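(* Let $M=SU(2)/I^*$ be the Poincaré dodecahedral space with its spherical metric $g_0$, let $E=E_{168}(g_0)$, and let $F_0\in E$ be a nonzero generator of the unique $I^*$-invariant line in $E$. There exists an open neighborhood $U\subset\mathbb P(E)$ of $[F_0]$ such that $U\subset\ell(\Omega)$. Equivalently, every projective line in $U$ is realized as the simple lowest eigendirection of some operator in $\mathscr B$.
   Context: $I^*\subset SU(2)$ is the binary icosahedral group; $SU(2)\cong S^3$ has the round metric of curvature $1$, and $M=SU(2)/I^*$ (left cosets $aI^*$) carries the induced metric $g_0$. $E=E_{168}(g_0)$ is the real eigenspace of the nonnegative Laplacian of $g_0$ for its first positive eigenvalue $168$; $\dim E=13$. $E$ is equipped with the $L^2(M,g_0)$ inner product, and $\operatorname{Sym}(E)$ is the space of self-adjoint operators on $E$. The group $SU(2)$ acts orthogonally on $E$ by $(L_af)(x)=f(a^{-1}x)$; the subspace of $E$ fixed by $I^*$ under this action is one-dimensional, and this is the unique $I^*$-invariant line. $\mathcal P=\operatorname{span}\{fg: f,g\in E\}\subset L^2(M,g_0)$ (finite-dimensional). For $q\in C^\infty(M)$ define $B(q)\in\operatorname{Sym}(E)$ by $\langle B(q)f,g\rangle_{L^2(M,g_0)}=-\int_M q\,fg\,dV_{g_0}$ for $f,g\in E$, and let $\mathscr B=B(\mathcal P)\subset\operatorname{Sym}(E)$. For $A\in\mathscr B$ let $\lambda_1(A)\le\lambda_2(A)\le\cdots$ be its eigenvalues with multiplicity. $\Omega=\{A\in\mathscr B:\lambda_1(A)<\lambda_2(A)\}$,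 and for $A\in\Omega$, $\ell(A)\in\mathbb P(E)$ is the eigenline of $A$ for $\lambda_1(A)$. *)

theory Defs
  imports
    "HOL-Analysis.Analysis"
    "HOL-Library.Function_Algebras"
    "HOL-Library.Multiset"
begin

section \<open>Spaces of functions as real vector spaces\<close>

instantiation "fun" :: (type, real_vector) real_vector
begin

definition scaleR_fun :: "real \<Rightarrow> ('a \<Rightarrow> 'b) \<Rightarrow> 'a \<Rightarrow> 'b"
  where "scaleR_fun c f = (\<lambda>x. c *\<^sub>R f x)"

instance
  by standard
    (auto simp: scaleR_fun_def plus_fun_def fun_eq_iff scaleR_add_right scaleR_add_left)

end

section \<open>The group SU(2) and the binary icosahedral group\<close>

type_synonym mat2 = "complex^2^2"

definition mat2 :: "complex \<Rightarrow> complex \<Rightarrow> complex \<Rightarrow> complex \<Rightarrow> mat2"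
  where "mat2 a b c d = vector [vector [a, b], vector [c, d]]"

definition conj_transpose :: "mat2 \<Rightarrow> mat2"
  where "conj_transpose A = (\<chi> i j. cnj (A $ j $ i))"

definition SU2 :: "mat2 set"
  where "SU2 = {A. A ** conj_transpose A = mat 1 \<and> det A = 1}"

text \<open>
  Vectors \<open>v\<close> of \<open>\<real>\<^sup>3\<close> are encoded as traceless Hermitian matrices \<open>v \<cdot> \<sigma>\<close>
  (Pauli matrices).  On these, \<open>X \<mapsto> A X A\<^sup>*\<close> with \<open>A\<close> in SU(2) is the rotation
  that is the image of \<open>A\<close> under the double cover of SO(3).
\<close>

definition pauli :: "real \<Rightarrow> real \<Rightarrow> real \<Rightarrow> mat2"
  where "pauli x y z = mat2 (of_real z) (Complex x (- y)) (Complex x y) (of_real (- z))"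

text \<open>
  The regular icosahedron inscribed in the unit sphere, in Klein's position: the
  two poles, the upper ring at height \<open>1 / sqrt 5\<close>, and the antipodes of that ring.
\<close>

definition icosahedron_upper :: "mat2 set"
  where "icosahedron_upper = insert (pauli 0 0 1)
    ((\<lambda>k::nat. pauli (2 / sqrt 5 * cos (2 * pi * real k / 5))
                     (2 / sqrt 5 * sin (2 * pi * real k / 5)) (1 / sqrt 5)) ` {..<5})"

definition icosahedron :: "mat2 set"
  where "icosahedron = icosahedron_upper \<union> uminus ` icosahedron_upper"

text \<open>The preimage in SU(2) of the rotation group of the icosahedron.\<close>

definition Istar :: "mat2 set"
  where "Istar = {A \<in> SU2. (\<lambda>X. A ** X ** conj_transpose A) ` icosahedron = icosahedron}"

section \<open>The Poincare dodecahedral space\<close>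

definition coset :: "mat2 \<Rightarrow> mat2 set"
  where "coset a = (\<lambda>h. a ** h) ` Istar"

definition PDS :: "mat2 set set"
  where "PDS = coset ` SU2"

section \<open>Smooth functions\<close>

fun Ck_on :: "nat \<Rightarrow> 'a::euclidean_space set \<Rightarrow> ('a \<Rightarrow> real) \<Rightarrow> bool"
  where
    "Ck_on 0 U g \<longleftrightarrow> continuous_on U g"
  | "Ck_on (Suc k) U g \<longleftrightarrow>
      (\<exists>g'. (\<forall>x\<in>U. (g has_derivative g' x) (at x)) \<and> (\<forall>v. Ck_on k U (\<lambda>x. g' x v)))"

text \<open>
  A function on an embedded submanifold \<open>S\<close> of a Euclidean space is smooth iff it
  is locally the restriction of a smooth function on an open subset of that space.
\<close>

definition smooth_on_submanifold :: "'a::euclidean_space set \<Rightarrow> ('a \<Rightarrow> real) \<Rightarrow> bool"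
  where "smooth_on_submanifold S f \<longleftrightarrow>
    (\<forall>x\<in>S. \<exists>U g. open U \<and> x \<in> U \<and> (\<forall>k. Ck_on k U g) \<and> (\<forall>y\<in>U \<inter> S. g y = f y))"

text \<open>
  A function on the quotient is represented as a function on all sets of matrices
  that vanishes off \<open>PDS\<close>; this makes sums and scalar multiples the pointwise ones.
  The quotient map \<open>coset\<close> is a covering, so smoothness can be tested upstairs.
\<close>

definition Cinf_PDS :: "(mat2 set \<Rightarrow> real) set"
  where "Cinf_PDS = {f. (\<forall>x. x \<notin> PDS \<longrightarrow> f x = 0) \<and> smooth_on_submanifold SU2 (f \<circ> coset)}"

section \<open>The round metric: Laplacian and volume\<close>

text \<open>
  SU(2) is the unit sphere of the real span of \<open>1, e\<^sub>1, e\<^sub>2, e\<^sub>3\<close> below (the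
  quaternions), these four matrices being orthonormal; this is half of the
  Frobenius inner product, and it induces the round metric of curvature 1.  It is
  bi-invariant, so for \<open>x\<close> in SU(2) the matrices \<open>x e\<^sub>i\<close> are an orthonormal basis of
  the tangent space at \<open>x\<close>.  The geodesic with initial velocity \<open>x e\<^sub>i\<close> is the great
  circle \<open>cos t x + sin t (x e\<^sub>i)\<close>, which is \<open>x exp (t e\<^sub>i)\<close>.
\<close>

definition quaternion_units :: "mat2 set"
  where "quaternion_units = {mat2 \<i> 0 0 (- \<i>), mat2 0 1 (- 1) 0, mat2 0 \<i> \<i> 0}"

text \<open>
  The nonnegative Laplacian is minus the trace of the Riemannian Hessian, and the
  Hessian on a unit vector is the second derivative along the geodesic.
\<close>

definition laplacian_SU2 :: "(mat2 \<Rightarrow> real) \<Rightarrow> mat2 \<Rightarrow> real"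
  where "laplacian_SU2 f x =
    - (\<Sum>e\<in>quaternion_units. (deriv ^^ 2) (\<lambda>t. f (cos t *\<^sub>R x + sin t *\<^sub>R (x ** e))) 0)"

text \<open>
  The real eigenspace of the Laplacian of the quotient metric.  As \<open>coset\<close> is a
  local isometry, that Laplacian is computed on the pullback to SU(2).
\<close>

definition laplace_eigenspace :: "real \<Rightarrow> (mat2 set \<Rightarrow> real) set"
  where "laplace_eigenspace \<mu> =
    {f \<in> Cinf_PDS. \<forall>a\<in>SU2. laplacian_SU2 (f \<circ> coset) a = \<mu> * f (coset a)}"

abbreviation E168 :: "(mat2 set \<Rightarrow> real) set"
  where "E168 \<equiv> laplace_eigenspace 168"

text \<open>
  Riemannian volume of the unit 3-sphere, identified with SU(2) through the first
  column: by polar coordinates, the volume of a subset is 4 times the Lebesgue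
  measure of the cone over it inside the unit ball.
\<close>

definition SU2_of_sphere :: "complex^2 \<Rightarrow> mat2"
  where "SU2_of_sphere z = mat2 (z $ 1) (- cnj (z $ 2)) (z $ 2) (cnj (z $ 1))"

definition vol_SU2 :: "mat2 measure"
  where "vol_SU2 = scale_measure 4
    (distr (restrict_space lborel (cball 0 1 - {0})) borel (\<lambda>z. SU2_of_sphere (sgn z)))"

text \<open>
  Integration against the Riemannian volume of the quotient: \<open>coset\<close> is a locally
  isometric covering with \<open>card Istar\<close> sheets.
\<close>

definition integral_PDS :: "(mat2 set \<Rightarrow> real) \<Rightarrow> real"
  where "integral_PDS f = (LINT a|vol_SU2. f (coset a)) / real (card Istar)"

definition L2_inner :: "(mat2 set \<Rightarrow> real) \<Rightarrow> (mat2 set \<Rightarrow> real) \<Rightarrow> real"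
  where "L2_inner f g = integral_PDS (f * g)"

definition L2_dist :: "(mat2 set \<Rightarrow> real) \<Rightarrow> (mat2 set \<Rightarrow> real) \<Rightarrow> real"
  where "L2_dist f g = sqrt (L2_inner (f - g) (f - g))"

section \<open>The action of SU(2)\<close>

definition left_translate :: "mat2 \<Rightarrow> (mat2 set \<Rightarrow> real) \<Rightarrow> mat2 set \<Rightarrow> real"
  where "left_translate a f = (\<lambda>x. f ((\<lambda>y. matrix_inv a ** y) ` x))"

definition Istar_fixed :: "(mat2 set \<Rightarrow> real) set"
  where "Istar_fixed = {f \<in> E168. \<forall>a\<in>Istar. left_translate a f = f}"

section \<open>Operators on the eigenspace\<close>

definition Sym_E :: "((mat2 set \<Rightarrow> real) \<Rightarrow> (mat2 set \<Rightarrow> real)) set"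
  where "Sym_E = {A \<in> E168 \<rightarrow>\<^sub>E E168.
    (\<forall>f\<in>E168. \<forall>g\<in>E168. A (f + g) = A f + A g) \<and>
    (\<forall>c. \<forall>f\<in>E168. A (c *\<^sub>R f) = c *\<^sub>R A f) \<and>
    (\<forall>f\<in>E168. \<forall>g\<in>E168. L2_inner (A f) g = L2_inner f (A g))}"

definition products_E :: "(mat2 set \<Rightarrow> real) set"
  where "products_E = span {f * g | f g. f \<in> E168 \<and> g \<in> E168}"

definition B_op :: "(mat2 set \<Rightarrow> real) \<Rightarrow> (mat2 set \<Rightarrow> real) \<Rightarrow> (mat2 set \<Rightarrow> real)"
  where "B_op q = (THE A. A \<in> Sym_E \<and>
    (\<forall>f\<in>E168. \<forall>g\<in>E168. L2_inner (A f) g = - integral_PDS (q * f * g)))"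

definition B_ops :: "((mat2 set \<Rightarrow> real) \<Rightarrow> (mat2 set \<Rightarrow> real)) set"
  where "B_ops = B_op ` products_E"

definition op_eigenspace ::
  "((mat2 set \<Rightarrow> real) \<Rightarrow> (mat2 set \<Rightarrow> real)) \<Rightarrow> real \<Rightarrow> (mat2 set \<Rightarrow> real) set"
  where "op_eigenspace A \<mu> = {f \<in> E168. A f = \<mu> *\<^sub>R f}"

definition op_spectrum :: "((mat2 set \<Rightarrow> real) \<Rightarrow> (mat2 set \<Rightarrow> real)) \<Rightarrow> real set"
  where "op_spectrum A = {\<mu>. \<exists>f\<in>op_eigenspace A \<mu>. f \<noteq> 0}"

text \<open>\<open>eigenvalue A k\<close> is \<open>\<lambda>\<^sub>k(A)\<close>, with \<open>k\<close> starting at 1.\<close>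

definition eigenvalue :: "((mat2 set \<Rightarrow> real) \<Rightarrow> (mat2 set \<Rightarrow> real)) \<Rightarrow> nat \<Rightarrow> real"
  where "eigenvalue A k =
    sorted_list_of_multiset
      (\<Sum>\<mu>\<in>op_spectrum A. replicate_mset (dim (op_eigenspace A \<mu>)) \<mu>) ! (k - 1)"

definition Omega :: "((mat2 set \<Rightarrow> real) \<Rightarrow> (mat2 set \<Rightarrow> real)) set"
  where "Omega = {A \<in> B_ops. eigenvalue A 1 < eigenvalue A 2}"

definition lowest_line ::
  "((mat2 set \<Rightarrow> real) \<Rightarrow> (mat2 set \<Rightarrow> real)) \<Rightarrow> (mat2 set \<Rightarrow> real) set"
  where "lowest_line A = op_eigenspace A (eigenvalue A 1)"

section \<open>The projective space of the eigenspace\<close>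

definition quotient_topology :: "'a topology \<Rightarrow> ('a \<Rightarrow> 'b) \<Rightarrow> 'b topology"
  where "quotient_topology X q =
    topology (\<lambda>U. U \<subseteq> q ` topspace X \<and> openin X {x \<in> topspace X. q x \<in> U})"

lemma openin_quotient_topology:
  "openin (quotient_topology X q) U \<longleftrightarrow>
    U \<subseteq> q ` topspace X \<and> openin X {x \<in> topspace X. q x \<in> U}"
proof -
  have "istopology (\<lambda>U. U \<subseteq> q ` topspace X \<and> openin X {x \<in> topspace X. q x \<in> U})"
    unfolding istopology_def
  proof (intro conjI allI impI)
    fix S T assume "S \<subseteq> q ` topspace X \<and> openin X {x \<in> topspace X. q x \<in> S}"
      and "T \<subseteq> q ` topspace X \<and> openin X {x \<in> topspace X. q x \<in> T}"
    moreover have "{x \<in> topspace X. q x \<in> S \<inter> T} =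
        {x \<in> topspace X. q x \<in> S} \<inter> {x \<in> topspace X. q x \<in> T}" by auto
    ultimately show "S \<inter> T \<subseteq> q ` topspace X" "openin X {x \<in> topspace X. q x \<in> S \<inter> T}"
      by auto
  next
    fix K assume K: "\<forall>S\<in>K. S \<subseteq> q ` topspace X \<and> openin X {x \<in> topspace X. q x \<in> S}"
    then show "\<Union>K \<subseteq> q ` topspace X" by auto
    have "{x \<in> topspace X. q x \<in> \<Union>K} = (\<Union>S\<in>K. {x \<in> topspace X. q x \<in> S})" by auto
    then show "openin X {x \<in> topspace X. q x \<in> \<Union>K}" using K by auto
  qed
  then show ?thesis
    by (simp add: quotient_topology_def topology_inverse')
qed

text \<open>
  Points are the lines \<open>span {f}\<close>, as subsets of the eigenspace; the topology is the
  quotient of the one that the \<open>L\<^sup>2\<close> metric gives on the nonzero vectors.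
\<close>

definition projective_E :: "(mat2 set \<Rightarrow> real) set topology"
  where "projective_E =
    quotient_topology (Metric_space.mtopology (E168 - {0}) L2_dist) (\<lambda>f. span {f})"

end

theory Submission
  imports Defs
begin

text \<open>
  Write \<open>e\<close> for the base point, the coset of the identity. By the Riesz lemma, evaluation at
  \<open>e\<close> is \<open>f \<mapsto> \<langle>K, f\<rangle>\<close> on \<open>E168\<close> for some \<open>K\<close> in \<open>E168\<close>, and it is \<open>p \<mapsto> \<langle>q\<^sub>0, p\<rangle>\<close> on the
  space of products for some \<open>q\<^sub>0\<close> in that space. Hence
  \<open>\<langle>B(q\<^sub>0) f, g\<rangle> = - (f g)(e) = - \<langle>f, K\<rangle> \<langle>K, g\<rangle>\<close>: minus the rank one operator \<open>K \<otimes> K\<close> belongs to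
  the family of operators, and \<open>K\<close> spans its simple lowest eigenspace
  (\<open>evaluation_rank_one\<close>). The point \<open>e\<close> is fixed by the left action of \<open>Istar\<close>, so \<open>K\<close> is an
  \<open>Istar\<close>-fixed vector, and it is nonzero because \<open>SU2\<close> acts transitively. As the fixed
  vectors form a line, \<open>F0\<close> is a multiple of \<open>K\<close>.

  It remains to perturb. The map \<open>q \<mapsto> B(q) K\<close> is onto the eigenspace
  (\<open>B_op_surjective_at\<close>): if \<open>g\<close> is orthogonal to its image, then \<open>q = K g\<close> gives
  \<open>\<integral> (K g)\<^sup>2 = 0\<close>, so \<open>g\<close> vanishes near \<open>e\<close>, where \<open>K\<close> does not vanish, and then \<open>g = 0\<close> by
  unique continuation. Surjectivity is an open condition, so for \<open>F\<close> close to \<open>K\<close> one can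
  correct \<open>q\<^sub>0\<close> by a small term that makes \<open>F\<close> an exact eigenvector; the spectral gap of
  \<open>- K \<otimes> K\<close> survives a small correction (\<open>stable_lowest_direction\<close>).

  The analytic input is that \<open>E168\<close> is finite-dimensional and that its \<open>Istar\<close>-fixed part is a
  line. Both come from the functions \<open>\<ell>\<^sup>n\<close>, where \<open>\<ell>(A) = det [w, A v]\<close> for \<open>w\<close>, \<open>v\<close> in \<open>\<complex>\<^sup>2\<close>.
  These are eigenfunctions for \<open>n (n + 2)\<close> and together they span a dense space, as follows
  from the relation \<open>det A = 1\<close> and the Stone--Weierstrass theorem. The Laplacian is symmetric,
  by right invariance of the volume, so an eigenfunction for \<open>168 = 12 \<cdot> 14\<close> is orthogonal to all
  \<open>\<ell>\<^sup>n\<close> with \<open>n \<noteq> 12\<close> and is determined by the finitely many coefficients of the form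
  \<open>(w, v) \<mapsto> \<integral> f \<ell>\<^sup>1\<^sup>2\<close>. If \<open>f\<close> is invariant under \<open>Istar\<close> on both sides, this form is an invariant
  binary form of degree 12 in \<open>w\<close> and in \<open>v\<close>. Such forms are multiples of a single one, Klein's
  \<open>x y (x\<^sup>1\<^sup>0 - 11 x\<^sup>5 y\<^sup>5 - y\<^sup>1\<^sup>0)\<close>, whose zeros are the vertices of the icosahedron. This gives the
  one-dimensionality.

  Unique continuation needs no regularity theory: the functions in \<open>E168\<close> that vanish near \<open>e\<close>
  form a finite-dimensional space, hence they vanish on a common neighbourhood, hence that
  space is stable under small translations, and \<open>SU2\<close> is connected.
\<close>

section \<open>Finite-dimensional inner product spaces and symmetric operators\<close>

text \<open>
  A finite-dimensional subspace \<open>S\<close> of an arbitrary real vector space with an inner product that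
  need only be defined on \<open>S\<close>. The vector space in the application is a space of functions, which
  carries no norm, so the inner product cannot be the one of a type class.
\<close>

locale inner_space =
  fixes S :: "'v::real_vector set" and ip :: "'v \<Rightarrow> 'v \<Rightarrow> real"
  assumes subspace_S: "subspace S"
    and finite_span: "\<exists>B. finite B \<and> S \<subseteq> span B"
    and ip_add: "\<lbrakk>f \<in> S; g \<in> S; h \<in> S\<rbrakk> \<Longrightarrow> ip (f + g) h = ip f h + ip g h"
    and ip_scale: "\<lbrakk>f \<in> S; g \<in> S\<rbrakk> \<Longrightarrow> ip (c *\<^sub>R f) g = c * ip f g"
    and ip_commute: "\<lbrakk>f \<in> S; g \<in> S\<rbrakk> \<Longrightarrow> ip f g = ip g f"
    and ip_pos: "\<lbrakk>f \<in> S; f \<noteq> 0\<rbrakk> \<Longrightarrow> ip f f > 0"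
begin

definition nrm :: "'v \<Rightarrow> real" where "nrm f = sqrt (ip f f)"

definition linop :: "('v \<Rightarrow> 'v) \<Rightarrow> bool"
  where "linop T \<longleftrightarrow> (\<forall>f\<in>S. T f \<in> S) \<and> (\<forall>f\<in>S. \<forall>g\<in>S. T (f + g) = T f + T g)
    \<and> (\<forall>c. \<forall>f\<in>S. T (c *\<^sub>R f) = c *\<^sub>R T f)"

lemma linopD:
  assumes "linop T"
  shows "f \<in> S \<Longrightarrow> T f \<in> S" "\<lbrakk>f \<in> S; g \<in> S\<rbrakk> \<Longrightarrow> T (f + g) = T f + T g"
    "f \<in> S \<Longrightarrow> T (c *\<^sub>R f) = c *\<^sub>R T f"
  using assms by (auto simp: linop_def)

lemma S_zero [simp]: "0 \<in> S" using subspace_S by (rule subspace_0)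
lemma S_add [simp]: "f \<in> S \<Longrightarrow> g \<in> S \<Longrightarrow> f + g \<in> S" using subspace_S by (rule subspace_add)
lemma S_scale [simp]: "f \<in> S \<Longrightarrow> c *\<^sub>R f \<in> S" using subspace_S by (rule subspace_scale)
lemma S_diff [simp]: "f \<in> S \<Longrightarrow> g \<in> S \<Longrightarrow> f - g \<in> S" using subspace_S by (rule subspace_diff)
lemma S_sum: "(\<And>b. b \<in> B \<Longrightarrow> f b \<in> S) \<Longrightarrow> sum f B \<in> S"
  using subspace_S by (rule subspace_sum)

lemma ip_add2: "\<lbrakk>f \<in> S; g \<in> S; h \<in> S\<rbrakk> \<Longrightarrow> ip h (f + g) = ip h f + ip h g"
  using ip_add[of f g h] ip_commute S_add by metis

lemma ip_scale2: "\<lbrakk>f \<in> S; g \<in> S\<rbrakk> \<Longrightarrow> ip g (c *\<^sub>R f) = c * ip g f"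
  using ip_scale[of f g c] ip_commute S_scale by metis

lemma ip_zero [simp]: "f \<in> S \<Longrightarrow> ip 0 f = 0" "f \<in> S \<Longrightarrow> ip f 0 = 0"
  using ip_scale[of f f 0] ip_scale2[of f f 0] by auto

lemma ip_diff: "\<lbrakk>f \<in> S; g \<in> S; h \<in> S\<rbrakk> \<Longrightarrow> ip (f - g) h = ip f h - ip g h"
  using ip_add[of "f - g" g h] by simp

lemma ip_diff2: "\<lbrakk>f \<in> S; g \<in> S; h \<in> S\<rbrakk> \<Longrightarrow> ip h (f - g) = ip h f - ip h g"
  using ip_add2[of "f - g" g h] by simp

lemmas ip_simps = ip_add ip_add2 ip_scale ip_scale2 ip_diff ip_diff2

lemma ip_sum: "(\<And>b. b \<in> B \<Longrightarrow> f b \<in> S) \<Longrightarrow> h \<in> S \<Longrightarrow> ip (sum f B) h = (\<Sum>b\<in>B. ip (f b) h)"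
proof (induction B rule: infinite_finite_induct)
  case (insert x F)
  have "f x \<in> S" "sum f F \<in> S" using insert.prems(1) by (auto intro!: S_sum)
  then show ?case using insert by (simp add: ip_add)
qed auto

lemma ip_nonneg: "f \<in> S \<Longrightarrow> ip f f \<ge> 0"
  using ip_pos[of f] by (cases "f = 0") auto

lemma ip_self_eq_0: "f \<in> S \<Longrightarrow> ip f f = 0 \<longleftrightarrow> f = 0"
  using ip_pos[of f] by (cases "f = 0") auto

lemma nrm_nonneg [simp]: "f \<in> S \<Longrightarrow> nrm f \<ge> 0" by (simp add: nrm_def ip_nonneg)
lemma nrm_sq: "f \<in> S \<Longrightarrow> (nrm f)\<^sup>2 = ip f f" by (simp add: nrm_def ip_nonneg)
lemma nrm_eq_0: "f \<in> S \<Longrightarrow> nrm f = 0 \<longleftrightarrow> f = 0" by (simp add: nrm_def ip_self_eq_0)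
lemma nrm_scale: "f \<in> S \<Longrightarrow> nrm (c *\<^sub>R f) = \<bar>c\<bar> * nrm f"
  by (simp add: nrm_def ip_scale ip_scale2 real_sqrt_mult flip: mult.assoc)

text \<open>
  The discriminant of the nonnegative quadratic polynomial \<open>x \<mapsto> \<langle>T (x f + g), x f + g\<rangle>\<close>. It is
  needed for forms that may be degenerate; \<open>T = id\<close> gives the usual inequality.
\<close>

lemma semidefinite_Cauchy_Schwarz:
  assumes T: "linop T" and sym: "\<And>f g. f \<in> S \<Longrightarrow> g \<in> S \<Longrightarrow> ip (T f) g = ip f (T g)"
    and pos: "\<And>f. f \<in> S \<Longrightarrow> ip (T f) f \<ge> 0" and fg: "f \<in> S" "g \<in> S"
  shows "(ip (T f) g)\<^sup>2 \<le> ip (T f) f * ip (T g) g"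
proof -
  have TS: "T f \<in> S" "T g \<in> S" using T fg by (auto simp: linop_def)
  define a b d where "a = ip (T f) f" and "b = ip (T f) g" and "d = ip (T g) g"
  have b': "ip (T g) f = b"
    using sym[of g f] ip_commute[of g "T f"] fg TS by (simp add: b_def)
  have quad: "a * x\<^sup>2 + 2 * b * x + d \<ge> 0" for x
  proof -
    have "T (x *\<^sub>R f + g) = x *\<^sub>R T f + T g"
      using T fg by (simp add: linop_def)
    then have "ip (T (x *\<^sub>R f + g)) (x *\<^sub>R f + g) = a * x\<^sup>2 + 2 * b * x + d"
      using fg TS b' by (simp add: ip_simps a_def b_def d_def power2_eq_square algebra_simps)
    then show ?thesis using pos[of "x *\<^sub>R f + g"] fg by simp
  qed
  show ?thesis
  proof (cases "a = 0")
    case True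
    have "b = 0"
    proof (rule ccontr)
      assume "b \<noteq> 0"
      then have "2 * b * (- (d + 1) / (2 * b)) + d = -1" by simp
      with quad[of "- (d + 1) / (2 * b)"] True show False by simp
    qed
    then show ?thesis using True by (simp add: a_def b_def)
  next
    case False
    have a: "a > 0" using False pos[OF fg(1)] by (simp add: a_def)
    have "a * (-b/a)\<^sup>2 + 2 * b * (-b/a) + d = d - b\<^sup>2 / a"
      using a by (simp add: power2_eq_square field_simps)
    then have "b\<^sup>2 / a \<le> d" using quad[of "-b/a"] by simp
    then show ?thesis using a by (simp add: a_def b_def d_def field_simps)
  qed
qed

lemma Cauchy_Schwarz: "f \<in> S \<Longrightarrow> g \<in> S \<Longrightarrow> \<bar>ip f g\<bar> \<le> nrm f * nrm g"
proof -
  assume fg: "f \<in> S" "g \<in> S"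
  have "(ip f g)\<^sup>2 \<le> ip f f * ip g g"
    by (rule semidefinite_Cauchy_Schwarz[where T = "\<lambda>x. x"]) (auto simp: linop_def ip_nonneg fg)
  then have "\<bar>ip f g\<bar>\<^sup>2 \<le> (nrm f * nrm g)\<^sup>2" using fg by (simp add: power_mult_distrib nrm_sq)
  then show ?thesis using fg by (simp add: power2_le_iff_abs_le)
qed

lemma nrm_triangle: "f \<in> S \<Longrightarrow> g \<in> S \<Longrightarrow> nrm (f + g) \<le> nrm f + nrm g"
proof -
  assume fg: "f \<in> S" "g \<in> S"
  have "(nrm (f + g))\<^sup>2 = (nrm f)\<^sup>2 + 2 * ip f g + (nrm g)\<^sup>2"
    using fg ip_commute[of g f] by (simp add: nrm_sq ip_simps)
  also have "\<dots> \<le> (nrm f + nrm g)\<^sup>2"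
    using Cauchy_Schwarz[OF fg] by (simp add: power2_sum abs_le_iff)
  finally show ?thesis by (rule power2_le_imp_le) (use fg in auto)
qed

lemma nrm_minus_commute: "f \<in> S \<Longrightarrow> g \<in> S \<Longrightarrow> nrm (f - g) = nrm (g - f)"
  using nrm_scale[of "f - g" "-1"] by simp

lemma nrm_sum: "(\<And>b. b \<in> B \<Longrightarrow> f b \<in> S) \<Longrightarrow> nrm (sum f B) \<le> (\<Sum>b\<in>B. nrm (f b))"
proof (induction B rule: infinite_finite_induct)
  case (insert x F)
  have "f x \<in> S" "sum f F \<in> S" using insert.prems(1) by (auto intro!: S_sum)
  then have "nrm (f x + sum f F) \<le> nrm (f x) + nrm (sum f F)" by (rule nrm_triangle)
  moreover have "nrm (sum f F) \<le> (\<Sum>b\<in>F. nrm (f b))" using insert.prems by (intro insert.IH) auto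
  ultimately show ?case using insert.hyps by simp
qed (auto simp: nrm_def)

text \<open>
  Gram--Schmidt, one vector at a time.
\<close>

lemma orthogonal_basis_of_span:
  assumes "finite B" "B \<subseteq> S"
  shows "\<exists>C. finite C \<and> C \<subseteq> S \<and> span C = span B \<and>
    (\<forall>b\<in>C. \<forall>c\<in>C. ip b c = (if b = c then 1 else 0))"
  using assms
proof (induction B)
  case empty
  then show ?case by (intro exI[of _ "{}"]) auto
next
  case (insert x B)
  then obtain C where C: "finite C" "C \<subseteq> S" "span C = span B"
    "\<And>b c. b \<in> C \<Longrightarrow> c \<in> C \<Longrightarrow> ip b c = (if b = c then 1 else 0)" by auto
  define p where "p = (\<Sum>b\<in>C. ip x b *\<^sub>R b)"
  define y where "y = x - p"
  have xS: "x \<in> S" using insert by simp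
  have pS: "p \<in> S" unfolding p_def using C by (intro S_sum S_scale) auto
  have yS: "y \<in> S" using xS pS by (simp add: y_def)
  have psp: "p \<in> span C" by (auto simp: p_def intro: span_sum span_scale span_base)
  have orth: "ip y c = 0" if "c \<in> C" for c
  proof -
    have "ip p c = (\<Sum>b\<in>C. ip x b * ip b c)"
      unfolding p_def using C(2) that by (subst ip_sum) (auto simp: ip_scale subset_iff intro!: sum.cong)
    also have "\<dots> = (\<Sum>b\<in>C. if b = c then ip x b else 0)"
      by (rule sum.cong) (use C(4) that in auto)
    also have "\<dots> = ip x c" using C(1) that by simp
    finally show ?thesis using xS pS C that by (auto simp: y_def ip_diff subset_iff)
  qed
  show ?case
  proof (cases "y = 0")
    case True
    then have "x \<in> span B" using psp C by (simp add: y_def)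
    then show ?thesis using C by (intro exI[of _ C]) (auto simp: span_redundant)
  next
    case False
    define z where "z = (1 / nrm y) *\<^sub>R y"
    have ny: "nrm y > 0" using False yS nrm_eq_0[of y] nrm_nonneg[of y] by linarith
    have zS: "z \<in> S" using yS by (simp add: z_def)
    have zz: "ip z z = 1"
      using yS False ip_self_eq_0[OF yS] ny nrm_sq[OF yS]
      by (simp add: z_def ip_scale ip_scale2 power2_eq_square flip: times_divide_eq_right)
    have zc: "ip z c = 0" "ip c z = 0" if "c \<in> C" for c
      using that C yS orth[OF that] ip_commute[of c y]
      by (auto simp: z_def ip_scale ip_scale2 subset_iff)
    have "span (insert z C) = span (insert x C)"
    proof -
      have "z \<in> span (insert x C)"
        unfolding z_def y_def
        by (intro span_scale span_diff) (auto intro: span_base span_mono[THEN subsetD, OF _ psp])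
      moreover have "x = nrm y *\<^sub>R z + p" using ny by (simp add: z_def y_def)
      then have "x \<in> span (insert z C)"
        by (auto intro!: span_add span_scale intro: span_base span_mono[THEN subsetD, OF _ psp])
      ultimately show ?thesis
        unfolding span_eq by (auto intro: span_base)
    qed
    also have "\<dots> = span (insert x B)"
      unfolding span_insert C(3) ..
    finally have "span (insert z C) = span (insert x B)" .
    moreover have "z \<notin> C" using zz zc by fastforce
    ultimately show ?thesis using C(1,2,4) zS zz zc
      by (intro exI[of _ "insert z C"]) auto
  qed
qed

lemma finite_basis: "\<exists>B. finite B \<and> B \<subseteq> S \<and> span B = S"
proof -
  obtain D where D: "finite D" "S \<subseteq> span D" using finite_span by auto
  obtain B where B: "B \<subseteq> S" "independent B" "S \<subseteq> span B"
    using maximal_independent_subset[of S] by auto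
  then have "finite B" using independent_span_bound[OF D(1) B(2)] D(2) by auto
  then show ?thesis using B span_minimal[OF B(1) subspace_S] by auto
qed

lemma orthonormal_basis:
  obtains C where "finite C" "C \<subseteq> S" "span C = S"
    "\<And>b c. b \<in> C \<Longrightarrow> c \<in> C \<Longrightarrow> ip b c = (if b = c then 1 else 0)"
    "\<And>f. f \<in> S \<Longrightarrow> f = (\<Sum>b\<in>C. ip f b *\<^sub>R b)"
    "\<And>f. f \<in> S \<Longrightarrow> ip f f = (\<Sum>b\<in>C. (ip f b)\<^sup>2)"
proof -
  obtain B where "finite B" "B \<subseteq> S" "span B = S" using finite_basis by auto
  then obtain C where C: "finite C" "C \<subseteq> S" "span C = S"
    "\<And>b c. b \<in> C \<Longrightarrow> c \<in> C \<Longrightarrow> ip b c = (if b = c then 1 else 0)"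
    using orthogonal_basis_of_span[of B] by auto
  have e: "f = (\<Sum>b\<in>C. ip f b *\<^sub>R b)" if f: "f \<in> S" for f
  proof -
    obtain u where u: "f = (\<Sum>b\<in>C. u b *\<^sub>R b)"
    proof -
      have "f \<in> range (\<lambda>u. \<Sum>b\<in>C. u b *\<^sub>R b)"
        using f C(3) span_finite[OF C(1)] by simp
      then show thesis using \<open>\<And>u. f = (\<Sum>b\<in>C. u b *\<^sub>R b) \<Longrightarrow> thesis\<close> by auto
    qed
    have "ip f c = u c" if "c \<in> C" for c
    proof -
      have "ip f c = (\<Sum>b\<in>C. u b * ip b c)"
        unfolding u using C(2) that by (subst ip_sum) (auto simp: ip_scale subset_iff intro!: sum.cong)
    also have "\<dots> = (\<Sum>b\<in>C. if b = c then u b else 0)"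
      by (rule sum.cong) (use C(4) that in auto)
      also have "\<dots> = u c" using C(1) that by simp
      finally show ?thesis .
    qed
    then show ?thesis by (subst u) (auto intro: sum.cong)
  qed
  have "ip f f = (\<Sum>b\<in>C. (ip f b)\<^sup>2)" if "f \<in> S" for f
  proof -
    have "ip f f = ip (\<Sum>b\<in>C. ip f b *\<^sub>R b) f" using e[OF that] by simp
    also have "\<dots> = (\<Sum>b\<in>C. (ip f b)\<^sup>2)"
      using C(2) that
      by (subst ip_sum)
        (auto simp: ip_scale ip_scale2 ip_commute[of _ f] subset_iff power2_eq_square
          intro!: sum.cong)
    finally show ?thesis .
  qed
  with C e that show ?thesis by blast
qed

lemma Riesz:
  assumes add: "\<And>f g. f \<in> S \<Longrightarrow> g \<in> S \<Longrightarrow> \<phi> (f + g) = \<phi> f + \<phi> g"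
    and scale: "\<And>c f. f \<in> S \<Longrightarrow> \<phi> (c *\<^sub>R f) = c * (\<phi> f :: real)"
  shows "\<exists>r\<in>S. \<forall>f\<in>S. ip r f = \<phi> f"
proof -
  obtain C where C: "finite C" "C \<subseteq> S" 
    "\<And>f. f \<in> S \<Longrightarrow> f = (\<Sum>b\<in>C. ip f b *\<^sub>R b)" using orthonormal_basis by metis
  have sum: "\<phi> (sum u B) = (\<Sum>b\<in>B. \<phi> (u b))" if "\<And>b. b \<in> B \<Longrightarrow> u b \<in> S" for u and B :: "'v set"
    using that
  proof (induction B rule: infinite_finite_induct)
    case (insert x F)
    have "u x \<in> S" "sum u F \<in> S" using insert.prems(1) by (auto intro!: S_sum)
    then show ?case using insert by (simp add: add)
  qed (use scale[of 0 0] in auto)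
  show ?thesis
  proof (intro bexI ballI)
    show rS: "(\<Sum>b\<in>C. \<phi> b *\<^sub>R b) \<in> S" using C(2) by (intro S_sum S_scale) auto
    fix f assume f: "f \<in> S"
    have "\<phi> f = (\<Sum>b\<in>C. ip f b * \<phi> b)"
      using C(2) by (subst C(3)[OF f], subst sum) (auto simp: scale subset_iff)
    also have "\<dots> = ip (\<Sum>b\<in>C. \<phi> b *\<^sub>R b) f"
      using C(2) f by (subst ip_sum)
        (auto simp: ip_scale2[of _ f] ip_commute[of _ f] subset_iff intro!: sum.cong)
    finally show "ip (\<Sum>b\<in>C. \<phi> b *\<^sub>R b) f = \<phi> f" ..
  qed
qed

lemma ext_ip: "\<lbrakk>f \<in> S; g \<in> S; \<And>h. h \<in> S \<Longrightarrow> ip f h = ip g h\<rbrakk> \<Longrightarrow> f = g"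
  using ip_self_eq_0[of "f - g"] by (simp add: ip_diff)

lemma inner_space_subspace: "subspace R \<Longrightarrow> R \<subseteq> S \<Longrightarrow> inner_space R ip"
proof unfold_locales
  assume R: "subspace R" "R \<subseteq> S"
  show "subspace R" by fact
  show "\<exists>B. finite B \<and> R \<subseteq> span B" using finite_span R(2) by (metis order.trans)
qed (auto simp: subset_iff intro: ip_add ip_scale ip_commute ip_pos)

text \<open>
  The difference between a vector and its orthogonal projection to \<open>R\<close>, which the Riesz lemma for
  \<open>R\<close> provides, is orthogonal to \<open>R\<close>.
\<close>

lemma subspace_eq_if_orthogonal_trivial:
  assumes R: "subspace R" "R \<subseteq> S"
    and triv: "\<And>g. g \<in> S \<Longrightarrow> (\<And>r. r \<in> R \<Longrightarrow> ip r g = 0) \<Longrightarrow> g = 0"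
  shows "R = S"
proof
  show "S \<subseteq> R"
  proof
    fix f assume f: "f \<in> S"
    interpret R: inner_space R ip using inner_space_subspace R by blast
    obtain r where r: "r \<in> R" "\<And>s. s \<in> R \<Longrightarrow> ip r s = ip f s"
      using R.Riesz[of "ip f"] f R by (auto simp: ip_add2 ip_scale2 subset_iff)
    have "f - r = 0"
    proof (rule triv)
      fix s assume "s \<in> R"
      then show "ip s (f - r) = 0"
        using f r R ip_commute[of s f] ip_commute[of s r] by (auto simp: ip_diff2 subset_iff)
    qed (use f r R in auto)
    then show "f \<in> R" using r by simp
  qed
qed (use R in auto)

lemma linop_sum:
  assumes "linop T" "\<And>b. b \<in> B \<Longrightarrow> f b \<in> S"
  shows "T (sum f B) = (\<Sum>b\<in>B. T (f b))"
proof -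
  have "T (0 *\<^sub>R 0) = 0 *\<^sub>R T 0" by (rule linopD(3)[OF assms(1) S_zero])
  then have "T 0 = 0" by simp
  from assms(2) show ?thesis
  proof (induction B rule: infinite_finite_induct)
    case (insert x F)
    have "f x \<in> S" "sum f F \<in> S" using insert.prems by (auto intro!: S_sum)
    then have "T (f x + sum f F) = T (f x) + T (sum f F)" by (rule linopD(2)[OF assms(1)])
    then show ?case using insert by simp
  qed (use \<open>T 0 = 0\<close> in auto)
qed

text \<open>
  Otherwise the images of a basis together with a vector outside the range would be independent,
  one vector too many.
\<close>

lemma linop_injective_imp_surjective:
  assumes T: "linop T" and inj: "\<And>f. f \<in> S \<Longrightarrow> T f = 0 \<Longrightarrow> f = 0"
  shows "T ` S = S"
proof
  show "T ` S \<subseteq> S" using T by (auto simp: linop_def)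
  obtain B where B: "finite B" "B \<subseteq> S" "independent B" "S \<subseteq> span B"
    using maximal_independent_subset[of S] independent_span_bound finite_span by (metis order.trans)
  have injT: "inj_on T S"
  proof (rule inj_onI)
    fix f g assume fg: "f \<in> S" "g \<in> S" "T f = T g"
    have "T ((f - g) + g) = T (f - g) + T g" using fg by (intro linopD(2)[OF T] S_diff)
    then show "f = g" using inj[of "f - g"] fg by simp
  qed
  have ind: "independent (T ` B)"
  proof (rule independent_if_scalars_zero)
    show "finite (T ` B)" using B by simp
    fix u x assume s: "(\<Sum>x\<in>T ` B. u x *\<^sub>R x) = 0" and x: "x \<in> T ` B"
    have "(\<Sum>x\<in>T ` B. u x *\<^sub>R x) = (\<Sum>b\<in>B. u (T b) *\<^sub>R T b)"
      using injT B by (subst sum.reindex) (auto simp: inj_on_def subset_iff)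
    also have "\<dots> = (\<Sum>b\<in>B. T (u (T b) *\<^sub>R b))"
      using T B by (auto simp: linop_def subset_iff)
    also have "\<dots> = T (\<Sum>b\<in>B. u (T b) *\<^sub>R b)"
      using T B by (subst linop_sum) (auto)
    moreover have "(\<Sum>b\<in>B. u (T b) *\<^sub>R b) \<in> S" using B by (intro S_sum S_scale) auto
    ultimately have "(\<Sum>b\<in>B. u (T b) *\<^sub>R b) = 0" using inj s by auto
    then have "\<forall>b\<in>B. u (T b) = 0" using independentD[OF B(3,1) order_refl, of "\<lambda>b. u (T b)"] by auto
    then show "u x = 0" using x by auto
  qed
  show "S \<subseteq> T ` S"
  proof (rule ccontr)
    assume "\<not> S \<subseteq> T ` S"
    then obtain h where h: "h \<in> S" "h \<notin> T ` S" by auto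
    have sub: "span (T ` B) \<subseteq> T ` S"
    proof
      fix y assume "y \<in> span (T ` B)"
      then obtain u where u: "y = (\<Sum>x\<in>T ` B. u x *\<^sub>R x)" using B(1) by (auto simp: span_finite)
      have "(\<Sum>x\<in>T ` B. u x *\<^sub>R x) = (\<Sum>b\<in>B. u (T b) *\<^sub>R T b)"
        using injT B by (subst sum.reindex) (auto simp: inj_on_def subset_iff)
      also have "\<dots> = (\<Sum>b\<in>B. T (u (T b) *\<^sub>R b))"
        using T B by (auto simp: linop_def subset_iff)
      also have "\<dots> = T (\<Sum>b\<in>B. u (T b) *\<^sub>R b)"
        using T B by (subst linop_sum) (auto)
      moreover have "(\<Sum>b\<in>B. u (T b) *\<^sub>R b) \<in> S" using B by (intro S_sum S_scale) auto
      ultimately show "y \<in> T ` S" using u by auto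
    qed
    have "h \<notin> span (T ` B)" using h sub by auto
    then have "independent (insert h (T ` B))" using ind by (simp add: independent_insert)
    moreover have "insert h (T ` B) \<subseteq> span B" using h B T by (auto simp: linop_def subset_iff)
    ultimately have "card (insert h (T ` B)) \<le> card B"
      using independent_span_bound[OF B(1)] by blast
    moreover have "card (T ` B) = card B" using injT B by (meson card_image inj_on_subset)
    moreover have "h \<notin> T ` B" using h B by auto
    ultimately show False using B(1) by simp
  qed
qed

lemma linop_bounded:
  assumes T: "linop T"
  obtains M where "M \<ge> 0" "\<And>f. f \<in> S \<Longrightarrow> nrm (T f) \<le> M * nrm f"
proof -
  obtain C where C: "finite C" "C \<subseteq> S"
    "\<And>b c. b \<in> C \<Longrightarrow> c \<in> C \<Longrightarrow> ip b c = (if b = c then 1 else 0)"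
    "\<And>f. f \<in> S \<Longrightarrow> f = (\<Sum>b\<in>C. ip f b *\<^sub>R b)" using orthonormal_basis by metis
  have TS: "T f \<in> S" if "f \<in> S" for f using T that by (auto simp: linop_def)
  define M where "M = (\<Sum>b\<in>C. nrm (T b))"
  have "M \<ge> 0" unfolding M_def using C(2) TS by (auto intro!: sum_nonneg)
  moreover have "nrm (T f) \<le> M * nrm f" if f: "f \<in> S" for f
  proof -
    have "T f = (\<Sum>b\<in>C. T (ip f b *\<^sub>R b))"
      using C(2) T by (subst C(4)[OF f], subst linop_sum) auto
    also have "\<dots> = (\<Sum>b\<in>C. ip f b *\<^sub>R T b)"
      using T C(2) by (auto simp: linop_def subset_iff)
    finally have "nrm (T f) \<le> (\<Sum>b\<in>C. nrm (ip f b *\<^sub>R T b))"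
      using nrm_sum[of C "\<lambda>b. ip f b *\<^sub>R T b"] TS C(2) by (auto simp: subset_iff)
    also have "\<dots> \<le> (\<Sum>b\<in>C. nrm f * nrm (T b))"
    proof (rule sum_mono)
      fix b assume b: "b \<in> C"
      then have bS: "b \<in> S" using C(2) by auto
      have "nrm b = 1" using C(3)[OF b b] by (simp add: nrm_def)
      then have "\<bar>ip f b\<bar> \<le> nrm f" using Cauchy_Schwarz[OF f bS] by simp
      then show "nrm (ip f b *\<^sub>R T b) \<le> nrm f * nrm (T b)"
        using TS bS by (simp add: nrm_scale mult_right_mono)
    qed
    finally show ?thesis by (simp add: M_def sum_distrib_left mult.commute)
  qed
  ultimately show ?thesis using that by blast
qed

text \<open>
  The infimum \<open>m\<close> of the Rayleigh quotient is an eigenvalue. This is shown without compactness: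
  otherwise \<open>U = T - m\<close> is injective, hence surjective, and Cauchy--Schwarz for the semidefinite
  form of \<open>U\<close> bounds the square of every coordinate of \<open>f\<close> in an orthonormal basis by a multiple of
  \<open>\<langle>U f, f\<rangle>\<close>. So \<open>U\<close> is bounded below by a positive constant, and \<open>m\<close> was not the infimum.
\<close>

lemma symmetric_eigenvalue_exists:
  assumes T: "linop T" and sym: "\<And>f g. f \<in> S \<Longrightarrow> g \<in> S \<Longrightarrow> ip (T f) g = ip f (T g)"
    and nontriv: "S \<noteq> {0}"
  shows "\<exists>\<mu>. \<exists>f\<in>S. f \<noteq> 0 \<and> T f = \<mu> *\<^sub>R f"
proof (rule ccontr)
  assume no: "\<not> ?thesis"
  have TS: "T f \<in> S" if "f \<in> S" for f using T that by (auto simp: linop_def)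
  obtain M where M: "M \<ge> 0" "\<And>f. f \<in> S \<Longrightarrow> nrm (T f) \<le> M * nrm f" using linop_bounded[OF T] by blast
  define R where "R = {ip (T f) f / ip f f | f. f \<in> S \<and> f \<noteq> 0}"
  define m where "m = Inf R"
  have ne: "R \<noteq> {}" using nontriv S_zero by (auto simp: R_def)
  have bdd: "bdd_below R"
  proof (rule bdd_belowI)
    fix r assume "r \<in> R"
    then obtain f where f: "f \<in> S" "f \<noteq> 0" "r = ip (T f) f / ip f f" by (auto simp: R_def)
    have "\<bar>ip (T f) f\<bar> \<le> nrm (T f) * nrm f" using f TS by (intro Cauchy_Schwarz) auto
    also have "\<dots> \<le> M * nrm f * nrm f" using M f by (intro mult_right_mono) auto
    finally have "\<bar>ip (T f) f\<bar> \<le> M * ip f f"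
      using f nrm_sq[of f] by (simp add: power2_eq_square mult.assoc)
    then have "- M * ip f f \<le> ip (T f) f" by (auto simp: abs_le_iff)
    then show "- M \<le> r" using ip_pos[OF f(1,2)] f(3) by (simp add: pos_le_divide_eq)
  qed
  define U where "U = (\<lambda>f. T f - m *\<^sub>R f)"
  have U: "linop U" using T unfolding linop_def U_def by (auto simp: algebra_simps)
  have Usym: "ip (U f) g = ip f (U g)" if "f \<in> S" "g \<in> S" for f g
    using that sym TS by (simp add: U_def ip_simps)
  have Upos: "ip (U f) f \<ge> 0" if "f \<in> S" for f
  proof (cases "f = 0")
    case False
    then have "m \<le> ip (T f) f / ip f f"
      unfolding m_def using bdd that by (intro cInf_lower) (auto simp: R_def)
    then show ?thesis using ip_pos[OF that False] TS that by (simp add: U_def ip_simps pos_le_divide_eq)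
  qed (use that TS in \<open>auto simp: U_def\<close>)
  have "U ` S = S"
  proof (rule linop_injective_imp_surjective[OF U])
    fix f assume "f \<in> S" "U f = 0"
    then show "f = 0" using no by (auto simp: U_def)
  qed
  then have surj: "\<exists>k\<in>S. U k = h" if "h \<in> S" for h using that by (metis imageE)
  obtain C where C: "finite C" "C \<subseteq> S"
    "\<And>f. f \<in> S \<Longrightarrow> ip f f = (\<Sum>b\<in>C. (ip f b)\<^sup>2)" using orthonormal_basis by metis
  obtain k where k: "\<And>h. h \<in> C \<Longrightarrow> k h \<in> S \<and> U (k h) = h" using surj C(2) by (metis subsetD)
  define c where "c = (\<Sum>h\<in>C. ip (U (k h)) (k h)) + 1"
  have c: "c > 0" unfolding c_def proof (intro add_nonneg_pos sum_nonneg)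
    fix h assume "h \<in> C"
    then show "0 \<le> ip (U (k h)) (k h)" using k Upos by blast
  qed simp
  have coer: "ip f f \<le> c * ip (U f) f" if f: "f \<in> S" for f
  proof -
    have "ip f f = (\<Sum>h\<in>C. (ip f h)\<^sup>2)" using C f by blast
    also have "\<dots> \<le> (\<Sum>h\<in>C. ip (U f) f * ip (U (k h)) (k h))"
    proof (rule sum_mono)
      fix h assume h: "h \<in> C"
      have "ip (U f) (k h) = ip f h" using Usym[of f "k h"] f k[OF h] by simp
      then show "(ip f h)\<^sup>2 \<le> ip (U f) f * ip (U (k h)) (k h)"
        using semidefinite_Cauchy_Schwarz[OF U Usym Upos, of f "k h"] f k[OF h] by simp
    qed
    also have "\<dots> \<le> c * ip (U f) f"
      using Upos[OF f] by (simp add: c_def sum_distrib_left algebra_simps)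
    finally show ?thesis .
  qed
  have "m + 1 / c \<le> m" unfolding m_def[symmetric]
  proof (subst (2) m_def, rule cInf_greatest[OF ne])
    fix r assume "r \<in> R"
    then obtain f where f: "f \<in> S" "f \<noteq> 0" "r = ip (T f) f / ip f f" by (auto simp: R_def)
    have "ip (U f) f = ip (T f) f - m * ip f f" using f TS by (simp add: U_def ip_simps)
    then have "ip f f \<le> c * (ip (T f) f - m * ip f f)" using coer[OF f(1)] by simp
    then have "(m + 1 / c) * ip f f \<le> ip (T f) f" using c by (simp add: field_simps)
    then show "m + 1 / c \<le> r" using ip_pos[OF f(1,2)] f(3) by (simp add: pos_le_divide_eq)
  qed
  then show False using c by simp
qed

text \<open>
  If \<open>-K \<otimes> K\<close> is one of the operators and \<open>q \<mapsto> Bop q K\<close> is onto, then every \<open>F\<close> near \<open>K\<close> is a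
  strictly lowest eigenvector of an operator of the family. Fix parameters \<open>p h\<close> with
  \<open>Bop (p h) K = h\<close> for an orthonormal basis, and extend linearly to \<open>qc g\<close>. For \<open>F\<close> near \<open>K\<close> the
  map \<open>g \<mapsto> Bop (qc g) F\<close> is a small perturbation of the identity, so it is invertible with inverse
  of norm at most 2. It can therefore produce the small vector \<open>r = - k\<^sup>2 F - Bop q0 F\<close>, with
  \<open>k = nrm K\<close>, from a small \<open>g0\<close>, and \<open>Bop (q0 + qc g0)\<close> has \<open>F\<close> as eigenvector for \<open>- k\<^sup>2\<close>. On the
  orthogonal complement of \<open>F\<close>, both \<open>- K \<otimes> K\<close> and the correction are small.
\<close>

lemma stable_lowest_direction:
  fixes Q :: "'q::real_vector set" and Bop :: "'q \<Rightarrow> 'v \<Rightarrow> 'v"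
  assumes Q: "subspace Q" and lin: "\<And>q. q \<in> Q \<Longrightarrow> linop (Bop q)"
    and Badd: "\<And>p q f. \<lbrakk>p \<in> Q; q \<in> Q; f \<in> S\<rbrakk> \<Longrightarrow> Bop (p + q) f = Bop p f + Bop q f"
    and Bscale: "\<And>c q f. \<lbrakk>q \<in> Q; f \<in> S\<rbrakk> \<Longrightarrow> Bop (c *\<^sub>R q) f = c *\<^sub>R Bop q f"
    and K: "K \<in> S" "K \<noteq> 0"
    and q0: "q0 \<in> Q" "\<And>f. f \<in> S \<Longrightarrow> Bop q0 f = - (ip f K) *\<^sub>R K"
    and surj: "\<And>h. h \<in> S \<Longrightarrow> \<exists>q\<in>Q. Bop q K = h"
  shows "\<exists>\<epsilon>>0. \<forall>F\<in>S. nrm (F - K) < \<epsilon> \<longrightarrow>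
    (\<exists>q\<in>Q. \<exists>\<mu> \<delta>. \<delta> > 0 \<and> Bop q F = \<mu> *\<^sub>R F \<and>
      (\<forall>g\<in>S. ip g F = 0 \<longrightarrow> ip (Bop q g) g \<ge> (\<mu> + \<delta>) * ip g g))"
proof -
  obtain C where C: "finite C" "C \<subseteq> S"
    "\<And>b c. b \<in> C \<Longrightarrow> c \<in> C \<Longrightarrow> ip b c = (if b = c then 1 else 0)"
    "\<And>f. f \<in> S \<Longrightarrow> f = (\<Sum>b\<in>C. ip f b *\<^sub>R b)" using orthonormal_basis by metis
  obtain p where p: "\<And>h. h \<in> C \<Longrightarrow> p h \<in> Q \<and> Bop (p h) K = h" using surj C(2) by (metis subsetD)
  have BS: "Bop q f \<in> S" if "q \<in> Q" "f \<in> S" for q f using lin that by (auto simp: linop_def)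
  have Bsum: "Bop (sum u D) f = (\<Sum>d\<in>D. Bop (u d) f)" if "\<And>d. d \<in> D \<Longrightarrow> u d \<in> Q" "f \<in> S"
    for u and D :: "'v set" and f
    using that(1)
  proof (induction D rule: infinite_finite_induct)
    case (insert x F)
    have "sum u F \<in> Q" using insert by (intro subspace_sum[OF Q]) auto
    then show ?case using insert that(2) by (auto simp: Badd)
  qed (use Bscale[of 0 f 0] subspace_0[OF Q] that(2) in auto)
  have "\<exists>M\<ge>0. \<forall>f\<in>S. nrm (Bop (p h) f) \<le> M * nrm f" if "h \<in> C" for h
    using linop_bounded[OF lin, of "p h"] p[OF that] by metis
  then obtain m where m: "\<And>h. h \<in> C \<Longrightarrow> m h \<ge> 0"
    "\<And>h f. h \<in> C \<Longrightarrow> f \<in> S \<Longrightarrow> nrm (Bop (p h) f) \<le> m h * nrm f" by metis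
  define M where "M = (\<Sum>h\<in>C. m h) + 1"
  have M: "M > 0" unfolding M_def using m by (intro add_nonneg_pos sum_nonneg) auto
  define qc where "qc = (\<lambda>g. \<Sum>h\<in>C. ip g h *\<^sub>R p h)"
  have qcQ: "qc g \<in> Q" for g unfolding qc_def using p by (auto intro!: subspace_sum[OF Q] subspace_scale[OF Q])
  have qcB: "Bop (qc g) f = (\<Sum>h\<in>C. ip g h *\<^sub>R Bop (p h) f)" if "f \<in> S" for f g
    unfolding qc_def using that p by (subst Bsum) (auto simp: Bscale subspace_scale[OF Q])
  have bound: "nrm (Bop (qc g) f) \<le> M * nrm g * nrm f" if "f \<in> S" "g \<in> S" for f g
  proof -
    have "nrm (Bop (qc g) f) \<le> (\<Sum>h\<in>C. nrm (ip g h *\<^sub>R Bop (p h) f))"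
      unfolding qcB[OF that(1)] using p BS that by (intro nrm_sum) auto
    also have "\<dots> \<le> (\<Sum>h\<in>C. nrm g * (m h * nrm f))"
    proof (rule sum_mono)
      fix h assume h: "h \<in> C"
      then have hS: "h \<in> S" using C(2) by auto
      have "nrm h = 1" using C(3)[OF h h] by (simp add: nrm_def)
      then have "\<bar>ip g h\<bar> \<le> nrm g" using Cauchy_Schwarz[OF that(2) hS] by simp
      then show "nrm (ip g h *\<^sub>R Bop (p h) f) \<le> nrm g * (m h * nrm f)"
        using BS p h that m by (simp add: nrm_scale mult_mono)
    qed
    also have "\<dots> = (M - 1) * nrm g * nrm f"
      by (simp add: M_def sum_distrib_left sum_distrib_right mult_ac)
    also have "\<dots> \<le> M * nrm g * nrm f" using that by (intro mult_right_mono) auto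
    finally show ?thesis .
  qed
  have solve: "\<exists>g\<in>S. Bop (qc g) F = r \<and> nrm g \<le> 2 * nrm r"
    if F: "F \<in> S" "nrm (F - K) \<le> 1 / (2 * M)" and r: "r \<in> S" for F r
  proof -
    define T where "T = (\<lambda>g. Bop (qc g) F)"
    have Tl: "linop T" unfolding linop_def T_def qcB[OF F(1)] using C(2) p BS F
      by (auto simp: ip_add ip_scale sum.distrib algebra_simps scaleR_sum_right subset_iff
          intro!: S_sum S_scale)
    have near: "nrm (T g - g) \<le> nrm g / 2" if g: "g \<in> S" for g
    proof -
      have gK: "Bop (qc g) K = g"
        using C(4)[OF g, symmetric] p by (simp add: qcB[OF K(1)])
      have FK: "F - K \<in> S" using F K by simp
      have "Bop (qc g) ((F - K) + K) = Bop (qc g) (F - K) + Bop (qc g) K"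
        by (rule linopD(2)[OF lin[OF qcQ] FK K(1)])
      then have "T g - g = Bop (qc g) (F - K)" using gK by (simp add: T_def)
      also have "nrm \<dots> \<le> M * nrm g * nrm (F - K)" using bound FK g by blast
      also have "\<dots> \<le> M * nrm g * (1 / (2 * M))" using F M g by (intro mult_left_mono) auto
      finally show ?thesis using M by simp
    qed
    have lower: "nrm g \<le> 2 * nrm (T g)" if g: "g \<in> S" for g
    proof -
      have TgS: "T g \<in> S" using Tl g by (auto simp: linop_def)
      have "nrm (T g + (g - T g)) \<le> nrm (T g) + nrm (g - T g)"
        using TgS g by (intro nrm_triangle) auto
      moreover have "nrm (g - T g) = nrm (T g - g)" using TgS g by (rule nrm_minus_commute[rotated])
      ultimately show ?thesis using near[OF g] by simp
    qed
    have "T ` S = S"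
    proof (rule linop_injective_imp_surjective[OF Tl])
      fix f assume "f \<in> S" "T f = 0"
      then have "nrm f \<le> 0" using lower[of f] by (simp add: nrm_def)
      then show "f = 0" using \<open>f \<in> S\<close> nrm_nonneg[of f] nrm_eq_0[of f] by linarith
    qed
    then obtain g where "g \<in> S" "T g = r" using r by (metis imageE)
    then show ?thesis using lower[of g] by (auto simp: T_def)
  qed
  define k where "k = nrm K"
  have k: "k > 0" using K nrm_eq_0[of K] nrm_nonneg[of K] unfolding k_def by linarith
  have kk: "ip K K = k\<^sup>2" using nrm_sq[OF K(1)] by (simp add: k_def)
  \<comment> \<open>The three bounds make \<open>\<bar>\<langle>g, K\<rangle>\<bar> \<le> k / 2 nrm g\<close> for \<open>g \<bottom> F\<close>, make \<open>solve\<close> applicable, and keep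
    the correction below \<open>k\<^sup>2 / 4\<close>; together they leave a gap of \<open>k\<^sup>2 / 2\<close>.\<close>
  define \<epsilon> where "\<epsilon> = min (k / 2) (min (1 / (2 * M)) (1 / (16 * M)))"
  have e: "\<epsilon> > 0" "\<epsilon> \<le> k / 2" "\<epsilon> \<le> 1 / (2 * M)" "\<epsilon> \<le> 1 / (16 * M)"
    using k M by (auto simp: \<epsilon>_def)
  show ?thesis
  proof (intro exI[of _ \<epsilon>] conjI ballI impI e(1))
    fix F assume F: "F \<in> S" "nrm (F - K) < \<epsilon>"
    define D where "D = F - K"
    have D: "D \<in> S" "nrm D < \<epsilon>" using F K by (auto simp: D_def)
    have FD: "F = K + D" by (simp add: D_def)
    define r where "r = (ip D K) *\<^sub>R K - k\<^sup>2 *\<^sub>R D"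
    have rS: "r \<in> S" using D K by (simp add: r_def)
    have nr: "nrm r \<le> 2 * k\<^sup>2 * nrm D"
    proof -
      have "nrm r \<le> nrm ((ip D K) *\<^sub>R K) + nrm ((- k\<^sup>2) *\<^sub>R D)"
        using nrm_triangle[OF S_scale[OF K(1)] S_scale[OF D(1)], of "ip D K" "- k\<^sup>2"]
        by (simp add: r_def)
      also have "\<dots> = \<bar>ip D K\<bar> * k + k\<^sup>2 * nrm D"
        using D K nrm_scale[of D "- k\<^sup>2"] nrm_scale[of K "ip D K"] by (simp add: k_def)
      also have "\<bar>ip D K\<bar> * k \<le> nrm D * k * k"
        using Cauchy_Schwarz[of D K] D K k by (intro mult_right_mono) (auto simp: k_def)
      finally show ?thesis by (simp add: power2_eq_square algebra_simps)
    qed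
    obtain g0 where g0: "g0 \<in> S" "Bop (qc g0) F = r" "nrm g0 \<le> 2 * nrm r"
      using solve[OF F(1) _ rS] F(2) e by auto
    define q where "q = q0 + qc g0"
    have qQ: "q \<in> Q" unfolding q_def using q0 qcQ subspace_add[OF Q] by blast
    have qB: "Bop q f = - (ip f K) *\<^sub>R K + Bop (qc g0) f" if "f \<in> S" for f
      unfolding q_def using that q0 qcQ by (simp add: Badd)
    have eig: "Bop q F = (- (k\<^sup>2)) *\<^sub>R F"
      using F g0 D K by (simp add: qB r_def) (simp add: FD ip_add kk algebra_simps)
    have gap: "ip (Bop q g) g \<ge> (- (k\<^sup>2) + k\<^sup>2 / 2) * ip g g" if g: "g \<in> S" "ip g F = 0" for g
    proof -
      have "ip g K = - ip g D" using g D K by (simp add: FD ip_add2)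
      then have "\<bar>ip g K\<bar> \<le> nrm g * nrm D" using Cauchy_Schwarz[OF g(1) D(1)] by simp
      also have "\<dots> \<le> nrm g * (k / 2)" using D e g by (intro mult_left_mono) auto
      finally have "(ip g K)\<^sup>2 \<le> (nrm g * (k / 2))\<^sup>2" by (simp add: abs_le_square_iff[symmetric])
      then have 1: "(ip g K)\<^sup>2 \<le> k\<^sup>2 / 4 * ip g g"
        using nrm_sq[OF g(1)] by (simp add: power_mult_distrib power_divide mult.commute)
      have BgS: "Bop (qc g0) g \<in> S" using BS qcQ g by blast
      have "\<bar>ip (Bop (qc g0) g) g\<bar> \<le> nrm (Bop (qc g0) g) * nrm g"
        using BgS g by (intro Cauchy_Schwarz) auto
      also have "\<dots> \<le> M * nrm g0 * nrm g * nrm g"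
        using bound[OF g(1) g0(1)] g by (intro mult_right_mono) auto
      also have "\<dots> = M * nrm g0 * ip g g" using nrm_sq[OF g(1)] by (simp add: power2_eq_square)
      also have "\<dots> \<le> (k\<^sup>2 / 4) * ip g g"
      proof (rule mult_right_mono[OF _ ip_nonneg[OF g(1)]])
        have "nrm g0 \<le> 4 * k\<^sup>2 * nrm D" using g0 nr by linarith
        also have "\<dots> \<le> 4 * k\<^sup>2 * (1 / (16 * M))"
          using D e by (intro mult_left_mono) auto
        finally have "M * nrm g0 \<le> M * (4 * k\<^sup>2 * (1 / (16 * M)))"
          using M by (intro mult_left_mono) auto
        then show "M * nrm g0 \<le> k\<^sup>2 / 4" using M by simp
      qed
      finally have 2: "ip (Bop (qc g0) g) g \<ge> - (k\<^sup>2 / 4) * ip g g" by (auto simp: abs_le_iff)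
      have "ip (Bop q g) g = - (ip g K)\<^sup>2 + ip (Bop (qc g0) g) g"
        using g K BgS ip_commute[of K g] 
        by (simp add: qB ip_add ip_scale[of K] power2_eq_square S_scale del: scaleR_minus_left)
      then show ?thesis using 1 2 by (simp add: field_simps)
    qed
    show "\<exists>q\<in>Q. \<exists>\<mu> \<delta>. \<delta> > 0 \<and> Bop q F = \<mu> *\<^sub>R F \<and>
      (\<forall>g\<in>S. ip g F = 0 \<longrightarrow> ip (Bop q g) g \<ge> (\<mu> + \<delta>) * ip g g)"
      using qQ eig gap k
      by (intro bexI[of _ q] exI[of _ "- (k\<^sup>2)"] exI[of _ "k\<^sup>2 / 2"]) auto
  qed
qed

end

section \<open>The matrix group SU(2)\<close>

lemma mat2_nth [simp]:
  "mat2 a b c d $ 1 $ 1 = a" "mat2 a b c d $ 1 $ 2 = b"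
  "mat2 a b c d $ 2 $ 1 = c" "mat2 a b c d $ 2 $ 2 = d"
  by (simp_all add: mat2_def)

lemma mat2_eq_iff:
  "(A::mat2) = B \<longleftrightarrow> A$1$1 = B$1$1 \<and> A$1$2 = B$1$2 \<and> A$2$1 = B$2$1 \<and> A$2$2 = B$2$2"
  by (auto simp: vec_eq_iff forall_2)

lemma matmul_nth [simp]: "((A::mat2) ** B) $ i $ j = A$i$1 * B$1$j + A$i$2 * B$2$j"
  by (simp add: matrix_matrix_mult_def sum_2)

lemma conj_transpose_nth [simp]: "conj_transpose A $ i $ j = cnj (A $ j $ i)"
  by (simp add: conj_transpose_def)

lemma mat_1_nth [simp]: "(mat 1 :: mat2) $ 1 $ 1 = 1" "(mat 1 :: mat2) $ 1 $ 2 = 0"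
  "(mat 1 :: mat2) $ 2 $ 1 = 0" "(mat 1 :: mat2) $ 2 $ 2 = 1"
  by (simp_all add: mat_def)

text \<open>
  The unitarity and determinant equations leave the first column free on the unit sphere and
  express the second column through it.
\<close>

lemma SU2_iff:
  "A \<in> SU2 \<longleftrightarrow> A$2$2 = cnj (A$1$1) \<and> A$1$2 = - cnj (A$2$1) \<and>
    A$1$1 * cnj (A$1$1) + A$2$1 * cnj (A$2$1) = 1"
proof
  assume A: "A \<in> SU2"
  define a b c d where "a = A$1$1" and "b = A$1$2" and "c = A$2$1" and "d = A$2$2"
  have e: "a * cnj a + b * cnj b = 1" "a * cnj c + b * cnj d = 0" "c * cnj a + d * cnj b = 0"
    "c * cnj c + d * cnj d = 1" "a * d - b * c = 1"
    using A by (auto simp: SU2_def mat2_eq_iff det_2 a_def b_def c_def d_def)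
  have d: "d = cnj a"
  proof -
    have "d = d * (a * cnj a + b * cnj b)" using e(1) by simp
    also have "\<dots> = (a * d) * cnj a + b * (d * cnj b)" by (simp add: algebra_simps)
    also have "d * cnj b = - (c * cnj a)" using e(3) by (simp add: eq_neg_iff_add_eq_0 add.commute)
    also have "(a * d) * cnj a + b * (- (c * cnj a)) = (a * d - b * c) * cnj a"
      by (simp add: algebra_simps)
    finally show ?thesis using e(5) by simp
  qed
  have b: "b = - cnj c"
  proof -
    have "b = b * (c * cnj c + d * cnj d)" using e(4) by simp
    also have "\<dots> = (b * c) * cnj c + d * (b * cnj d)" by (simp add: algebra_simps)
    also have "b * cnj d = - (a * cnj c)" using e(2) by (simp add: eq_neg_iff_add_eq_0 add.commute)
    also have "(b * c) * cnj c + d * (- (a * cnj c)) = - (a * d - b * c) * cnj c"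
      by (simp add: algebra_simps)
    finally show ?thesis using e(5) by simp
  qed
  have "a * cnj a + c * cnj c = 1" using e(1) b by (simp add: mult.commute)
  then show "A$2$2 = cnj (A$1$1) \<and> A$1$2 = - cnj (A$2$1) \<and>
    A$1$1 * cnj (A$1$1) + A$2$1 * cnj (A$2$1) = 1"
    using d b by (simp add: a_def b_def c_def d_def)
next
  assume "A$2$2 = cnj (A$1$1) \<and> A$1$2 = - cnj (A$2$1) \<and>
    A$1$1 * cnj (A$1$1) + A$2$1 * cnj (A$2$1) = 1"
  then show "A \<in> SU2" by (auto simp: SU2_def mat2_eq_iff det_2 algebra_simps)
qed

lemma conj_transpose_mult: "conj_transpose (A ** B) = conj_transpose B ** conj_transpose A"
  by (simp add: mat2_eq_iff mult.commute)

lemma conj_transpose_conj_transpose [simp]: "conj_transpose (conj_transpose A) = A"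
  by (simp add: mat2_eq_iff)

lemma conj_transpose_mat_1 [simp]: "conj_transpose (mat 1) = mat 1"
  by (simp add: mat2_eq_iff)

lemma SU2_right_inverse: "A \<in> SU2 \<Longrightarrow> A ** conj_transpose A = mat 1"
  by (simp add: SU2_def)

lemma SU2_left_inverse: "A \<in> SU2 \<Longrightarrow> conj_transpose A ** A = mat 1"
  using SU2_right_inverse matrix_left_right_inverse by blast

lemma SU2_mult [intro]: "A \<in> SU2 \<Longrightarrow> B \<in> SU2 \<Longrightarrow> A ** B \<in> SU2"
proof -
  assume AB: "A \<in> SU2" "B \<in> SU2"
  have "(A ** B) ** conj_transpose (A ** B) = A ** (B ** conj_transpose B) ** conj_transpose A"
    by (simp add: conj_transpose_mult matrix_mul_assoc)
  then show ?thesis using AB by (simp add: SU2_def det_mul)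
qed

lemma SU2_conj_transpose [intro]: "A \<in> SU2 \<Longrightarrow> conj_transpose A \<in> SU2"
  by (auto simp: SU2_iff algebra_simps)

lemma SU2_mat_1 [simp]: "mat 1 \<in> SU2"
  by (simp add: SU2_iff)

lemma SU2_cancel [simp]:
  "A \<in> SU2 \<Longrightarrow> A ** (conj_transpose A ** B) = B" "A \<in> SU2 \<Longrightarrow> conj_transpose A ** (A ** B) = B"
  "A \<in> SU2 \<Longrightarrow> B ** A ** conj_transpose A = B" "A \<in> SU2 \<Longrightarrow> B ** conj_transpose A ** A = B"
  using SU2_right_inverse SU2_left_inverse
  by (simp_all add: matrix_mul_assoc flip: matrix_mul_assoc[of B])

lemma matrix_inv_SU2: "A \<in> SU2 \<Longrightarrow> matrix_inv A = conj_transpose A"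
  unfolding matrix_inv_def
proof (rule some_equality)
  fix B assume A: "A \<in> SU2" and B: "A ** B = mat 1 \<and> B ** A = mat 1"
  have "B = B ** (A ** conj_transpose A)" using A by (simp add: SU2_right_inverse)
  also have "\<dots> = conj_transpose A" using B by (simp add: matrix_mul_assoc)
  finally show "B = conj_transpose A" .
qed (simp add: SU2_right_inverse SU2_left_inverse)

lemma norm_mat2: "norm (A::mat2) = sqrt ((cmod (A$1$1))\<^sup>2 + (cmod (A$1$2))\<^sup>2 + (cmod (A$2$1))\<^sup>2 + (cmod (A$2$2))\<^sup>2)"
  by (simp add: norm_vec_def L2_set_def sum_2)

lemma unit_iff: "a * cnj a + c * cnj c = 1 \<longleftrightarrow> (cmod a)\<^sup>2 + (cmod c)\<^sup>2 = 1"
proof -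
  have "a * cnj a + c * cnj c = complex_of_real ((cmod a)\<^sup>2 + (cmod c)\<^sup>2)"
    by (simp only: of_real_add complex_norm_square)
  then show ?thesis by (simp only: of_real_eq_1_iff)
qed

lemma SU2_entry_bound: "A \<in> SU2 \<Longrightarrow> cmod (A $ i $ j) \<le> 1"
proof -
  assume A: "A \<in> SU2"
  have s: "(cmod (A$1$1))\<^sup>2 + (cmod (A$2$1))\<^sup>2 = 1"
    using A by (simp add: SU2_iff unit_iff)
  then have "(cmod (A$1$1))\<^sup>2 \<le> 1" "(cmod (A$2$1))\<^sup>2 \<le> 1"
    by (smt (verit) zero_le_power2)+
  then have "cmod (A$1$1) \<le> 1" "cmod (A$2$1) \<le> 1"
    by (simp_all add: power2_le_iff_abs_le abs_square_le_1)
  moreover have "A$2$2 = cnj (A$1$1)" "A$1$2 = - cnj (A$2$1)" using A by (auto simp: SU2_iff)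
  ultimately show ?thesis using exhaust_2[of i] exhaust_2[of j] by auto
qed

lemma compact_SU2: "compact SU2"
proof (rule compact_eq_bounded_closed[THEN iffD2, OF conjI])
  show "bounded SU2"
  proof (rule boundedI)
    fix A assume A: "A \<in> SU2"
    have 1: "(cmod (A$i$j))\<^sup>2 \<le> 1" for i j
      using SU2_entry_bound[OF A] by (simp add: power_le_one)
    have "(cmod (A$1$1))\<^sup>2 + (cmod (A$1$2))\<^sup>2 + (cmod (A$2$1))\<^sup>2 + (cmod (A$2$2))\<^sup>2 \<le> 2\<^sup>2"
      using 1[of 1 1] 1[of 1 2] 1[of 2 1] 1[of 2 2] by simp
    then have "norm A \<le> sqrt (2\<^sup>2)" unfolding norm_mat2 by (rule real_sqrt_le_mono)
    then show "norm A \<le> 2" by simp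
  qed
  have eq: "SU2 = {A. A$2$2 = cnj (A$1$1)} \<inter> {A. A$1$2 = - cnj (A$2$1)} \<inter>
    {A. A$1$1 * cnj (A$1$1) + A$2$1 * cnj (A$2$1) = 1}" using SU2_iff by blast
  show "closed SU2" unfolding eq
    by (auto intro!: closed_Int closed_Collect_eq continuous_intros)
qed

section \<open>SU(2) as the unit sphere\<close>

lemma SU2_of_sphere_nth [simp]:
  "SU2_of_sphere z $ 1 $ 1 = z $ 1" "SU2_of_sphere z $ 1 $ 2 = - cnj (z $ 2)"
  "SU2_of_sphere z $ 2 $ 1 = z $ 2" "SU2_of_sphere z $ 2 $ 2 = cnj (z $ 1)"
  by (simp_all add: SU2_of_sphere_def)

lemma norm_C2_sq: "(norm (z::complex^2))\<^sup>2 = (cmod (z$1))\<^sup>2 + (cmod (z$2))\<^sup>2"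
  by (simp add: norm_vec_def L2_set_def sum_2)

lemma SU2_of_sphere_in_SU2: "norm z = 1 \<Longrightarrow> SU2_of_sphere z \<in> SU2"
proof -
  assume "norm z = 1"
  then have "(cmod (z$1))\<^sup>2 + (cmod (z$2))\<^sup>2 = 1" by (simp flip: norm_C2_sq)
  then show ?thesis by (simp add: SU2_iff unit_iff)
qed

lemma SU2_eq_image_sphere: "SU2 = SU2_of_sphere ` sphere 0 1"
proof
  show "SU2_of_sphere ` sphere 0 1 \<subseteq> SU2" using SU2_of_sphere_in_SU2 by auto
  show "SU2 \<subseteq> SU2_of_sphere ` sphere 0 1"
  proof
    fix A assume A: "A \<in> SU2"
    define z :: "complex^2" where "z = vector [A$1$1, A$2$1]"
    have "(norm z)\<^sup>2 = 1"
      using A unfolding norm_C2_sq by (simp add: z_def SU2_iff unit_iff)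
    then have "norm z = 1" using norm_ge_zero[of z] by (simp add: power2_eq_1_iff)
    moreover have "SU2_of_sphere z = A" using A by (auto simp: mat2_eq_iff z_def SU2_iff)
    ultimately show "A \<in> SU2_of_sphere ` sphere 0 1" by (intro image_eqI[of _ _ z]) auto
  qed
qed

lemma continuous_mat2I:
  fixes F :: "'a::topological_space \<Rightarrow> mat2"
  assumes "\<And>i j. continuous_on S (\<lambda>x. F x $ i $ j)"
  shows "continuous_on S F"
proof -
  have "continuous_on S (\<lambda>x. \<chi> i j. F x $ i $ j)"
    by (intro continuous_on_vec_lambda assms)
  then show ?thesis by simp
qed

lemma not_eq_1: "(i::2) \<noteq> 1 \<longleftrightarrow> i = 2"
  using exhaust_2[of i] by auto

lemma continuous_on_SU2_of_sphere [continuous_intros]: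
  "continuous_on S f \<Longrightarrow> continuous_on S (\<lambda>x. SU2_of_sphere (f x))"
proof (rule continuous_mat2I)
  fix i j :: 2 assume "continuous_on S f"
  then show "continuous_on S (\<lambda>x. SU2_of_sphere (f x) $ i $ j)"
    by (cases "i = 1"; cases "j = 1") (simp_all add: not_eq_1 continuous_intros)
qed

lemma continuous_on_matmul [continuous_intros]:
  fixes f g :: "'a::topological_space \<Rightarrow> mat2"
  shows "continuous_on S f \<Longrightarrow> continuous_on S g \<Longrightarrow> continuous_on S (\<lambda>x. f x ** g x)"
  by (rule continuous_mat2I) (auto intro!: continuous_intros)

lemma continuous_on_conj_transpose [continuous_intros]:
  "continuous_on S f \<Longrightarrow> continuous_on S (\<lambda>x. conj_transpose (f x))"
  by (rule continuous_mat2I) (auto intro!: continuous_intros)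

lemma connected_SU2: "connected SU2"
proof -
  have "2 \<le> DIM(complex^2)" by simp
  then have "connected (sphere (0::complex^2) 1)" by (rule connected_sphere)
  then show ?thesis unfolding SU2_eq_image_sphere
    by (intro connected_continuous_image continuous_intros)
qed

section \<open>The binary icosahedral group\<close>

lemma Istar_SU2: "h \<in> Istar \<Longrightarrow> h \<in> SU2"
  by (simp add: Istar_def)

lemma Istar_mat_1: "mat 1 \<in> Istar"
  by (simp add: Istar_def)

lemma Istar_mult: "A \<in> Istar \<Longrightarrow> B \<in> Istar \<Longrightarrow> A ** B \<in> Istar"
proof -
  assume AB: "A \<in> Istar" "B \<in> Istar"
  have "(\<lambda>X. (A ** B) ** X ** conj_transpose (A ** B)) =
    (\<lambda>X. A ** X ** conj_transpose A) \<circ> (\<lambda>X. B ** X ** conj_transpose B)"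
    by (simp add: fun_eq_iff conj_transpose_mult matrix_mul_assoc)
  then have "(\<lambda>X. (A ** B) ** X ** conj_transpose (A ** B)) ` icosahedron = icosahedron"
    using AB by (simp only: Istar_def mem_Collect_eq image_comp[symmetric])
  then show ?thesis using AB by (auto simp: Istar_def)
qed

lemma Istar_conj_transpose: "A \<in> Istar \<Longrightarrow> conj_transpose A \<in> Istar"
proof -
  assume A: "A \<in> Istar"
  then have SU: "A \<in> SU2" and im: "(\<lambda>X. A ** X ** conj_transpose A) ` icosahedron = icosahedron"
    by (auto simp: Istar_def)
  have "(\<lambda>X. conj_transpose A ** X ** A) ` ((\<lambda>X. A ** X ** conj_transpose A) ` icosahedron)
     = (\<lambda>X. X) ` icosahedron"
    unfolding image_image using SU by (simp add: matrix_mul_assoc SU2_left_inverse)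
  then show ?thesis using SU im by (auto simp: Istar_def)
qed

lemma coset_mult_Istar: "h \<in> Istar \<Longrightarrow> coset (a ** h) = coset a"
proof -
  assume h: "h \<in> Istar"
  have "(\<lambda>k. h ** k) ` Istar = Istar"
  proof
    show "(\<lambda>k. h ** k) ` Istar \<subseteq> Istar" using h Istar_mult by auto
    show "Istar \<subseteq> (\<lambda>k. h ** k) ` Istar"
    proof
      fix k assume "k \<in> Istar"
      then show "k \<in> (\<lambda>k. h ** k) ` Istar"
        using h Istar_mult Istar_conj_transpose Istar_SU2
        by (intro image_eqI[of _ _ "conj_transpose h ** k"]) auto
    qed
  qed
  then have "coset a = (\<lambda>k. a ** k) ` ((\<lambda>k. h ** k) ` Istar)" by (simp add: coset_def)
  then show ?thesis by (simp add: coset_def image_image matrix_mul_assoc)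
qed

lemma coset_in_PDS: "a \<in> SU2 \<Longrightarrow> coset a \<in> PDS"
  by (simp add: PDS_def)

lemma coset_in_PDS_iff: "coset a \<in> PDS \<longleftrightarrow> a \<in> SU2"
proof
  assume "coset a \<in> PDS"
  then obtain b where b: "b \<in> SU2" "coset a = coset b" by (auto simp: PDS_def)
  have "a \<in> coset a" using Istar_mat_1 by (auto simp: coset_def intro: image_eqI[of _ _ "mat 1"])
  then show "a \<in> SU2" using b Istar_SU2 by (auto simp: coset_def)
qed (rule coset_in_PDS)

lemma image_mult_coset: "(\<lambda>y. b ** y) ` coset a = coset (b ** a)"
  by (simp add: coset_def image_image matrix_mul_assoc)

lemma pauli_nth [simp]:
  "pauli x y z $ 1 $ 1 = of_real z" "pauli x y z $ 1 $ 2 = Complex x (- y)"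
  "pauli x y z $ 2 $ 1 = Complex x y" "pauli x y z $ 2 $ 2 = of_real (- z)"
  by (simp_all add: pauli_def)

lemma uminus_pauli: "- pauli x y z = pauli (- x) (- y) (- z)"
  by (simp add: mat2_eq_iff complex_eq_iff)

lemma finite_icosahedron: "finite icosahedron"
  by (simp add: icosahedron_def icosahedron_upper_def)

text \<open>
  The five vertices of the icosahedron next to the north pole, counted modulo 5.
\<close>

definition ring_vertex :: "nat \<Rightarrow> mat2"
  where "ring_vertex k = pauli (2 / sqrt 5 * cos (2 * pi * real k / 5))
                     (2 / sqrt 5 * sin (2 * pi * real k / 5)) (1 / sqrt 5)"

lemma icosahedron_alt:
  "icosahedron = {pauli 0 0 1, - pauli 0 0 1} \<union> ring_vertex ` {..<5} \<union> (\<lambda>k. - ring_vertex k) ` {..<5}"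
proof -
  have "ring_vertex = (\<lambda>k. pauli (2 / sqrt 5 * cos (2 * pi * real k / 5))
      (2 / sqrt 5 * sin (2 * pi * real k / 5)) (1 / sqrt 5))"
    by (simp add: fun_eq_iff ring_vertex_def)
  then have e: "icosahedron_upper = insert (pauli 0 0 1) (ring_vertex ` {..<5})"
    by (simp only: icosahedron_upper_def)
  show ?thesis
    unfolding icosahedron_def e
    by (simp only: image_insert image_image Un_insert_left Un_insert_right Un_empty_left
        Un_empty_right insert_commute)
qed

text \<open>
  The images of two vertices that are neither equal nor antipodal determine a matrix up to sign:
  what commutes with \<open>\<sigma>\<^sub>3\<close> is diagonal, and if it also commutes with a vertex off the polar axis,
  it is scalar.
\<close>

lemma finite_Istar: "finite Istar"
proof -
  define \<phi> where "\<phi> = (\<lambda>A. (A ** pauli 0 0 1 ** conj_transpose A, A ** ring_vertex 0 ** conj_transpose A))"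
  have "\<phi> ` Istar \<subseteq> icosahedron \<times> icosahedron"
  proof
    fix y assume "y \<in> \<phi> ` Istar"
    then obtain A where A: "A \<in> Istar" "y = \<phi> A" by blast
    have "A ** X ** conj_transpose A \<in> icosahedron" if "X \<in> icosahedron" for X
      using that A(1) unfolding Istar_def by blast
    moreover have "pauli 0 0 1 \<in> icosahedron" "ring_vertex 0 \<in> icosahedron"
      unfolding icosahedron_alt by auto
    ultimately show "y \<in> icosahedron \<times> icosahedron" by (simp add: A(2) \<phi>_def)
  qed
  then have fin: "finite (\<phi> ` Istar)" using finite_icosahedron by (meson finite_SigmaI finite_subset)
  have pm: "B = A \<or> B = - A" if A: "A \<in> Istar" and B: "B \<in> Istar" and eq: "\<phi> A = \<phi> B" for A B
  proof -
    have SU: "A \<in> SU2" "B \<in> SU2" using A B Istar_SU2 by auto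
    define C where "C = conj_transpose A ** B"
    have BC: "B = A ** C" using SU by (simp add: C_def)
    have CSU: "C \<in> SU2" unfolding C_def using SU by blast
    have comm: "X ** C = C ** X" if "A ** X ** conj_transpose A = B ** X ** conj_transpose B" for X
    proof -
      have "X ** C = conj_transpose A ** (A ** X ** conj_transpose A) ** B"
        using SU by (simp add: C_def matrix_mul_assoc SU2_left_inverse)
      also have "\<dots> = conj_transpose A ** (B ** X ** conj_transpose B) ** B" using that by simp
      also have "\<dots> = C ** X" using SU by (simp add: C_def matrix_mul_assoc)
      finally show ?thesis .
    qed
    have 1: "pauli 0 0 1 ** C = C ** pauli 0 0 1" "ring_vertex 0 ** C = C ** ring_vertex 0"
      using eq by (auto simp: \<phi>_def intro: comm)
    have nth: "(X ** Y) $ i $ j = (Y ** X) $ i $ j" if "X ** Y = Y ** X" for X Y :: mat2 and i j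
      using that by simp
    have z: "Complex 0 0 = 0" by (simp add: Complex_eq_0)
    have "C$1$2 = - (C$1$2)" "C$2$1 = - (C$2$1)"
      using nth[OF 1(1), of 1 2] nth[OF 1(1), of 2 1] by (simp_all add: z)
    then have off: "C$1$2 = 0" "C$2$1 = 0" by (simp_all add: eq_neg_iff_add_eq_0 flip: mult_2)
    have "C$1$1 = C$2$2"
      using nth[OF 1(2), of 1 2] off by (simp add: ring_vertex_def Complex_eq_0 mult.commute)
    moreover have "C$1$1 * C$2$2 = 1" using CSU off by (simp add: SU2_def det_2)
    ultimately have "C$1$1 = 1 \<and> C$2$2 = 1 \<or> C$1$1 = -1 \<and> C$2$2 = -1"
      by (metis square_eq_1_iff)
    then have "C = mat 1 \<or> C = - mat 1" using off by (auto simp: mat2_eq_iff)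
    then show ?thesis using BC by (auto simp: mat2_eq_iff)
  qed
  show ?thesis
  proof (rule finite_subset)
    show "Istar \<subseteq> (\<Union>y\<in>\<phi> ` Istar. {SOME A. A \<in> Istar \<and> \<phi> A = y, - (SOME A. A \<in> Istar \<and> \<phi> A = y)})"
    proof
      fix B assume B: "B \<in> Istar"
      define A where "A = (SOME A. A \<in> Istar \<and> \<phi> A = \<phi> B)"
      have "A \<in> Istar \<and> \<phi> A = \<phi> B" unfolding A_def by (rule someI[of _ B]) (use B in simp)
      then have "B = A \<or> B = - A" using pm B by blast
      then show "B \<in> (\<Union>y\<in>\<phi> ` Istar. {SOME A. A \<in> Istar \<and> \<phi> A = y, - (SOME A. A \<in> Istar \<and> \<phi> A = y)})"
        using B by (auto simp: A_def)
    qed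
    show "finite (\<Union>y\<in>\<phi> ` Istar. {SOME A. A \<in> Istar \<and> \<phi> A = y, - (SOME A. A \<in> Istar \<and> \<phi> A = y)})"
      by (rule finite_UN_I[OF fin]) simp
  qed
qed

lemma card_Istar_pos: "card Istar > 0"
  using finite_Istar Istar_mat_1 card_gt_0_iff by blast

text \<open>
  The icosahedron is finite and closed under negation and conjugation is injective, so it suffices
  to map the north pole and its neighbours into the icosahedron.
\<close>

lemma IstarI:
  assumes A: "A \<in> SU2"
    and np: "A ** pauli 0 0 1 ** conj_transpose A \<in> icosahedron"
    and rv: "\<And>k. k < 5 \<Longrightarrow> A ** ring_vertex k ** conj_transpose A \<in> icosahedron"
  shows "A \<in> Istar"
proof -
  let ?f = "\<lambda>X. A ** X ** conj_transpose A"
  have neg: "- X \<in> icosahedron" if "X \<in> icosahedron" for X using that unfolding icosahedron_alt by auto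
  have fneg: "?f (- X) = - ?f X" for X by (simp add: mat2_eq_iff algebra_simps)
  have "?f ` icosahedron \<subseteq> icosahedron"
  proof
    fix Y assume "Y \<in> ?f ` icosahedron"
    then obtain X where X: "X \<in> icosahedron" "Y = ?f X" by blast
    then consider "X = pauli 0 0 1" | "X = - pauli 0 0 1" | k where "k < 5" "X = ring_vertex k"
      | k where "k < 5" "X = - ring_vertex k" unfolding icosahedron_alt by auto
    then show "Y \<in> icosahedron" using np rv neg X(2) by cases (simp_all add: fneg)
  qed
  moreover have "inj_on ?f icosahedron"
  proof (rule inj_onI)
    fix X Y assume "?f X = ?f Y"
    then have "conj_transpose A ** ?f X ** A = conj_transpose A ** ?f Y ** A" by simp
    then show "X = Y" using A by (simp add: matrix_mul_assoc SU2_left_inverse)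
  qed
  ultimately have "?f ` icosahedron = icosahedron"
    using endo_inj_surj finite_icosahedron by blast
  then show ?thesis using A by (simp add: Istar_def)
qed

lemma ring_vertex_periodic: "ring_vertex (k + 5) = ring_vertex k"
proof -
  have "2 * pi * real (k + 5) / 5 = 2 * pi * real k / 5 + 2 * pi" by (simp add: field_simps)
  then show ?thesis unfolding ring_vertex_def by (simp only: cos_periodic sin_periodic)
qed

lemma ring_vertex_in: "ring_vertex k \<in> icosahedron"
proof -
  have "ring_vertex k = ring_vertex (k mod 5)"
  proof (induction k rule: less_induct)
    case (less k)
    show ?case
    proof (cases "k < 5")
      case False
      then show ?thesis using less[of "k - 5"] ring_vertex_periodic[of "k - 5"]
        by (simp add: le_mod_geq)
    qed simp
  qed
  then show ?thesis by (auto simp: icosahedron_alt)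
qed

lemma neg_ring_vertex_in: "- ring_vertex k \<in> icosahedron"
  using ring_vertex_in[of k] by (auto simp: icosahedron_alt)

lemma ring_vertex_reflect: "k \<le> 5 \<Longrightarrow>
  ring_vertex (5 - k) = pauli (2 / sqrt 5 * cos (2 * pi * real k / 5))
                     (- (2 / sqrt 5 * sin (2 * pi * real k / 5))) (1 / sqrt 5)"
proof -
  assume "k \<le> 5"
  then have e: "2 * pi * real (5 - k) / 5 = 2 * pi - 2 * pi * real k / 5" by (simp add: field_simps)
  show ?thesis unfolding ring_vertex_def e by (simp add: cos_diff sin_diff)
qed

text \<open>
  This and the next two elements are the only ones that the classification of invariant forms
  uses. Here the rotation about the polar axis moves each vertex of the ring to the next one.
\<close>

lemma fifth_turn_in_Istar: "mat2 (cis (- pi / 5)) 0 0 (cis (pi / 5)) \<in> Istar"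
proof (rule IstarI)
  let ?A = "mat2 (cis (- pi / 5)) 0 0 (cis (pi / 5))"
  show "?A \<in> SU2" by (simp add: SU2_iff cis_cnj cis_mult)
  have "?A ** pauli 0 0 1 ** conj_transpose ?A = pauli 0 0 1"
    by (simp add: mat2_eq_iff cis_cnj cis_mult Complex_eq_0)
  then show "?A ** pauli 0 0 1 ** conj_transpose ?A \<in> icosahedron"
    by (simp add: icosahedron_alt)
  fix k :: nat assume "k < 5"
  have "?A ** ring_vertex k ** conj_transpose ?A = ring_vertex (Suc k)"
  proof -
    define t where "t = 2 * pi * real k / 5"
    have t: "2 * pi * real (Suc k) / 5 = t + 2 * pi / 5" by (simp add: t_def field_simps)
    have c: "Complex (2 / sqrt 5 * cos x) (2 / sqrt 5 * sin x) = of_real (2 / sqrt 5) * cis x"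
      "Complex (2 / sqrt 5 * cos x) (- (2 / sqrt 5 * sin x)) = of_real (2 / sqrt 5) * cis (- x)" for x
      by (simp_all add: complex_eq_iff)
    have m: "cis (- pi / 5) * (r * cis (- t)) * cis (- pi / 5) = r * cis (- (t + 2 * pi / 5))"
      "cis (pi / 5) * (r * cis t) * cis (pi / 5) = r * cis (t + 2 * pi / 5)" for r
    proof -
      have "cis (- pi / 5) * (r * cis (- t)) * cis (- pi / 5) = r * (cis (- pi / 5) * cis (- t) * cis (- pi / 5))"
        "cis (pi / 5) * (r * cis t) * cis (pi / 5) = r * (cis (pi / 5) * cis t * cis (pi / 5))"
        by (simp_all only: mult_ac)
      then show "cis (- pi / 5) * (r * cis (- t)) * cis (- pi / 5) = r * cis (- (t + 2 * pi / 5))"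
        "cis (pi / 5) * (r * cis t) * cis (pi / 5) = r * cis (t + 2 * pi / 5)"
        unfolding cis_mult by (simp_all add: algebra_simps)
    qed
    show ?thesis
      unfolding ring_vertex_def t t_def[symmetric] mat2_eq_iff matmul_nth conj_transpose_nth
        pauli_nth c mat2_nth cis_cnj using m
      by (simp add: cis_mult algebra_simps)
  qed
  then show "?A ** ring_vertex k ** conj_transpose ?A \<in> icosahedron"
    using ring_vertex_in by simp
qed

text \<open>
  The half turn about the second coordinate axis, which exchanges the two poles.
\<close>

lemma half_turn_in_Istar: "mat2 0 (- 1) 1 0 \<in> Istar"
proof (rule IstarI)
  let ?A = "mat2 0 (- 1) 1 0"
  have e: "?A ** pauli x y z ** conj_transpose ?A = - pauli x (- y) z" for x y z
    by (simp add: mat2_eq_iff complex_eq_iff)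
  show "?A \<in> SU2" by (simp add: SU2_iff)
  show "?A ** pauli 0 0 1 ** conj_transpose ?A \<in> icosahedron"
    unfolding e by (simp add: icosahedron_alt)
  fix k :: nat assume "k < 5"
  then have "?A ** ring_vertex k ** conj_transpose ?A = - ring_vertex (5 - k)"
    by (subst ring_vertex_reflect) (simp_all add: ring_vertex_def e)
  then show "?A ** ring_vertex k ** conj_transpose ?A \<in> icosahedron"
    using neg_ring_vertex_in by simp
qed

text \<open>
  For \<open>\<theta> = 2 \<pi> / 5\<close>, the equation \<open>cos (4 \<theta>) = cos \<theta>\<close> is a quartic equation for \<open>c = cos \<theta>\<close>, whose
  roots \<open>1\<close> and \<open>- 1 / 2\<close> are excluded by \<open>0 < c < 1\<close>.
\<close>

lemma cos_fifth_turn: "cos (2 * pi / 5) = (sqrt 5 - 1) / 4" "cos (4 * pi / 5) = - (sqrt 5 + 1) / 4"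
proof -
  define c where "c = cos (2 * pi / 5)"
  have c4: "cos (4 * pi / 5) = 2 * c\<^sup>2 - 1"
    using cos_double_cos[of "2 * pi / 5"] by (simp add: c_def)
  have "cos (8 * pi / 5) = 2 * (cos (4 * pi / 5))\<^sup>2 - 1"
    using cos_double_cos[of "4 * pi / 5"] by simp
  moreover have "cos (8 * pi / 5) = c"
  proof -
    have "8 * pi / 5 = 2 * pi - 2 * pi / 5" by simp
    then show ?thesis unfolding c_def by (simp only: cos_diff cos_two_pi sin_two_pi)
  qed
  ultimately have "c = 2 * (2 * c\<^sup>2 - 1)\<^sup>2 - 1" using c4 by simp
  then have "(c - 1) * ((2 * c + 1) * (4 * c\<^sup>2 + 2 * c - 1)) = 0" by algebra
  moreover have c0: "c > 0" unfolding c_def by (rule cos_gt_zero) auto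
  moreover have "c < 1" unfolding c_def using cos_monotone_0_pi[of 0 "2 * pi / 5"] by simp
  ultimately have q: "4 * c\<^sup>2 + 2 * c - 1 = 0" by auto
  then have "(4 * c + 1)\<^sup>2 = 5" by algebra
  then have "4 * c + 1 = sqrt 5" using c0 by (metis abs_of_pos add_pos_pos mult_pos_pos real_sqrt_abs zero_less_numeral zero_less_one)
  then have "c = (sqrt 5 - 1) / 4" by simp
  then show "cos (2 * pi / 5) = (sqrt 5 - 1) / 4" by (simp add: c_def)
  have "2 * c\<^sup>2 - 1 = - c - 1 / 2" using q by simp
  then show "cos (4 * pi / 5) = - (sqrt 5 + 1) / 4"
    using c4 \<open>c = (sqrt 5 - 1) / 4\<close> by (simp add: field_simps)
qed

text \<open>
  The half turn about the midpoint of the edge between the north pole and the vertex \<open>0\<close> of the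
  ring. With \<open>\<alpha>\<close> the angle between these two vertices, \<open>cos \<alpha> = 1 / \<surd>5\<close>, and \<open>c\<close>, \<open>s\<close> are the
  cosine and sine of \<open>\<alpha> / 2\<close>.
\<close>

lemma tilted_half_turn_in_Istar:
  assumes c: "c\<^sup>2 = (1 + 1 / sqrt 5) / 2" and s: "s\<^sup>2 = (1 - 1 / sqrt 5) / 2" and pos: "c > 0" "s > 0"
  shows "mat2 (\<i> * of_real c) (\<i> * of_real s) (\<i> * of_real s) (- \<i> * of_real c) \<in> Istar"
proof (rule IstarI)
  let ?A = "mat2 (\<i> * of_real c) (\<i> * of_real s) (\<i> * of_real s) (- \<i> * of_real c)"
  have cs1: "c\<^sup>2 + s\<^sup>2 = 1" unfolding c s by (simp add: field_simps)
  have d: "c\<^sup>2 - s\<^sup>2 = 1 / sqrt 5" unfolding c s by (simp add: field_simps)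
  have p: "2 * c * s = 2 / sqrt 5"
  proof -
    have "(c * s)\<^sup>2 = (1 / sqrt 5)\<^sup>2"
      unfolding power_mult_distrib c s by (simp add: field_simps power2_eq_square)
    then have "c * s = 1 / sqrt 5" using pos by (simp add: power2_eq_iff_nonneg)
    then show ?thesis by simp
  qed
  have e: "?A ** pauli x y z ** conj_transpose ?A =
      pauli (2 * c * s * z - (c\<^sup>2 - s\<^sup>2) * x) (- y) ((c\<^sup>2 - s\<^sup>2) * z + 2 * c * s * x)" for x y z
  proof -
    have "y * c\<^sup>2 + y * s\<^sup>2 = y" using cs1 by (simp flip: distrib_left)
    then show ?thesis
      by (simp add: mat2_eq_iff complex_eq_iff power2_eq_square algebra_simps)
  qed
  show "?A \<in> SU2"
  proof -
    have "complex_of_real (c\<^sup>2 + s\<^sup>2) = 1" using cs1 by simp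
    then show ?thesis by (simp add: SU2_iff power2_eq_square algebra_simps)
  qed
  have "?A ** pauli 0 0 1 ** conj_transpose ?A = ring_vertex 0"
    unfolding e d p ring_vertex_def by simp
  then show "?A ** pauli 0 0 1 ** conj_transpose ?A \<in> icosahedron" using ring_vertex_in by simp
  \<comment> \<open>The turn sends the ring vertex \<open>0\<close> to the pole, exchanges \<open>1\<close> and \<open>4\<close>, and sends \<open>2\<close> and \<open>3\<close> to
    their antipodes.\<close>
  have tog: "?A ** ring_vertex k ** conj_transpose ?A = pauli (2 / 5 - 2 / 5 * cos (2 * pi * real k / 5))
     (- (2 / sqrt 5 * sin (2 * pi * real k / 5))) (1 / 5 + 4 / 5 * cos (2 * pi * real k / 5))" for k
    unfolding ring_vertex_def e d p by (simp add: field_simps)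
  fix k :: nat assume "k < 5"
  then consider "k = 0" | "k = 1 \<or> k = 4" | "k = 2 \<or> k = 3" by linarith
  then show "?A ** ring_vertex k ** conj_transpose ?A \<in> icosahedron"
  proof cases
    case 1
    have "?A ** ring_vertex k ** conj_transpose ?A = pauli 0 0 1" unfolding tog using 1 by simp
    then show ?thesis by (simp add: icosahedron_alt)
  next
    case 2
    have ck: "cos (2 * pi * real k / 5) = (sqrt 5 - 1) / 4"
    proof -
      have "2 * pi * 4 / 5 = 2 * pi - 2 * pi / 5" by simp
      then have "cos (2 * pi * 4 / 5) = cos (2 * pi / 5)" by (simp only: cos_diff cos_two_pi sin_two_pi)
      then show ?thesis using 2 cos_fifth_turn(1) by auto
    qed
    have "2 / 5 - 2 / 5 * cos (2 * pi * real k / 5) = 2 / sqrt 5 * cos (2 * pi * real k / 5)"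
      "1 / 5 + 4 / 5 * cos (2 * pi * real k / 5) = 1 / sqrt 5"
      unfolding ck by (simp_all add: field_simps)
    then have "?A ** ring_vertex k ** conj_transpose ?A = ring_vertex (5 - k)"
      unfolding tog using \<open>k < 5\<close> by (subst ring_vertex_reflect) simp_all
    then show ?thesis using ring_vertex_in by simp
  next
    case 3
    have ck: "cos (2 * pi * real k / 5) = - (sqrt 5 + 1) / 4"
    proof -
      have "2 * pi * 3 / 5 = 2 * pi - 4 * pi / 5" by simp
      then have "cos (2 * pi * 3 / 5) = cos (4 * pi / 5)" by (simp only: cos_diff cos_two_pi sin_two_pi)
      then show ?thesis using 3 cos_fifth_turn(2) by auto
    qed
    have "2 / 5 - 2 / 5 * cos (2 * pi * real k / 5) = - (2 / sqrt 5 * cos (2 * pi * real k / 5))"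
      "1 / 5 + 4 / 5 * cos (2 * pi * real k / 5) = - (1 / sqrt 5)"
      unfolding ck by (simp_all add: field_simps)
    then have "?A ** ring_vertex k ** conj_transpose ?A = - ring_vertex k"
      unfolding tog by (simp add: ring_vertex_def uminus_pauli)
    then show ?thesis using neg_ring_vertex_in by simp
  qed
qed

section \<open>Linear isometries preserve Lebesgue measure\<close>

lemma prod_Basis_vec:
  "(\<Prod>b\<in>(Basis :: ('a::euclidean_space ^ 'n) set). f b) = (\<Prod>i\<in>UNIV. \<Prod>u\<in>Basis. f (axis i u))"
proof -
  have B: "(Basis :: ('a ^ 'n) set) = (\<lambda>(i, u). axis i u) ` (UNIV \<times> Basis)"
    by (auto simp: Basis_vec_def image_iff)
  have inj: "inj_on (\<lambda>(i, u). axis i u :: 'a ^ 'n) (UNIV \<times> Basis)"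
    by (auto simp: inj_on_def axis_eq_axis nonzero_Basis)
  show ?thesis
    unfolding B prod.reindex[OF inj] by (simp add: prod.cartesian_product case_prod_unfold)
qed

text \<open>
  Invariance of Lebesgue measure under orthogonal maps is known for \<open>real ^ 'n\<close>; this
  identification transports it to \<open>complex ^ 2\<close>.
\<close>

definition C2_to_R4 :: "complex^2 \<Rightarrow> real^4"
  where "C2_to_R4 z = (\<chi> i. if i = 1 then Re (z$1) else if i = 2 then Im (z$1) else if i = 3 then Re (z$2) else Im (z$2))"

definition R4_to_C2 :: "real^4 \<Rightarrow> complex^2"
  where "R4_to_C2 x = vector [Complex (x$1) (x$2), Complex (x$3) (x$4)]"

lemma C2_to_R4_nth [simp]:
  "C2_to_R4 z $ 1 = Re (z$1)" "C2_to_R4 z $ 2 = Im (z$1)"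
  "C2_to_R4 z $ 3 = Re (z$2)" "C2_to_R4 z $ 4 = Im (z$2)"
  by (simp_all add: C2_to_R4_def)

lemma R4_to_C2_nth [simp]:
  "R4_to_C2 x $ 1 = Complex (x$1) (x$2)" "R4_to_C2 x $ 2 = Complex (x$3) (x$4)"
  by (simp_all add: R4_to_C2_def)

lemma R4_to_C2_to_R4 [simp]: "C2_to_R4 (R4_to_C2 x) = x" "R4_to_C2 (C2_to_R4 z) = z"
  by (simp_all add: vec_eq_iff forall_4 forall_2)

lemma linear_C2_to_R4: "linear C2_to_R4"
  by (rule linearI) (simp_all add: vec_eq_iff forall_4)

lemma linear_R4_to_C2: "linear R4_to_C2"
  by (rule linearI) (simp_all add: vec_eq_iff forall_2 complex_eq_iff)

lemma norm_C2_to_R4: "norm (C2_to_R4 z) = norm z"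
  by (simp add: norm_vec_def L2_set_def sum_2 sum_4 cmod_power2 add.assoc)

lemma borel_C2_to_R4 [measurable]: "C2_to_R4 \<in> borel \<rightarrow>\<^sub>M borel"
  by (intro borel_measurable_continuous_onI linear_continuous_on)
    (simp add: linear_C2_to_R4 linear_linear)

lemma borel_R4_to_C2 [measurable]: "R4_to_C2 \<in> borel \<rightarrow>\<^sub>M borel"
  by (intro borel_measurable_continuous_onI linear_continuous_on)
    (simp add: linear_R4_to_C2 linear_linear)

text \<open>
  The identification matches the standard bases, so it maps boxes to boxes of equal volume.
\<close>

lemma distr_C2_to_R4: "distr lborel borel C2_to_R4 = lborel"
proof (rule lborel_eqI[symmetric])
  fix l u :: "real^4"
  assume le: "\<And>b. b \<in> Basis \<Longrightarrow> l \<bullet> b \<le> u \<bullet> b"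
  have le': "l $ i \<le> u $ i" for i using le[of "axis i 1"] by (simp add: axis_in_Basis_iff inner_axis)
  have vim: "C2_to_R4 -` box l u = box (R4_to_C2 l) (R4_to_C2 u)"
    by (auto simp: box_def Basis_vec_def inner_axis forall_2 forall_4 Basis_complex_def Basis_real_def)
  have le2: "R4_to_C2 l \<bullet> b \<le> R4_to_C2 u \<bullet> b" if "b \<in> Basis" for b
  proof -
    have "\<exists>i v. b = axis i v \<and> v \<in> Basis" using that unfolding Basis_vec_def by blast
    then obtain i v where b: "b = axis i v" "v = 1 \<or> v = \<i>"
      by (auto simp only: Basis_complex_def insert_iff empty_iff)
    then show ?thesis
      using le' exhaust_2[of i] by (auto simp: inner_axis)
  qed
  have "emeasure (distr lborel borel C2_to_R4) (box l u) = emeasure lborel (C2_to_R4 -` box l u)"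
    by (simp add: emeasure_distr)
  also have "\<dots> = (\<Prod>b\<in>Basis. (R4_to_C2 u - R4_to_C2 l) \<bullet> b)"
    unfolding vim by (rule emeasure_lborel_box[OF le2])
  also have "(\<Prod>b\<in>Basis. (R4_to_C2 u - R4_to_C2 l) \<bullet> b) = (\<Prod>b\<in>Basis. (u - l) \<bullet> b)"
  proof -
    have "(\<Prod>b\<in>Basis. (R4_to_C2 u - R4_to_C2 l) \<bullet> b) =
        (u$1 - l$1) * (u$2 - l$2) * ((u$3 - l$3) * (u$4 - l$4))"
      unfolding prod_Basis_vec UNIV_2 Basis_complex_def by (simp add: inner_axis)
    moreover have "(\<Prod>b\<in>Basis. (u - l) \<bullet> b) =
        (u$1 - l$1) * ((u$2 - l$2) * ((u$3 - l$3) * (u$4 - l$4)))"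
      unfolding prod_Basis_vec UNIV_4 Basis_real_def by (simp add: inner_axis)
    ultimately show ?thesis by (simp only: mult.assoc)
  qed
  finally show "emeasure (distr lborel borel C2_to_R4) (box l u) = (\<Prod>b\<in>Basis. (u - l) \<bullet> b)" .
qed simp

lemma distr_lborel_orthogonal_vec:
  fixes T :: "real^4 \<Rightarrow> real^4"
  assumes T: "orthogonal_transformation T"
  shows "distr lborel borel T = lborel"
proof (rule lborel_eqI[symmetric])
  fix l u :: "real^4"
  assume le: "\<And>b. b \<in> Basis \<Longrightarrow> l \<bullet> b \<le> u \<bullet> b"
  have [measurable]: "T \<in> borel \<rightarrow>\<^sub>M borel"
    using T by (intro borel_measurable_continuous_onI linear_continuous_on)
      (simp add: orthogonal_transformation_linear linear_linear)
  have bij: "bij T" by (rule orthogonal_transformation_bij[OF T])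
  have invT: "orthogonal_transformation (inv T)" by (rule orthogonal_transformation_inv[OF T])
  have vim: "T -` box l u = inv T ` box l u" by (rule bij_vimage_eq_inv_image[OF bij])
  have b: "T -` box l u \<in> sets borel" using measurable_sets[of T borel borel "box l u"] by simp
  have "emeasure (distr lborel borel T) (box l u) = emeasure lborel (T -` box l u)"
    by (simp add: emeasure_distr)
  also have "\<dots> = emeasure lebesgue (inv T ` box l u)"
    using b by (simp add: vim)
  also have "\<dots> = emeasure lebesgue (box l u)"
    using measure_orthogonal_image[OF invT, of "box l u"] measurable_orthogonal_image[OF invT, of "box l u"]
    by (simp add: emeasure_eq_measure2)
  also have "\<dots> = (\<Prod>b\<in>Basis. (u - l) \<bullet> b)"
    using le by (simp add: emeasure_lborel_box)
  finally show "emeasure (distr lborel borel T) (box l u) = (\<Prod>b\<in>Basis. (u - l) \<bullet> b)" .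
qed simp

lemma distr_lborel_isometry_C2:
  fixes T :: "complex^2 \<Rightarrow> complex^2"
  assumes lin: "linear T" and iso: "\<And>z. norm (T z) = norm z"
  shows "distr lborel borel T = lborel"
proof -
  define T' where "T' = C2_to_R4 \<circ> T \<circ> R4_to_C2"
  have [measurable]: "T \<in> borel \<rightarrow>\<^sub>M borel"
    using lin by (intro borel_measurable_continuous_onI linear_continuous_on) (simp add: linear_linear)
  have "orthogonal_transformation T'"
    unfolding orthogonal_transformation T'_def using iso norm_C2_to_R4
    by (simp add: linear_compose lin linear_C2_to_R4 linear_R4_to_C2)
       (metis R4_to_C2_to_R4(1))
  then have T': "distr lborel borel T' = lborel" by (rule distr_lborel_orthogonal_vec)
  have [measurable]: "T' \<in> borel \<rightarrow>\<^sub>M borel" unfolding T'_def comp_def by measurable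
  have bk: "distr lborel borel R4_to_C2 = lborel"
    unfolding distr_C2_to_R4[symmetric] by (simp add: distr_distr comp_def distr_id2)
  have "distr lborel borel T = distr (distr lborel borel R4_to_C2) borel T" by (simp only: bk)
  also have "\<dots> = distr (distr lborel borel T') borel R4_to_C2"
    by (simp add: distr_distr comp_def T'_def)
  finally show ?thesis by (simp only: T' bk)
qed

section \<open>The invariant volume of SU(2)\<close>

lemma sets_vol_SU2 [measurable_cong, simp]: "sets vol_SU2 = sets borel"
  by (simp add: vol_SU2_def)

lemma space_vol_SU2 [simp]: "space vol_SU2 = UNIV"
  by (simp add: vol_SU2_def space_scale_measure)

lemma continuous_sphere_map: "continuous_on (- {0}) (\<lambda>z. SU2_of_sphere (sgn z))"
  by (intro continuous_intros continuous_on_sgn) auto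

lemma borel_sphere_map [measurable]: "(\<lambda>z. SU2_of_sphere (sgn z)) \<in> borel \<rightarrow>\<^sub>M borel"
proof -
  have "continuous_on UNIV SU2_of_sphere" by (intro continuous_intros)
  then have "SU2_of_sphere \<in> borel \<rightarrow>\<^sub>M borel" by (rule borel_measurable_continuous_onI)
  moreover have "(sgn :: complex^2 \<Rightarrow> _) \<in> borel \<rightarrow>\<^sub>M borel" unfolding sgn_div_norm by measurable
  ultimately show ?thesis by measurable
qed

lemma emeasure_vol_SU2:
  assumes "B \<in> sets borel"
  shows "emeasure vol_SU2 B =
    4 * emeasure lborel {z \<in> cball 0 1 - {0}. SU2_of_sphere (sgn z) \<in> B}"
proof -
  have "emeasure vol_SU2 B = 4 * emeasure (restrict_space lborel (cball 0 1 - {0}))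
      ((\<lambda>z. SU2_of_sphere (sgn z)) -` B \<inter> (cball 0 1 - {0}))"
    unfolding vol_SU2_def emeasure_scale_measure using assms
    by (subst emeasure_distr) (auto simp: space_restrict_space intro!: measurable_restrict_space1)
  also have "(\<lambda>z. SU2_of_sphere (sgn z)) -` B \<inter> (cball 0 1 - {0}) =
      {z \<in> cball 0 1 - {0}. SU2_of_sphere (sgn z) \<in> B}" by auto
  finally show ?thesis by (subst (asm) emeasure_restrict_space) auto
qed

lemma sphere_map_in_SU2: "z \<noteq> 0 \<Longrightarrow> SU2_of_sphere (sgn z) \<in> SU2"
  by (rule SU2_of_sphere_in_SU2) (simp add: norm_sgn)

lemma finite_measure_vol_SU2: "finite_measure vol_SU2"
proof
  have "emeasure lborel (cball (0::complex^2) 1) < \<infinity>" using emeasure_lborel_cball_finite by blast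
  moreover have "emeasure lborel {z \<in> cball (0::complex^2) 1 - {0}. SU2_of_sphere (sgn z) \<in> UNIV}
    \<le> emeasure lborel (cball (0::complex^2) 1)" by (rule emeasure_mono) auto
  ultimately show "emeasure vol_SU2 (space vol_SU2) \<noteq> \<infinity>"
    unfolding space_vol_SU2 by (subst emeasure_vol_SU2) (auto simp: ennreal_mult_eq_top_iff top_unique)
qed

lemma closed_SU2: "closed SU2" by (rule compact_imp_closed[OF compact_SU2])

lemma SU2_borel [measurable, simp]: "SU2 \<in> sets borel"
  using closed_SU2 by simp

text \<open>
  Under the identification of a matrix with its first column, \<open>X \<mapsto> A X B\<close> becomes a real linear
  map \<open>T\<close> of \<open>\<complex>\<^sup>2\<close>. It is isometric because the squared norm of a column \<open>z\<close> is the determinant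
  of \<open>SU2_of_sphere z\<close>, and determinants are multiplicative.
\<close>

lemma vol_SU2_two_sided_invariant:
  assumes A: "A \<in> SU2" and B: "B \<in> SU2"
  shows "distr vol_SU2 borel (\<lambda>X. A ** X ** B) = vol_SU2"
proof (rule measure_eqI)
  define \<Phi> where "\<Phi> = (\<lambda>X. A ** X ** B)"
  define T :: "complex^2 \<Rightarrow> complex^2"
    where "T = (\<lambda>z. vector [\<Phi> (SU2_of_sphere z) $ 1 $ 1, \<Phi> (SU2_of_sphere z) $ 2 $ 1])"
  have AB: "A$2$2 = cnj (A$1$1)" "A$1$2 = - cnj (A$2$1)" "B$2$2 = cnj (B$1$1)" "B$1$2 = - cnj (B$2$1)"
    using A B by (simp_all add: SU2_iff)
  have dets: "det A = 1" "det B = 1" using A B by (simp_all add: SU2_def)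
  have T: "SU2_of_sphere (T z) = \<Phi> (SU2_of_sphere z)" for z
    by (simp add: mat2_eq_iff T_def \<Phi>_def AB algebra_simps)
  have "linear T"
    by (rule linearI) (simp_all add: vec_eq_iff forall_2 T_def \<Phi>_def algebra_simps)
  moreover have nT: "norm (T z) = norm z" for z
  proof -
    have d: "complex_of_real ((norm w)\<^sup>2) = det (SU2_of_sphere w)" for w
      unfolding norm_C2_sq of_real_add complex_norm_square by (simp add: det_2 mult.commute)
    have "complex_of_real ((norm (T z))\<^sup>2) = complex_of_real ((norm z)\<^sup>2)"
      unfolding d T by (simp add: \<Phi>_def det_mul dets)
    then show ?thesis by (simp only: of_real_eq_iff) (simp add: power2_eq_iff_nonneg)
  qed
  ultimately have dT: "distr lborel borel T = lborel" by (rule distr_lborel_isometry_C2)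
  have [measurable]: "T \<in> borel \<rightarrow>\<^sub>M borel"
    using \<open>linear T\<close> by (intro borel_measurable_continuous_onI linear_continuous_on) (simp add: linear_linear)
  have "continuous_on UNIV \<Phi>" unfolding \<Phi>_def by (intro continuous_intros)
  then have [measurable]: "\<Phi> \<in> borel \<rightarrow>\<^sub>M borel" by (rule borel_measurable_continuous_onI)
  have sgnT: "SU2_of_sphere (sgn (T z)) = \<Phi> (SU2_of_sphere (sgn z))" for z
  proof -
    have "sgn (T z) = T (sgn z)"
      using \<open>linear T\<close> by (simp add: sgn_div_norm nT linear_cmul)
    then show ?thesis by (simp add: T)
  qed
  fix C assume "C \<in> sets (distr vol_SU2 borel (\<lambda>X. A ** X ** B))"
  then have C [measurable]: "C \<in> sets borel" by simp
  define D where "D = {z \<in> cball 0 1 - {0}. SU2_of_sphere (sgn z) \<in> C}"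
  have [measurable]: "D \<in> sets borel" unfolding D_def by measurable
  have "emeasure (distr vol_SU2 borel (\<lambda>X. A ** X ** B)) C = emeasure vol_SU2 (\<Phi> -` C)"
    unfolding \<Phi>_def[symmetric] by (subst emeasure_distr) auto
  also have "\<dots> = 4 * emeasure lborel {z \<in> cball 0 1 - {0}. SU2_of_sphere (sgn z) \<in> \<Phi> -` C}"
    using measurable_sets[of \<Phi> borel borel C] by (intro emeasure_vol_SU2) simp
  also have "{z \<in> cball 0 1 - {0}. SU2_of_sphere (sgn z) \<in> \<Phi> -` C} = T -` D"
  proof -
    have "T z = 0 \<longleftrightarrow> z = 0" for z using nT[of z] by (metis norm_eq_zero)
    then show ?thesis by (auto simp: D_def sgnT nT dist_norm)
  qed
  also have "emeasure lborel (T -` D) = emeasure (distr lborel borel T) D"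
    by (subst emeasure_distr) auto
  also have "4 * \<dots> = emeasure vol_SU2 C" unfolding dT by (simp add: D_def emeasure_vol_SU2)
  finally show "emeasure (distr vol_SU2 borel (\<lambda>X. A ** X ** B)) C = emeasure vol_SU2 C" .
qed simp

definition SU2_integral :: "(mat2 \<Rightarrow> 'b::{banach, second_countable_topology}) \<Rightarrow> 'b"
  where "SU2_integral \<phi> = (LINT A:SU2|vol_SU2. \<phi> A)"

lemma SU2_integrable:
  fixes \<phi> :: "mat2 \<Rightarrow> 'b::{banach, second_countable_topology}"
  assumes "continuous_on SU2 \<phi>"
  shows "set_integrable vol_SU2 SU2 \<phi>"
proof -
  interpret finite_measure vol_SU2 by (rule finite_measure_vol_SU2)
  obtain c where c: "\<And>A. A \<in> SU2 \<Longrightarrow> norm (\<phi> A) \<le> c"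
    using compact_imp_bounded[OF compact_continuous_image[OF assms compact_SU2]]
    by (auto simp: bounded_iff)
  have "(\<lambda>A. indicator SU2 A *\<^sub>R \<phi> A) \<in> borel_measurable borel"
    by (rule borel_measurable_continuous_on_indicator[OF _ assms]) simp
  moreover have "norm (indicator SU2 A *\<^sub>R \<phi> A) \<le> \<bar>c\<bar>" for A
    using c[of A] by (auto simp: indicator_def)
  ultimately show ?thesis
    unfolding set_integrable_def by (intro integrable_const_bound[of _ "\<bar>c\<bar>"]) auto
qed

lemma SU2_integral_cong: "(\<And>A. A \<in> SU2 \<Longrightarrow> \<phi> A = \<psi> A) \<Longrightarrow> SU2_integral \<phi> = SU2_integral \<psi>"
  unfolding SU2_integral_def by (rule set_lebesgue_integral_cong) auto

lemma SU2_integral_add: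
  "continuous_on SU2 \<phi> \<Longrightarrow> continuous_on SU2 \<psi> \<Longrightarrow>
    SU2_integral (\<lambda>A. \<phi> A + \<psi> A) = SU2_integral \<phi> + SU2_integral \<psi>"
  unfolding SU2_integral_def by (intro set_integral_add SU2_integrable)

lemma SU2_integral_diff:
  "continuous_on SU2 \<phi> \<Longrightarrow> continuous_on SU2 \<psi> \<Longrightarrow>
    SU2_integral (\<lambda>A. \<phi> A - \<psi> A) = SU2_integral \<phi> - SU2_integral \<psi>"
  unfolding SU2_integral_def by (intro set_integral_diff SU2_integrable)

lemma SU2_integral_bounded_linear:
  assumes "bounded_linear T" "continuous_on SU2 \<phi>"
  shows "SU2_integral (\<lambda>A. T (\<phi> A)) = T (SU2_integral \<phi>)"
proof -
  interpret bounded_linear T by fact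
  have "SU2_integral (\<lambda>A. T (\<phi> A)) = (LINT A|vol_SU2. T (indicator SU2 A *\<^sub>R \<phi> A))"
    by (simp add: SU2_integral_def set_lebesgue_integral_def scaleR)
  also have "\<dots> = T (SU2_integral \<phi>)"
    using SU2_integrable[OF assms(2)] unfolding SU2_integral_def set_lebesgue_integral_def set_integrable_def
    by (rule integral_bounded_linear[OF assms(1)])
  finally show ?thesis .
qed

lemma SU2_integral_zero [simp]: "SU2_integral (\<lambda>A. 0) = 0"
  by (simp add: SU2_integral_def set_lebesgue_integral_def)

lemma SU2_integral_sum:
  "(\<And>i. i \<in> I \<Longrightarrow> continuous_on SU2 (\<phi> i)) \<Longrightarrow>
    SU2_integral (\<lambda>A. \<Sum>i\<in>I. \<phi> i A) = (\<Sum>i\<in>I. SU2_integral (\<phi> i))"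
proof (induction I rule: infinite_finite_induct)
  case (insert i I)
  then show ?case by (simp add: SU2_integral_add continuous_on_sum)
qed auto

lemma SU2_integral_mult_left:
  fixes \<phi> :: "mat2 \<Rightarrow> 'b::{banach, second_countable_topology, real_normed_algebra}"
  shows "continuous_on SU2 \<phi> \<Longrightarrow> SU2_integral (\<lambda>A. c * \<phi> A) = c * SU2_integral \<phi>"
  by (rule SU2_integral_bounded_linear[OF bounded_linear_mult_right])

lemma SU2_integral_translate:
  fixes \<phi> :: "mat2 \<Rightarrow> 'b::{banach, second_countable_topology}"
  assumes A: "A \<in> SU2" and B: "B \<in> SU2" and cont: "continuous_on SU2 \<phi>"
  shows "SU2_integral (\<lambda>X. \<phi> (A ** X ** B)) = SU2_integral \<phi>"
proof -
  have ind: "indicator SU2 (A ** X ** B) = (indicator SU2 X :: real)" for X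
  proof -
    have "X \<in> SU2" if "A ** X ** B \<in> SU2"
    proof -
      have "conj_transpose A ** (A ** X ** B) ** conj_transpose B \<in> SU2" using that A B by blast
      moreover have "conj_transpose A ** (A ** X ** B) ** conj_transpose B = X"
        using A B by (simp add: matrix_mul_assoc SU2_left_inverse)
      ultimately show ?thesis by simp
    qed
    then show ?thesis using A B by (auto simp: indicator_def)
  qed
  have "continuous_on UNIV (\<lambda>X. A ** X ** B)" by (intro continuous_intros)
  then have m: "(\<lambda>X. A ** X ** B) \<in> borel \<rightarrow>\<^sub>M borel" by (rule borel_measurable_continuous_onI)
  have m2: "(\<lambda>X. indicator SU2 X *\<^sub>R \<phi> X) \<in> borel_measurable borel"
    by (rule borel_measurable_continuous_on_indicator[OF _ cont]) simp
  have "SU2_integral \<phi> = (LINT X|distr vol_SU2 borel (\<lambda>X. A ** X ** B). indicator SU2 X *\<^sub>R \<phi> X)"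
    by (simp add: SU2_integral_def set_lebesgue_integral_def vol_SU2_two_sided_invariant[OF A B])
  also have "\<dots> = (LINT X|vol_SU2. indicator SU2 (A ** X ** B) *\<^sub>R \<phi> (A ** X ** B))"
    using m m2 by (intro integral_distr) (auto cong: measurable_cong_sets)
  finally show ?thesis by (simp add: ind SU2_integral_def set_lebesgue_integral_def)
qed

text \<open>
  A positive value would make the function positive on a nonempty open subset of the unit ball,
  which is not a null set.
\<close>

lemma SU2_integral_eq_0_imp:
  fixes \<phi> :: "mat2 \<Rightarrow> real"
  assumes cont: "continuous_on SU2 \<phi>" and nonneg: "\<And>A. A \<in> SU2 \<Longrightarrow> \<phi> A \<ge> 0"
    and zero: "SU2_integral \<phi> = 0" and A: "A \<in> SU2"
  shows "\<phi> A = 0"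
proof (rule ccontr)
  assume "\<phi> A \<noteq> 0"
  then have pos: "\<phi> A > 0" using nonneg[OF A] by simp
  have "AE X in vol_SU2. indicator SU2 X *\<^sub>R \<phi> X = 0"
  proof (rule integral_nonneg_eq_0_iff_AE[THEN iffD1])
    show "integrable vol_SU2 (\<lambda>X. indicator SU2 X *\<^sub>R \<phi> X)"
      using SU2_integrable[OF cont] by (simp add: set_integrable_def)
    show "AE X in vol_SU2. 0 \<le> indicator SU2 X *\<^sub>R \<phi> X" using nonneg by (auto simp: indicator_def)
    show "(LINT X|vol_SU2. indicator SU2 X *\<^sub>R \<phi> X) = 0"
      using zero by (simp add: SU2_integral_def set_lebesgue_integral_def)
  qed
  moreover define N where "N = {X. indicator SU2 X *\<^sub>R \<phi> X \<noteq> 0}"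
  have m2: "(\<lambda>X. indicator SU2 X *\<^sub>R \<phi> X) \<in> borel_measurable borel"
    by (rule borel_measurable_continuous_on_indicator[OF _ cont]) simp
  have Nb: "N \<in> sets borel" unfolding N_def using m2 by measurable
  ultimately have "emeasure vol_SU2 N = 0"
    using AE_iff_measurable[of N vol_SU2 "\<lambda>X. indicator SU2 X *\<^sub>R \<phi> X = 0"] by (simp add: N_def)
  then have em: "emeasure lborel {z \<in> cball 0 1 - {0}. SU2_of_sphere (sgn z) \<in> N} = 0"
    unfolding emeasure_vol_SU2[OF Nb] by simp
  define V where "V = {z \<in> ball 0 1 - {0}. \<phi> (SU2_of_sphere (sgn z)) > 0}"
  have "continuous_on (ball 0 1 - {0}) (\<lambda>z. \<phi> (SU2_of_sphere (sgn z)))"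
    by (rule continuous_on_compose2[OF cont continuous_on_subset[OF continuous_sphere_map]])
      (auto intro: sphere_map_in_SU2)
  then have "open ((\<lambda>z. \<phi> (SU2_of_sphere (sgn z))) -` {0<..} \<inter> (ball 0 1 - {0}))"
    by (intro continuous_on_open_vimage[THEN iffD1, rule_format]) auto
  moreover have "(\<lambda>z. \<phi> (SU2_of_sphere (sgn z))) -` {0<..} \<inter> (ball 0 1 - {0}) = V"
    by (auto simp: V_def)
  ultimately have V: "open V" by simp
  have Vsub: "V \<subseteq> {z \<in> cball 0 1 - {0}. SU2_of_sphere (sgn z) \<in> N}"
    using sphere_map_in_SU2 by (auto simp: V_def N_def)
  obtain w where w: "norm w = 1" "SU2_of_sphere w = A"
    using A unfolding SU2_eq_image_sphere by auto
  have "(1/2) *\<^sub>R w \<in> V"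
    using w pos by (auto simp: V_def sgn_div_norm)
  then have "V \<noteq> {}" by auto
  moreover have "emeasure lborel V = 0"
  proof -
    have "{z \<in> cball 0 1 - {0}. SU2_of_sphere (sgn z) \<in> N} \<in> sets lborel"
      using Nb by measurable
    then show ?thesis using emeasure_mono[OF Vsub, of lborel] em by simp
  qed
  then have "V \<in> null_sets lebesgue" using V by (simp add: null_sets_def)
  then have "negligible V" by (simp add: negligible_iff_null_sets)
  ultimately show False using open_not_negligible[OF V] by blast
qed

section \<open>Second derivatives along geodesics\<close>

text \<open>
  The geodesic \<open>x exp (t e)\<close>.
\<close>

definition geo :: "mat2 \<Rightarrow> real \<Rightarrow> mat2 \<Rightarrow> mat2"
  where "geo e t x = cos t *\<^sub>R x + sin t *\<^sub>R (x ** e)"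

lemma mat2_scaleR_nth [simp]: "(c *\<^sub>R (A::mat2)) $ i $ j = of_real c * A $ i $ j"
  by (simp add: complex_eq_iff)

lemma mat2_eqI:
  "\<lbrakk>(A::mat2)$1$1 = B$1$1; A$1$2 = B$1$2; A$2$1 = B$2$1; A$2$2 = B$2$2\<rbrakk> \<Longrightarrow> A = B"
  by (simp add: mat2_eq_iff)

lemma quaternion_unit_square: "e \<in> quaternion_units \<Longrightarrow> e ** e = - mat 1"
  by (auto simp: quaternion_units_def mat2_eq_iff)

lemma geo_0 [simp]: "geo e 0 x = x"
  by (simp add: geo_def)

lemma matmul_geo: "A ** geo e t x = geo e t (A ** x)"
  by (rule mat2_eqI) (simp_all add: geo_def algebra_simps)

lemma geo_eq: "geo e t x = x ** geo e t (mat 1)"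
  by (simp add: matmul_geo)

lemma geo_geo: "e \<in> quaternion_units \<Longrightarrow> geo e s (geo e t x) = geo e (s + t) x"
proof -
  assume e: "e \<in> quaternion_units"
  have "geo e s (geo e t x) = cos s *\<^sub>R (cos t *\<^sub>R x + sin t *\<^sub>R (x ** e)) +
      sin s *\<^sub>R (cos t *\<^sub>R (x ** e) + sin t *\<^sub>R (x ** (e ** e)))"
    by (rule mat2_eqI) (simp_all add: geo_def algebra_simps)
  also have "x ** (e ** e) = - x"
    unfolding quaternion_unit_square[OF e] by (simp add: mat2_eq_iff)
  finally show ?thesis by (simp add: geo_def cos_add sin_add algebra_simps)
qed

lemma geo_SU2: "e \<in> quaternion_units \<Longrightarrow> x \<in> SU2 \<Longrightarrow> geo e t x \<in> SU2"
proof -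
  assume e: "e \<in> quaternion_units" and x: "x \<in> SU2"
  have cs: "(cos t * cos t) *\<^sub>R 1 + (sin t * sin t) *\<^sub>R (1::complex) = 1"
    using sin_cos_squared_add3[of t] by (simp flip: scaleR_add_left)
  then have "geo e t (mat 1) \<in> SU2"
    using e by (auto simp: quaternion_units_def geo_def SU2_iff algebra_simps cs)
  then show ?thesis using x by (subst geo_eq) blast
qed

lemma geo_has_vector_derivative: "((\<lambda>t. geo e t x) has_vector_derivative (x ** e)) (at 0)"
proof -
  have "((\<lambda>t. cos t *\<^sub>R x + sin t *\<^sub>R (x ** e)) has_vector_derivative
      (- sin 0) *\<^sub>R x + cos 0 *\<^sub>R (x ** e)) (at 0)"
    by (auto intro!: derivative_eq_intros simp: has_vector_derivative_def has_derivative_scaleR_left)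
  then show ?thesis by (simp add: geo_def)
qed

lemma continuous_on_geo [continuous_intros]:
  fixes f :: "'a::t2_space \<Rightarrow> real"
  assumes "continuous_on S f" "continuous_on S g"
  shows "continuous_on S (\<lambda>x. geo e (f x) (g x))"
  unfolding geo_def by (intro continuous_intros continuous_on_cos continuous_on_sin assms)

text \<open>
  \<open>f2\<close> is the second derivative of \<open>f\<close> in the direction of the left invariant field of \<open>e\<close>, which
  is differentiation along \<open>t \<mapsto> x exp (t e)\<close> at \<open>t = 0\<close>. Requiring this at \<open>t = 0\<close> for all \<open>x\<close> is
  enough, because the geodesics are orbits of a one-parameter group.
\<close>

definition second_along :: "mat2 \<Rightarrow> (mat2 \<Rightarrow> real) \<Rightarrow> (mat2 \<Rightarrow> real) \<Rightarrow> bool"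
  where "second_along e f f2 \<longleftrightarrow> continuous_on SU2 f \<and> continuous_on SU2 f2 \<and>
    (\<exists>f1. \<forall>x\<in>SU2. ((\<lambda>t. f (geo e t x)) has_real_derivative f1 x) (at 0) \<and>
                   ((\<lambda>t. f1 (geo e t x)) has_real_derivative f2 x) (at 0))"

lemma derivative_along_shift:
  assumes e: "e \<in> quaternion_units" and x: "x \<in> SU2"
    and d: "\<And>x. x \<in> SU2 \<Longrightarrow> ((\<lambda>t. f (geo e t x)) has_real_derivative f1 x) (at 0)"
  shows "((\<lambda>t. f (geo e t x)) has_real_derivative f1 (geo e s x)) (at s)"
proof -
  have "((\<lambda>t. f (geo e t (geo e s x))) has_real_derivative f1 (geo e s x)) (at 0)"
    by (rule d[OF geo_SU2[OF e x]])
  then have "((\<lambda>t. f (geo e (t + s) x)) has_real_derivative f1 (geo e s x)) (at 0)"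
    by (simp add: geo_geo[OF e])
  then show ?thesis using DERIV_shift[of "\<lambda>t. f (geo e t x)" "f1 (geo e s x)" 0 s] by simp
qed

lemma second_along_deriv:
  assumes e: "e \<in> quaternion_units" and x: "x \<in> SU2" and f: "second_along e f f2"
  shows "(deriv ^^ 2) (\<lambda>t. f (geo e t x)) 0 = f2 x"
proof -
  obtain f1 where f1: "\<And>x. x \<in> SU2 \<Longrightarrow> ((\<lambda>t. f (geo e t x)) has_real_derivative f1 x) (at 0)"
    "\<And>x. x \<in> SU2 \<Longrightarrow> ((\<lambda>t. f1 (geo e t x)) has_real_derivative f2 x) (at 0)"
    using f by (auto simp: second_along_def)
  have "deriv (\<lambda>t. f (geo e t x)) = (\<lambda>t. f1 (geo e t x))"
    using derivative_along_shift[OF e x f1(1)] by (intro ext DERIV_imp_deriv)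
  then show ?thesis
    using f1(2)[OF x] by (simp add: numeral_2_eq_2 DERIV_imp_deriv)
qed

lemma second_along_Taylor:
  assumes e: "e \<in> quaternion_units" and x: "x \<in> SU2" and f: "second_along e f f2"
  shows "\<exists>r s. \<bar>r\<bar> \<le> \<bar>t\<bar> \<and> \<bar>s\<bar> \<le> \<bar>t\<bar> \<and>
    f (geo e t x) + f (geo e (- t) x) - 2 * f x = t\<^sup>2 * (f2 (geo e r x) + f2 (geo e s x)) / 2"
proof -
  obtain f1 where f1: "\<And>x. x \<in> SU2 \<Longrightarrow> ((\<lambda>t. f (geo e t x)) has_real_derivative f1 x) (at 0)"
    "\<And>x. x \<in> SU2 \<Longrightarrow> ((\<lambda>t. f1 (geo e t x)) has_real_derivative f2 x) (at 0)"
    using f by (auto simp: second_along_def)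
  define D where "D = (\<lambda>m::nat. if m = 0 then (\<lambda>t. f (geo e t x)) else if m = 1
    then (\<lambda>t. f1 (geo e t x)) else (\<lambda>t. f2 (geo e t x)))"
  have "\<exists>s. \<bar>s\<bar> \<le> \<bar>u\<bar> \<and> f (geo e u x) = f x + f1 x * u + f2 (geo e s x) / 2 * u\<^sup>2" for u
  proof -
    have "\<exists>s. \<bar>s\<bar> \<le> \<bar>u\<bar> \<and> f (geo e u x) = (\<Sum>m<2. D m 0 / fact m * u ^ m) + D 2 s / fact 2 * u ^ 2"
    proof (rule Maclaurin_bi_le)
      show "D 0 = (\<lambda>u. f (geo e u x))" by (simp add: D_def)
      show "\<forall>m t. m < 2 \<and> \<bar>t\<bar> \<le> \<bar>u\<bar> \<longrightarrow> (D m has_real_derivative D (Suc m) t) (at t)"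
        using derivative_along_shift[OF e x f1(1)] derivative_along_shift[OF e x f1(2)]
        by (auto simp: D_def less_2_cases_iff)
    qed
    then show ?thesis by (simp add: D_def numeral_2_eq_2)
  qed
  then obtain r s where "\<bar>r\<bar> \<le> \<bar>t\<bar>" "f (geo e t x) = f x + f1 x * t + f2 (geo e r x) / 2 * t\<^sup>2"
    "\<bar>s\<bar> \<le> \<bar>-t\<bar>" "f (geo e (-t) x) = f x + f1 x * (-t) + f2 (geo e s x) / 2 * (-t)\<^sup>2" by metis
  then show ?thesis by (intro exI[of _ r] exI[of _ s]) (auto simp: algebra_simps add_divide_distrib)
qed

text \<open>
  Symmetric second differences replace second derivatives in the proof of symmetry of the
  Laplacian: translation invariance moves them from one factor to the other without any
  differentiation under the integral sign.
\<close>

definition second_difference :: "mat2 \<Rightarrow> (mat2 \<Rightarrow> real) \<Rightarrow> nat \<Rightarrow> mat2 \<Rightarrow> real"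
  where "second_difference e f n x =
    (f (geo e (1 / Suc n) x) + f (geo e (- (1 / Suc n)) x) - 2 * f x) * (real (Suc n))\<^sup>2"

lemma second_difference_eq:
  assumes "e \<in> quaternion_units" "x \<in> SU2" "second_along e f f2"
  shows "\<exists>r s. \<bar>r\<bar> \<le> 1 / Suc n \<and> \<bar>s\<bar> \<le> 1 / Suc n \<and>
    second_difference e f n x = (f2 (geo e r x) + f2 (geo e s x)) / 2"
proof -
  have p: "(1 / real (Suc n))\<^sup>2 * y / 2 * (real (Suc n))\<^sup>2 = y / 2" for y
    by (simp add: power_divide del: of_nat_Suc)
  show ?thesis
    using second_along_Taylor[OF assms, of "1 / Suc n"] unfolding second_difference_def
    by (elim exE conjE) (simp only: p, auto simp del: of_nat_Suc)
qed

lemma second_difference_tendsto: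
  assumes e: "e \<in> quaternion_units" and x: "x \<in> SU2" and f: "second_along e f f2"
  shows "(\<lambda>n. second_difference e f n x) \<longlonglongrightarrow> f2 x"
proof -
  obtain r s where rs: "\<And>n. \<bar>r n\<bar> \<le> 1 / Suc n" "\<And>n. \<bar>s n\<bar> \<le> 1 / Suc n"
    "\<And>n. second_difference e f n x = (f2 (geo e (r n) x) + f2 (geo e (s n) x)) / 2"
    using second_difference_eq[OF assms] by metis
  have "continuous_on UNIV (\<lambda>t. f2 (geo e t x))"
    by (rule continuous_on_compose2[of SU2 f2]) (use f geo_SU2[OF e x] in \<open>auto simp: second_along_def intro!: continuous_intros\<close>)
  then have c: "isCont (\<lambda>t. f2 (geo e t x)) 0" by (simp add: continuous_on_eq_continuous_at)
  have null: "u \<longlonglongrightarrow> 0" if "\<And>n. \<bar>u n\<bar> \<le> 1 / Suc n" for u :: "nat \<Rightarrow> real"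
    by (rule Lim_null_comparison[OF _ LIMSEQ_inverse_real_of_nat])
      (use that in \<open>auto simp: inverse_eq_divide simp del: of_nat_Suc\<close>)
  have "(\<lambda>n. (f2 (geo e (r n) x) + f2 (geo e (s n) x)) / 2) \<longlonglongrightarrow>
      (f2 (geo e 0 x) + f2 (geo e 0 x)) / 2"
    using isCont_tendsto_compose[OF c null] rs by (intro tendsto_intros) auto
  then show ?thesis by (simp add: rs)
qed

lemma continuous_on_SU2_bounded:
  fixes f :: "mat2 \<Rightarrow> 'a::real_normed_vector"
  assumes "continuous_on SU2 f"
  shows "\<exists>c\<ge>0. \<forall>x\<in>SU2. norm (f x) \<le> c"
proof -
  obtain c where "\<forall>y\<in>f ` SU2. norm y \<le> c"
    using compact_imp_bounded[OF compact_continuous_image[OF assms compact_SU2]]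
    by (auto simp: bounded_iff)
  then show ?thesis by (intro exI[of _ "\<bar>c\<bar>"]) force
qed

lemma SU2_integral_dominated_convergence:
  fixes \<phi> :: "nat \<Rightarrow> mat2 \<Rightarrow> real"
  assumes cont: "\<And>n. continuous_on SU2 (\<phi> n)" "continuous_on SU2 \<psi>"
    and lim: "\<And>x. x \<in> SU2 \<Longrightarrow> (\<lambda>n. \<phi> n x) \<longlonglongrightarrow> \<psi> x"
    and bound: "\<And>n x. x \<in> SU2 \<Longrightarrow> \<bar>\<phi> n x\<bar> \<le> c"
  shows "(\<lambda>n. SU2_integral (\<phi> n)) \<longlonglongrightarrow> SU2_integral \<psi>"
  unfolding SU2_integral_def set_lebesgue_integral_def
proof (rule integral_dominated_convergence)
  interpret finite_measure vol_SU2 by (rule finite_measure_vol_SU2)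
  show "integrable vol_SU2 (\<lambda>x. \<bar>c\<bar>)" by simp
  show "(\<lambda>x. indicator SU2 x *\<^sub>R \<psi> x) \<in> borel_measurable vol_SU2"
    using SU2_integrable[OF cont(2)] by (auto simp: set_integrable_def)
  show "(\<lambda>x. indicator SU2 x *\<^sub>R \<phi> n x) \<in> borel_measurable vol_SU2" for n
    using SU2_integrable[OF cont(1)] by (auto simp: set_integrable_def)
  show "AE x in vol_SU2. (\<lambda>n. indicator SU2 x *\<^sub>R \<phi> n x) \<longlonglongrightarrow> indicator SU2 x *\<^sub>R \<psi> x"
    using lim by (auto simp: indicator_def)
  show "AE x in vol_SU2. norm (indicator SU2 x *\<^sub>R \<phi> n x) \<le> \<bar>c\<bar>" for n
    using bound[of _ n] by (auto simp: indicator_def intro!: AE_I2 order.trans[OF bound])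
qed

lemma SU2_integral_second_difference_commute:
  assumes e: "e \<in> quaternion_units" and f: "continuous_on SU2 f" and g: "continuous_on SU2 g"
  shows "SU2_integral (\<lambda>x. second_difference e f n x * g x) =
    SU2_integral (\<lambda>x. f x * second_difference e g n x)"
proof -
  have cg: "continuous_on SU2 (\<lambda>x. h (geo e t x))" if "continuous_on SU2 h" for h :: "mat2 \<Rightarrow> real" and t
    by (rule continuous_on_compose2[OF that]) (auto intro!: continuous_intros geo_SU2[OF e])
  have shift: "SU2_integral (\<lambda>x. f (geo e t x) * g x) = SU2_integral (\<lambda>x. f x * g (geo e (- t) x))" for t
  proof -
    have "SU2_integral (\<lambda>x. f (geo e t x) * g x) =
        SU2_integral (\<lambda>x. f (geo e t (mat 1 ** x ** geo e (-t) (mat 1))) * g (mat 1 ** x ** geo e (-t) (mat 1)))"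
      by (rule SU2_integral_translate[symmetric])
        (auto intro!: geo_SU2[OF e] continuous_intros cg[OF f] g)
    also have "\<dots> = SU2_integral (\<lambda>x. f x * g (geo e (- t) x))"
      by (simp add: geo_eq[symmetric] geo_geo[OF e])
    finally show ?thesis .
  qed
  define t c where "t = 1 / real (Suc n)" and "c = (real (Suc n))\<^sup>2"
  have "SU2_integral (\<lambda>x. second_difference e f n x * g x) =
      SU2_integral (\<lambda>x. c * ((f (geo e t x) * g x + f (geo e (-t) x) * g x) - 2 * (f x * g x)))"
    unfolding second_difference_def t_def c_def
    by (intro SU2_integral_cong) (simp add: algebra_simps del: of_nat_Suc)
  also have "\<dots> = c * ((SU2_integral (\<lambda>x. f (geo e t x) * g x) + SU2_integral (\<lambda>x. f (geo e (-t) x) * g x))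
      - 2 * SU2_integral (\<lambda>x. f x * g x))"
    by (simp add: SU2_integral_mult_left SU2_integral_diff SU2_integral_add cg f g continuous_intros)
  also have "\<dots> = c * ((SU2_integral (\<lambda>x. f x * g (geo e t x)) + SU2_integral (\<lambda>x. f x * g (geo e (-t) x)))
      - 2 * SU2_integral (\<lambda>x. f x * g x))"
    unfolding shift[of t] shift[of "-t"] by simp
  also have "\<dots> = SU2_integral (\<lambda>x. c * ((f x * g (geo e t x) + f x * g (geo e (-t) x)) - 2 * (f x * g x)))"
    by (simp add: SU2_integral_mult_left SU2_integral_diff SU2_integral_add cg f g continuous_intros)
  also have "\<dots> = SU2_integral (\<lambda>x. f x * second_difference e g n x)"
    unfolding second_difference_def t_def c_def
    by (intro SU2_integral_cong) (simp add: algebra_simps del: of_nat_Suc)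
  finally show ?thesis .
qed

text \<open>
  The second differences converge pointwise and stay bounded by the supremum of the second
  derivative, so dominated convergence passes from the identity for second differences to the
  one for second derivatives.
\<close>

lemma second_along_symmetric:
  assumes e: "e \<in> quaternion_units" and f: "second_along e f f2" and g: "second_along e g g2"
  shows "SU2_integral (\<lambda>x. f2 x * g x) = SU2_integral (\<lambda>x. f x * g2 x)"
proof -
  have lim: "(\<lambda>n. SU2_integral (\<lambda>x. second_difference e f n x * g x)) \<longlonglongrightarrow> SU2_integral (\<lambda>x. f2 x * g x)"
    if f: "second_along e f f2" and g: "continuous_on SU2 g" for f f2 g
  proof -
    have cf: "continuous_on SU2 f" "continuous_on SU2 f2" using f by (auto simp: second_along_def)
    obtain c d where c: "c \<ge> 0" "\<And>x. x \<in> SU2 \<Longrightarrow> \<bar>f2 x\<bar> \<le> c" and d: "d \<ge> 0" "\<And>x. x \<in> SU2 \<Longrightarrow> \<bar>g x\<bar> \<le> d"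
      using continuous_on_SU2_bounded[OF cf(2)] continuous_on_SU2_bounded[OF g] by auto
    have cg: "continuous_on SU2 (\<lambda>x. f (geo e t x))" for t
      by (rule continuous_on_compose2[OF cf(1)]) (auto intro!: continuous_intros geo_SU2[OF e])
    show ?thesis
    proof (rule SU2_integral_dominated_convergence)
      show "continuous_on SU2 (\<lambda>x. second_difference e f n x * g x)" for n
        unfolding second_difference_def by (intro continuous_intros cg cf g)
      show "continuous_on SU2 (\<lambda>x. f2 x * g x)" by (intro continuous_intros cf g)
      fix x assume x: "x \<in> SU2"
      show "(\<lambda>n. second_difference e f n x * g x) \<longlonglongrightarrow> f2 x * g x"
        by (intro tendsto_mult_right second_difference_tendsto[OF e x f])
      fix n
      obtain r s where "second_difference e f n x = (f2 (geo e r x) + f2 (geo e s x)) / 2"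
        using second_difference_eq[OF e x f] by blast
      then have "\<bar>second_difference e f n x\<bar> \<le> c"
        using c(2)[OF geo_SU2[OF e x, of r]] c(2)[OF geo_SU2[OF e x, of s]] by (simp add: abs_le_iff)
      then show "\<bar>second_difference e f n x * g x\<bar> \<le> c * d"
        unfolding abs_mult using c d(2)[OF x] by (intro mult_mono) auto
    qed
  qed
  have cf: "continuous_on SU2 f" and cg: "continuous_on SU2 g" using f g by (auto simp: second_along_def)
  have "(\<lambda>n. SU2_integral (\<lambda>x. second_difference e f n x * g x)) \<longlonglongrightarrow> SU2_integral (\<lambda>x. g2 x * f x)"
    unfolding SU2_integral_second_difference_commute[OF e cf cg]
    using lim[OF g cf] by (simp add: mult.commute)
  then show ?thesis using LIMSEQ_unique[OF lim[OF f cg]] by (simp add: mult.commute)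
qed

section \<open>Geodesic derivatives of smooth functions\<close>

lemma chain_rule_curve:
  fixes g :: "'a::real_normed_vector \<Rightarrow> real"
  assumes "(g has_derivative L) (at (c 0))" "(c has_vector_derivative v) (at 0)"
  shows "((\<lambda>t. g (c t)) has_real_derivative L v) (at 0)"
proof -
  have lin: "linear L" using assms(1) has_derivative_linear by blast
  have "(g \<circ> c has_derivative L \<circ> (\<lambda>h. h *\<^sub>R v)) (at 0)"
    using assms by (intro diff_chain_at) (auto simp: has_vector_derivative_def)
  moreover have "L \<circ> (\<lambda>h. h *\<^sub>R v) = (*) (L v)" using lin by (auto simp: linear_cmul)
  ultimately show ?thesis by (simp add: has_field_derivative_def comp_def)
qed

lemma geo_near:
  assumes "open U" "x \<in> U"
  shows "\<forall>\<^sub>F t in nhds 0. geo e t x \<in> U"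
proof -
  have "continuous_on UNIV (\<lambda>t. geo e t x)" by (intro continuous_intros)
  then have "open ((\<lambda>t. geo e t x) -` U)" using assms(1) by (metis open_vimage)
  then show ?thesis using assms(2) unfolding eventually_nhds
    by (intro exI[of _ "(\<lambda>t. geo e t x) -` U"]) auto
qed

text \<open>
  Near a point, \<open>f\<close> is the restriction of a function \<open>g\<close> on an open set of matrices. The first
  derivative along the geodesic is \<open>Dg(x)(x e)\<close>, and since \<open>x e e = - x\<close> the second one is
  \<open>D\<^sup>2g(x)(x e, x e) - Dg(x)(x)\<close>. Both are written in coordinates, because only the partial
  derivatives of \<open>g\<close> are known to be continuous.
\<close>

lemma smooth_second_along:
  assumes e: "e \<in> quaternion_units" and f: "smooth_on_submanifold SU2 f"
  shows "\<exists>f2. second_along e f f2"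
proof -
  define f1 where "f1 = (\<lambda>x. deriv (\<lambda>t. f (geo e t x)) 0)"
  define f2 where "f2 = (\<lambda>x. deriv (\<lambda>t. f1 (geo e t x)) 0)"
  have local: "\<exists>U. open U \<and> x0 \<in> U \<and> continuous_on (U \<inter> SU2) f \<and> continuous_on (U \<inter> SU2) f2 \<and>
    (\<forall>x\<in>U \<inter> SU2. ((\<lambda>t. f (geo e t x)) has_real_derivative f1 x) (at 0) \<and>
       ((\<lambda>t. f1 (geo e t x)) has_real_derivative f2 x) (at 0))" if x0: "x0 \<in> SU2" for x0
  proof -
    have "\<exists>U g. open U \<and> x0 \<in> U \<and> (\<forall>k. Ck_on k U g) \<and> (\<forall>y\<in>U \<inter> SU2. g y = f y)"
      using f x0 unfolding smooth_on_submanifold_def by (rule bspec)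
    then obtain U g where U: "open U" "x0 \<in> U" and C: "\<And>k. Ck_on k U g"
      and eq0: "\<forall>y\<in>U \<inter> SU2. g y = f y" by (elim exE conjE) (rule that, auto)
    have eq: "g y = f y" if "y \<in> U" "y \<in> SU2" for y using eq0 that by simp
    obtain g' where g': "\<And>x. x \<in> U \<Longrightarrow> (g has_derivative g' x) (at x)"
      and C1: "\<And>v. Ck_on (Suc 0) U (\<lambda>x. g' x v)" using C[of "Suc (Suc 0)"] by auto
    have "\<exists>g''. (\<forall>x\<in>U. ((\<lambda>x. g' x v) has_derivative g'' x) (at x)) \<and> (\<forall>w. continuous_on U (\<lambda>x. g'' x w))" for v
      using C1[of v] by simp
    then obtain g'' where g'': "\<And>v x. x \<in> U \<Longrightarrow> ((\<lambda>x. g' x v) has_derivative g'' v x) (at x)"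
      "\<And>v w. continuous_on U (\<lambda>x. g'' v x w)" by metis
    have cg: "continuous_on U g" "continuous_on U (\<lambda>x. g' x v)" for v
      by (intro continuous_at_imp_continuous_on ballI, rule has_derivative_continuous,
          erule g' g''(1))+
    have lin: "linear (g' x)" "linear (g'' v x)" if "x \<in> U" for x v
      by (rule has_derivative_linear[OF g'[OF that]], rule has_derivative_linear[OF g''(1)[OF that]])
    have expand: "L y = (\<Sum>b\<in>Basis. (y \<bullet> b) * L b)" if "linear L" for L :: "mat2 \<Rightarrow> real" and y
    proof -
      have "L y = L (\<Sum>b\<in>Basis. (y \<bullet> b) *\<^sub>R b)" by (simp add: euclidean_representation)
      also have "\<dots> = (\<Sum>b\<in>Basis. (y \<bullet> b) * L b)" using that by (simp add: linear_sum linear_cmul)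
      finally show ?thesis .
    qed
    have d1: "((\<lambda>t. f (geo e t x)) has_real_derivative g' x (x ** e)) (at 0)" if x: "x \<in> U" "x \<in> SU2" for x
    proof -
      have "((\<lambda>t. g (geo e t x)) has_real_derivative g' x (x ** e)) (at 0)"
        by (rule chain_rule_curve) (use g'[OF x(1)] geo_has_vector_derivative in auto)
      moreover have "\<forall>\<^sub>F t in nhds 0. g (geo e t x) = f (geo e t x)"
        using geo_near[OF U(1) x(1), of e] by eventually_elim (use eq geo_SU2[OF e x(2)] in auto)
      ultimately show ?thesis using DERIV_cong_ev[OF refl _ refl] by fast
    qed
    have f1: "f1 x = (\<Sum>b\<in>Basis. ((x ** e) \<bullet> b) * g' x b)" if x: "x \<in> U" "x \<in> SU2" for x
      unfolding f1_def using d1[OF x] expand[OF lin(1)[OF x(1)], of "x ** e"] by (simp add: DERIV_imp_deriv)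
    define G where "G = (\<lambda>x. \<Sum>b\<in>Basis. - (x \<bullet> b) * g' x b +
        ((x ** e) \<bullet> b) * (\<Sum>b'\<in>Basis. ((x ** e) \<bullet> b') * g'' b x b'))"
    have d2: "((\<lambda>t. f1 (geo e t x)) has_real_derivative G x) (at 0)" if x: "x \<in> U" "x \<in> SU2" for x
    proof -
      have ge: "(geo e t x ** e) = geo e t (x ** e)" for t
        by (rule mat2_eqI) (simp_all add: geo_def algebra_simps)
      have "x ** e ** e = - x"
        unfolding matrix_mul_assoc[symmetric] quaternion_unit_square[OF e] by (simp add: mat2_eq_iff)
      then have v1: "((\<lambda>t. geo e t x ** e) has_vector_derivative - x) (at 0)"
        unfolding ge using geo_has_vector_derivative[of e "x ** e"] by simp
      have i1: "((\<lambda>t. (geo e t x ** e) \<bullet> b) has_real_derivative - (x \<bullet> b)) (at 0)" for b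
        using chain_rule_curve[of "\<lambda>y. y \<bullet> b" "\<lambda>y. y \<bullet> b", OF _ v1]
        by (simp add: bounded_linear_imp_has_derivative bounded_linear_inner_left)
      have i2: "((\<lambda>t. g' (geo e t x) b) has_real_derivative g'' b x (x ** e)) (at 0)" for b
        by (rule chain_rule_curve[of "\<lambda>y. g' y b"]) (use g''(1)[OF x(1)] geo_has_vector_derivative in auto)
      have "((\<lambda>t. \<Sum>b\<in>Basis. ((geo e t x ** e) \<bullet> b) * g' (geo e t x) b) has_real_derivative
          (\<Sum>b\<in>Basis. - (x \<bullet> b) * g' (geo e 0 x) b + g'' b x (x ** e) * ((geo e 0 x ** e) \<bullet> b))) (at 0)"
        by (intro DERIV_sum DERIV_mult i1 i2)
      also have "(\<Sum>b\<in>Basis. - (x \<bullet> b) * g' (geo e 0 x) b + g'' b x (x ** e) * ((geo e 0 x ** e) \<bullet> b)) = G x"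
        unfolding G_def using expand[OF lin(2)[OF x(1)], of _ "x ** e"] by (simp add: mult.commute)
      finally have "((\<lambda>t. \<Sum>b\<in>Basis. ((geo e t x ** e) \<bullet> b) * g' (geo e t x) b) has_real_derivative G x) (at 0)" .
      moreover have "\<forall>\<^sub>F t in nhds 0. (\<Sum>b\<in>Basis. ((geo e t x ** e) \<bullet> b) * g' (geo e t x) b) = f1 (geo e t x)"
        using geo_near[OF U(1) x(1), of e] by eventually_elim (use f1 geo_SU2[OF e x(2)] in auto)
      ultimately show ?thesis using DERIV_cong_ev[OF refl _ refl] by fast
    qed
    have f2: "f2 x = G x" if "x \<in> U" "x \<in> SU2" for x
      unfolding f2_def using d2[OF that] by (simp add: DERIV_imp_deriv)
    have f1': "f1 x = g' x (x ** e)" if "x \<in> U" "x \<in> SU2" for x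
      unfolding f1_def using d1[OF that] by (simp add: DERIV_imp_deriv)
    have "continuous_on (U \<inter> SU2) G"
      unfolding G_def by (intro continuous_intros continuous_on_subset[OF cg(2)] continuous_on_subset[OF g''(2)]) auto
    then have "continuous_on (U \<inter> SU2) f2" using f2 by (subst continuous_on_cong[of _ _ _ G]) auto
    moreover have "continuous_on (U \<inter> SU2) f"
      using continuous_on_subset[OF cg(1), of "U \<inter> SU2"] eq by (subst continuous_on_cong[of _ _ _ g]) auto
    ultimately show ?thesis using U d1 d2 f1' f2 by (intro exI[of _ U]) auto
  qed
  have glue: "continuous_on SU2 h" if loc: "\<And>x0. x0 \<in> SU2 \<Longrightarrow> \<exists>U. open U \<and> x0 \<in> U \<and> continuous_on (U \<inter> SU2) h"
    for h :: "mat2 \<Rightarrow> real"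
  proof (rule continuous_on_eq_continuous_within[THEN iffD2], rule ballI)
    fix x assume x: "x \<in> SU2"
    obtain U where U: "open U" "x \<in> U" "continuous_on (U \<inter> SU2) h" using loc[OF x] by blast
    then have "continuous (at x within (U \<inter> SU2)) h" using x by (simp add: continuous_on_eq_continuous_within)
    moreover have "at x within (U \<inter> SU2) = at x within SU2"
      by (rule at_within_nhd[of x U]) (use U in auto)
    ultimately show "continuous (at x within SU2) h" by simp
  qed
  have "continuous_on SU2 f" "continuous_on SU2 f2" by (rule glue; use local in blast)+
  then have "second_along e f f2" unfolding second_along_def using local by blast
  then show ?thesis by (intro exI[of _ f2])
qed

lemma smooth_continuous_on_SU2: "smooth_on_submanifold SU2 f \<Longrightarrow> continuous_on SU2 f"
  using smooth_second_along[of "mat2 0 1 (- 1) 0" f]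
  by (auto simp: quaternion_units_def second_along_def)

lemma laplacian_SU2_alt:
  "laplacian_SU2 f x = - (\<Sum>e\<in>quaternion_units. (deriv ^^ 2) (\<lambda>t. f (geo e t x)) 0)"
  by (simp add: laplacian_SU2_def geo_def)

lemma laplacian_symmetric:
  assumes f: "\<And>e. e \<in> quaternion_units \<Longrightarrow> second_along e f (f2 e)"
    and g: "\<And>e. e \<in> quaternion_units \<Longrightarrow> second_along e g (g2 e)"
  shows "SU2_integral (\<lambda>x. laplacian_SU2 f x * g x) = SU2_integral (\<lambda>x. f x * laplacian_SU2 g x)"
proof -
  have lap: "laplacian_SU2 h x = - (\<Sum>e\<in>quaternion_units. h2 e x)"
    if "\<And>e. e \<in> quaternion_units \<Longrightarrow> second_along e h (h2 e)" "x \<in> SU2" for h h2 x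
    unfolding laplacian_SU2_alt using second_along_deriv that by (auto intro: sum.cong)
  have c: "continuous_on SU2 f" "continuous_on SU2 g" "\<And>e. e \<in> quaternion_units \<Longrightarrow> continuous_on SU2 (f2 e)"
    "\<And>e. e \<in> quaternion_units \<Longrightarrow> continuous_on SU2 (g2 e)"
    using f g by (auto simp: second_along_def quaternion_units_def)
  have "SU2_integral (\<lambda>x. laplacian_SU2 f x * g x) =
      SU2_integral (\<lambda>x. \<Sum>e\<in>quaternion_units. - 1 * (f2 e x * g x))"
    by (rule SU2_integral_cong) (simp add: lap[OF f] sum_distrib_right sum_negf)
  also have "\<dots> = (\<Sum>e\<in>quaternion_units. - 1 * SU2_integral (\<lambda>x. f2 e x * g x))"
    by (subst SU2_integral_sum, intro continuous_intros c, assumption)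
      (rule sum.cong[OF refl], rule SU2_integral_mult_left, intro continuous_intros c)
  also have "\<dots> = (\<Sum>e\<in>quaternion_units. - 1 * SU2_integral (\<lambda>x. f x * g2 e x))"
    using second_along_symmetric f g by (auto intro!: sum.cong)
  also have "\<dots> = SU2_integral (\<lambda>x. \<Sum>e\<in>quaternion_units. - 1 * (f x * g2 e x))"
    by (subst SU2_integral_sum, intro continuous_intros c, assumption)
      (rule sum.cong[OF refl], rule SU2_integral_mult_left[symmetric], intro continuous_intros c)
  also have "\<dots> = SU2_integral (\<lambda>x. f x * laplacian_SU2 g x)"
    by (rule SU2_integral_cong) (simp add: lap[OF g] sum_distrib_left sum_negf)
  finally show ?thesis .
qed

section \<open>The eigenfunctions given by powers of linear forms\<close>

text \<open>
  The bilinear form \<open>det [w, A v]\<close> with \<open>w = (a, b)\<close> and \<open>v = (x, y)\<close>, up to the order of the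
  columns: \<open>a\<close> multiplies the second and \<open>- b\<close> the first component of \<open>A v\<close>.
\<close>

definition ell :: "complex \<Rightarrow> complex \<Rightarrow> complex \<Rightarrow> complex \<Rightarrow> mat2 \<Rightarrow> complex"
  where "ell a b x y A = a * (A$2$1 * x + A$2$2 * y) - b * (A$1$1 * x + A$1$2 * y)"

lemma linear_ell: "linear (ell a b x y)"
  by (rule linearI) (simp_all add: ell_def algebra_simps)

lemma bounded_linear_ell: "bounded_linear (ell a b x y)"
  using linear_ell by (simp add: linear_linear)

lemma continuous_on_ell [continuous_intros]:
  "continuous_on S f \<Longrightarrow> continuous_on S (\<lambda>z. ell a b x y (f z))"
  unfolding ell_def by (intro continuous_intros)

lemma ell_right_unit: "e \<in> quaternion_units \<Longrightarrow> ell a b x y (A ** e ** e) = - ell a b x y A"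
proof -
  assume e: "e \<in> quaternion_units"
  have "A ** e ** e = - A"
    unfolding matrix_mul_assoc[symmetric] quaternion_unit_square[OF e] by (simp add: mat2_eq_iff)
  then show ?thesis by (simp add: ell_def algebra_simps)
qed

lemma sum_quaternion_units:
  "(\<Sum>e\<in>quaternion_units. h e) = h (mat2 \<i> 0 0 (- \<i>)) + h (mat2 0 1 (- 1) 0) + h (mat2 0 \<i> \<i> 0)"
proof -
  have "mat2 \<i> 0 0 (- \<i>) \<noteq> mat2 0 1 (- 1) 0" "mat2 \<i> 0 0 (- \<i>) \<noteq> mat2 0 \<i> \<i> 0"
    "mat2 0 1 (- 1) 0 \<noteq> mat2 0 \<i> \<i> 0" by (simp_all add: mat2_eq_iff)
  then show ?thesis by (simp add: quaternion_units_def add.assoc)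
qed

text \<open>
  As \<open>A \<mapsto> ell a b x y A\<close> has a coefficient matrix of rank one, it is isotropic for the determinant
  form, and so the gradient term in the Laplacian of its powers is a multiple of its square.
\<close>

lemma sum_ell_units: "(\<Sum>e\<in>quaternion_units. (ell a b x y (A ** e))\<^sup>2) = - (ell a b x y A)\<^sup>2"
proof -
  define p q where "p = a * A$2$1 - b * A$1$1" and "q = a * A$2$2 - b * A$1$2"
  have l: "ell a b x y A = p * x + q * y" by (simp add: ell_def p_def q_def algebra_simps)
  have l1: "ell a b x y (A ** mat2 \<i> 0 0 (- \<i>)) = \<i> * (p * x - q * y)"
    "ell a b x y (A ** mat2 0 1 (- 1) 0) = p * y - q * x"
    "ell a b x y (A ** mat2 0 \<i> \<i> 0) = \<i> * (q * x + p * y)"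
    by (simp_all add: ell_def p_def q_def algebra_simps)
  show ?thesis unfolding sum_quaternion_units l1 l
    by (simp add: power_mult_distrib) (simp add: power2_eq_square algebra_simps)
qed

text \<open>
  The second derivative of \<open>ell a b x y ^ n\<close> along \<open>e\<close>. The truncated exponents \<open>n - 1\<close> and \<open>n - 2\<close>
  occur only with a factor that vanishes when they are truncated.
\<close>

definition ell_power_second :: "nat \<Rightarrow> complex \<Rightarrow> complex \<Rightarrow> complex \<Rightarrow> complex \<Rightarrow> mat2 \<Rightarrow> mat2 \<Rightarrow> complex"
  where "ell_power_second n a b x y e A =
    of_nat n * (of_nat (n - 1) * ell a b x y A ^ (n - 2) * (ell a b x y (A ** e))\<^sup>2 - ell a b x y A ^ n)"

lemma ell_power_second_along:
  assumes e: "e \<in> quaternion_units"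
  shows "second_along e (\<lambda>A. Re (ell a b x y A ^ n)) (\<lambda>A. Re (ell_power_second n a b x y e A))"
    and "second_along e (\<lambda>A. Im (ell a b x y A ^ n)) (\<lambda>A. Im (ell_power_second n a b x y e A))"
proof -
  define l where "l = ell a b x y"
  define f1 where "f1 = (\<lambda>A. of_nat n * l A ^ (n - 1) * l (A ** e))"
  have vd: "((\<lambda>t. l (geo e t A)) has_vector_derivative l (A ** e)) (at 0)" for A
    using bounded_linear.has_vector_derivative[OF bounded_linear_ell geo_has_vector_derivative]
    by (simp add: l_def)
  have vde: "((\<lambda>t. l (geo e t A ** e)) has_vector_derivative - l A) (at 0)" for A
  proof -
    have "geo e t A ** e = geo e t (A ** e)" for t
      by (rule mat2_eqI) (simp_all add: geo_def algebra_simps)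
    then show ?thesis using vd[of "A ** e"] by (simp add: l_def ell_right_unit[OF e])
  qed
  have pow: "((\<lambda>t. g t ^ m) has_vector_derivative of_nat m * g 0 ^ (m - 1) * g') (at 0)"
    if "(g has_vector_derivative g') (at 0)" for g :: "real \<Rightarrow> complex" and g' m
  proof (cases m)
    case (Suc k)
    have "((\<lambda>z. z ^ m) has_field_derivative of_nat m * g 0 ^ (m - 1)) (at (g 0))"
      by (rule DERIV_cong[OF DERIV_power[OF DERIV_ident]]) simp
    from field_vector_diff_chain_at[OF that this] show ?thesis by (simp add: comp_def mult_ac)
  qed (auto intro!: derivative_eq_intros)
  have d1: "((\<lambda>t. l (geo e t A) ^ n) has_vector_derivative f1 A) (at 0)" for A
    using pow[OF vd[of A], of n] by (simp add: f1_def)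
  have d2: "((\<lambda>t. f1 (geo e t A)) has_vector_derivative ell_power_second n a b x y e A) (at 0)" for A
  proof -
    have "((\<lambda>t. of_nat n * l (geo e t A) ^ (n - 1) * l (geo e t A ** e)) has_vector_derivative
      (of_nat n * l (geo e 0 A) ^ (n - 1)) * (- l A) +
      (of_nat n * (of_nat (n - 1) * l (geo e 0 A) ^ (n - 1 - 1) * l (A ** e))) * l (geo e 0 A ** e)) (at 0)"
      by (intro has_vector_derivative_mult vde bounded_linear.has_vector_derivative[OF bounded_linear_mult_right] pow[OF vd])
    moreover have "(of_nat n * l (geo e 0 A) ^ (n - 1)) * (- l A) +
      (of_nat n * (of_nat (n - 1) * l (geo e 0 A) ^ (n - 1 - 1) * l (A ** e))) * l (geo e 0 A ** e)
      = ell_power_second n a b x y e A"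
    proof (cases n)
      case (Suc k)
      then show ?thesis
        by (simp add: ell_power_second_def l_def power2_eq_square algebra_simps numeral_2_eq_2)
    qed (simp add: ell_power_second_def)
    ultimately show ?thesis by (simp add: f1_def)
  qed
  have cont: "continuous_on SU2 (\<lambda>A. ell a b x y A ^ n)"
    "continuous_on SU2 (ell_power_second n a b x y e)"
    unfolding ell_power_second_def by (intro continuous_intros)+
  have Re: "((\<lambda>t. Re (h t)) has_real_derivative Re h') (at 0)"
    and Im: "((\<lambda>t. Im (h t)) has_real_derivative Im h') (at 0)"
    if "(h has_vector_derivative h') (at 0)" for h h'
    using bounded_linear.has_vector_derivative[OF bounded_linear_Re that]
      bounded_linear.has_vector_derivative[OF bounded_linear_Im that]
    by (simp_all add: has_real_derivative_iff_has_vector_derivative)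
  show "second_along e (\<lambda>A. Re (ell a b x y A ^ n)) (\<lambda>A. Re (ell_power_second n a b x y e A))"
    unfolding second_along_def
    by (intro conjI continuous_on_Re cont exI[of _ "\<lambda>A. Re (f1 A)"] ballI Re[OF d1[unfolded l_def]] Re[OF d2])
  show "second_along e (\<lambda>A. Im (ell a b x y A ^ n)) (\<lambda>A. Im (ell_power_second n a b x y e A))"
    unfolding second_along_def
    by (intro conjI continuous_on_Im cont exI[of _ "\<lambda>A. Im (f1 A)"] ballI Im[OF d1[unfolded l_def]] Im[OF d2])
qed

lemma sum_ell_power_second:
  "(\<Sum>e\<in>quaternion_units. ell_power_second n a b x y e A) = - of_nat (n * (n + 2)) * ell a b x y A ^ n"
proof -
  define l where "l = ell a b x y A"
  have "(\<Sum>e\<in>quaternion_units. ell_power_second n a b x y e A) =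
      of_nat n * (of_nat (n - 1) * l ^ (n - 2) * (\<Sum>e\<in>quaternion_units. (ell a b x y (A ** e))\<^sup>2)
        - 3 * l ^ n)"
    unfolding ell_power_second_def l_def sum_quaternion_units by (simp add: algebra_simps)
  also have "\<dots> = of_nat n * (of_nat (n - 1) * l ^ (n - 2) * (- l\<^sup>2) - 3 * l ^ n)"
    by (simp add: sum_ell_units l_def)
  also have "\<dots> = - of_nat (n * (n + 2)) * l ^ n"
  proof (cases "n \<ge> 2")
    case True
    then obtain k where "n = Suc (Suc k)" by (metis Suc_le_D numeral_2_eq_2 Suc_le_mono)
    then show ?thesis by (simp add: power2_eq_square algebra_simps)
  next
    case False
    then have "n = 0 \<or> n = 1" by auto
    then show ?thesis by auto
  qed
  finally show ?thesis by (simp add: l_def)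
qed

lemma laplacian_ell_power:
  assumes A: "A \<in> SU2"
  shows "laplacian_SU2 (\<lambda>A. Re (ell a b x y A ^ n)) A = real (n * (n + 2)) * Re (ell a b x y A ^ n)"
    and "laplacian_SU2 (\<lambda>A. Im (ell a b x y A ^ n)) A = real (n * (n + 2)) * Im (ell a b x y A ^ n)"
proof -
  have "laplacian_SU2 (\<lambda>A. Re (ell a b x y A ^ n)) A = - (\<Sum>e\<in>quaternion_units. Re (ell_power_second n a b x y e A))"
    unfolding laplacian_SU2_alt using second_along_deriv[OF _ A ell_power_second_along(1)] by (simp cong: sum.cong)
  then show "laplacian_SU2 (\<lambda>A. Re (ell a b x y A ^ n)) A = real (n * (n + 2)) * Re (ell a b x y A ^ n)"
    by (simp only: Re_sum[symmetric] sum_ell_power_second) (simp del: of_nat_mult of_nat_add)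
  have "laplacian_SU2 (\<lambda>A. Im (ell a b x y A ^ n)) A = - (\<Sum>e\<in>quaternion_units. Im (ell_power_second n a b x y e A))"
    unfolding laplacian_SU2_alt using second_along_deriv[OF _ A ell_power_second_along(2)] by (simp cong: sum.cong)
  then show "laplacian_SU2 (\<lambda>A. Im (ell a b x y A ^ n)) A = real (n * (n + 2)) * Im (ell a b x y A ^ n)"
    by (simp only: Im_sum[symmetric] sum_ell_power_second) (simp del: of_nat_mult of_nat_add)
qed

text \<open>
  Eigenfunctions of a symmetric operator for different eigenvalues are orthogonal. The test
  function is complex, so the argument runs for its real and imaginary parts.
\<close>

lemma eigenfunction_orthogonal_ell_power:
  assumes f: "smooth_on_submanifold SU2 f" and eig: "\<And>A. A \<in> SU2 \<Longrightarrow> laplacian_SU2 f A = \<mu> * f A"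
    and n: "\<mu> \<noteq> real (n * (n + 2))"
  shows "SU2_integral (\<lambda>A. complex_of_real (f A) * ell a b x y A ^ n) = 0"
proof -
  obtain f2 where f2: "\<And>e. e \<in> quaternion_units \<Longrightarrow> second_along e f (f2 e)"
    using smooth_second_along[OF _ f] by metis
  have cf: "continuous_on SU2 f" by (rule smooth_continuous_on_SU2[OF f])
  have part: "SU2_integral (\<lambda>A. f A * h A) = 0"
    if h: "\<And>e. e \<in> quaternion_units \<Longrightarrow> second_along e h (h2 e)"
      and eh: "\<And>A. A \<in> SU2 \<Longrightarrow> laplacian_SU2 h A = real (n * (n + 2)) * h A" for h h2
  proof -
    have ch: "continuous_on SU2 h" using h by (auto simp: quaternion_units_def second_along_def)
    have "\<mu> * SU2_integral (\<lambda>A. f A * h A) = SU2_integral (\<lambda>A. laplacian_SU2 f A * h A)"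
      by (subst SU2_integral_mult_left[symmetric], intro continuous_intros cf ch)
        (auto intro!: SU2_integral_cong simp: eig)
    also have "\<dots> = SU2_integral (\<lambda>A. f A * laplacian_SU2 h A)"
      by (rule laplacian_symmetric[OF f2 h])
    also have "\<dots> = real (n * (n + 2)) * SU2_integral (\<lambda>A. f A * h A)"
      by (subst SU2_integral_mult_left[symmetric], intro continuous_intros cf ch)
        (auto intro!: SU2_integral_cong simp: eh)
    finally show ?thesis using n by simp
  qed
  have c: "continuous_on SU2 (\<lambda>A. complex_of_real (f A) * ell a b x y A ^ n)"
    by (intro continuous_intros cf)
  have "Re (SU2_integral (\<lambda>A. complex_of_real (f A) * ell a b x y A ^ n)) =
      SU2_integral (\<lambda>A. f A * Re (ell a b x y A ^ n))"
    by (subst SU2_integral_bounded_linear[OF bounded_linear_Re c, symmetric]) simp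
  also have "\<dots> = 0" by (rule part[OF ell_power_second_along(1) laplacian_ell_power(1)])
  finally have re: "Re (SU2_integral (\<lambda>A. complex_of_real (f A) * ell a b x y A ^ n)) = 0" .
  have "Im (SU2_integral (\<lambda>A. complex_of_real (f A) * ell a b x y A ^ n)) =
      SU2_integral (\<lambda>A. f A * Im (ell a b x y A ^ n))"
    by (subst SU2_integral_bounded_linear[OF bounded_linear_Im c, symmetric]) simp
  also have "\<dots> = 0" by (rule part[OF ell_power_second_along(2) laplacian_ell_power(2)])
  finally show ?thesis using re by (simp add: complex_eq_iff)
qed

section \<open>Moments and density\<close>

text \<open>
  On SU(2) the complex conjugates of the entries are again entries up to sign, so the complex span
  of these monomials contains all real polynomials in the real and imaginary parts of the entries. The signs are chosen so that the
  linear form \<open>ell a b x y\<close> has the coefficients \<open>a x\<close>, \<open>a y\<close>, \<open>b x\<close>, \<open>b y\<close>.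
\<close>

definition monom4 :: "nat \<Rightarrow> nat \<Rightarrow> nat \<Rightarrow> nat \<Rightarrow> mat2 \<Rightarrow> complex"
  where "monom4 p q r s A = (A$2$1) ^ p * (A$2$2) ^ q * (- A$1$1) ^ r * (- A$1$2) ^ s"

lemma continuous_on_monom4 [continuous_intros]:
  "continuous_on S f \<Longrightarrow> continuous_on S (\<lambda>z. monom4 p q r s (f z))"
  unfolding monom4_def by (intro continuous_intros)

text \<open>
  The equation \<open>det A = 1\<close>: modulo lower degree, it identifies monomials with the same degrees in
  the rows and in the columns.
\<close>

lemma monom4_relation:
  assumes "A \<in> SU2"
  shows "monom4 (Suc p) q r (Suc s) A = monom4 p q r s A + monom4 p (Suc q) (Suc r) s A"
proof -
  have "A$1$1 * A$2$2 - A$1$2 * A$2$1 = 1" using assms by (simp add: SU2_def det_2)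
  then have "A$2$1 * (- A$1$2) = 1 + A$2$2 * (- A$1$1)" by (simp add: algebra_simps eq_diff_eq)
  then have "monom4 p q r s A * (A$2$1 * (- A$1$2)) = monom4 p q r s A * (1 + A$2$2 * (- A$1$1))"
    by simp
  then show ?thesis by (simp add: monom4_def algebra_simps)
qed

lemma ell_power_expand:
  "ell a b x y A ^ n = (\<Sum>i\<le>n. (\<Sum>(p, r)\<in>{..i} \<times> {..n - i}.
      of_nat (n choose i) * of_nat (i choose p) * of_nat ((n - i) choose r) *
      monom4 p (i - p) r (n - i - r) A * x ^ (p + r) * y ^ (n - (p + r))) * a ^ i * b ^ (n - i))"
proof -
  have "ell a b x y A = a * (x * A$2$1 + y * A$2$2) + b * (x * (- A$1$1) + y * (- A$1$2))"
    by (simp add: ell_def algebra_simps)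
  then have "ell a b x y A ^ n = (\<Sum>i\<le>n. of_nat (n choose i) * (a * (x * A$2$1 + y * A$2$2)) ^ i *
      (b * (x * (- A$1$1) + y * (- A$1$2))) ^ (n - i))"
    by (simp only: binomial_ring)
  also have "\<dots> = (\<Sum>i\<le>n. (\<Sum>(p, r)\<in>{..i} \<times> {..n - i}.
      of_nat (n choose i) * of_nat (i choose p) * of_nat ((n - i) choose r) *
      monom4 p (i - p) r (n - i - r) A * x ^ (p + r) * y ^ (n - (p + r))) * a ^ i * b ^ (n - i))"
  proof (rule sum.cong[OF refl])
    fix i assume "i \<in> {..n}"
    then have i: "i \<le> n" by simp
    have e: "y ^ (i - p) * y ^ (n - i - r) = y ^ (n - (p + r))" if "p \<le> i" "r \<le> n - i" for p r
      using that i by (simp flip: power_add)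
    have "(x * A$2$1 + y * A$2$2) ^ i * (x * (- A$1$1) + y * (- A$1$2)) ^ (n - i) =
       (\<Sum>p\<le>i. of_nat (i choose p) * (x * A$2$1) ^ p * (y * A$2$2) ^ (i - p)) *
       (\<Sum>r\<le>n - i. of_nat ((n - i) choose r) * (x * (- A$1$1)) ^ r * (y * (- A$1$2)) ^ (n - i - r))"
      by (simp only: binomial_ring)
    also have "\<dots> = (\<Sum>(p, r)\<in>{..i} \<times> {..n - i}.
       (of_nat (i choose p) * (x * A$2$1) ^ p * (y * A$2$2) ^ (i - p)) *
       (of_nat ((n - i) choose r) * (x * (- A$1$1)) ^ r * (y * (- A$1$2)) ^ (n - i - r)))"
      by (simp only: sum_product sum.cartesian_product)
    also have "\<dots> = (\<Sum>(p, r)\<in>{..i} \<times> {..n - i}.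
      of_nat (i choose p) * of_nat ((n - i) choose r) *
      monom4 p (i - p) r (n - i - r) A * x ^ (p + r) * y ^ (n - (p + r)))"
    proof (rule sum.cong[OF refl], clarify)
      fix p r assume "p \<le> i" "r \<le> n - i"
      show "(of_nat (i choose p) * (x * A$2$1) ^ p * (y * A$2$2) ^ (i - p)) *
       (of_nat ((n - i) choose r) * (x * (- A$1$1)) ^ r * (y * (- A$1$2)) ^ (n - i - r)) =
        of_nat (i choose p) * of_nat ((n - i) choose r) *
      monom4 p (i - p) r (n - i - r) A * x ^ (p + r) * y ^ (n - (p + r))"
        unfolding e[OF \<open>p \<le> i\<close> \<open>r \<le> n - i\<close>, symmetric] power_mult_distrib monom4_def power_add
        by (simp only: mult_ac)
    qed
    finally have m: "(x * A$2$1 + y * A$2$2) ^ i * (x * (- A$1$1) + y * (- A$1$2)) ^ (n - i) = \<dots>" .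
    have "of_nat (n choose i) * (a * (x * A$2$1 + y * A$2$2)) ^ i * (b * (x * (- A$1$1) + y * (- A$1$2))) ^ (n - i)
      = of_nat (n choose i) * ((x * A$2$1 + y * A$2$2) ^ i * (x * (- A$1$1) + y * (- A$1$2)) ^ (n - i)) * a ^ i * b ^ (n - i)"
      unfolding power_mult_distrib by (simp only: mult_ac)
    also have "\<dots> = (\<Sum>(p, r)\<in>{..i} \<times> {..n - i}.
      of_nat (n choose i) * of_nat (i choose p) * of_nat ((n - i) choose r) *
      monom4 p (i - p) r (n - i - r) A * x ^ (p + r) * y ^ (n - (p + r))) * a ^ i * b ^ (n - i)"
      unfolding m by (simp add: sum_distrib_left mult.assoc case_prod_unfold)
    finally show "of_nat (n choose i) * (a * (x * A$2$1 + y * A$2$2)) ^ i * (b * (x * (- A$1$1) + y * (- A$1$2))) ^ (n - i) = \<dots>" .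
  qed
  finally show ?thesis .
qed

text \<open>
  The coefficient of \<open>a\<^sup>i b\<^bsup>n-i\<^esup> x\<^sup>j y\<^bsup>n-j\<^esup>\<close> in \<open>ell a b x y A ^ n\<close>.
\<close>

definition ell_coeff :: "nat \<Rightarrow> nat \<Rightarrow> nat \<Rightarrow> mat2 \<Rightarrow> complex"
  where "ell_coeff n i j A = (\<Sum>(p, r)\<in>{(p, r). p \<le> i \<and> r \<le> n - i \<and> p + r = j}.
      of_nat (n choose i) * of_nat (i choose p) * of_nat ((n - i) choose r) *
      monom4 p (i - p) r (n - i - r) A)"

lemma continuous_on_ell_coeff: "continuous_on S (ell_coeff n i j)"
  unfolding ell_coeff_def case_prod_unfold by (intro continuous_intros)

lemma ell_power_coeffs:
  "ell a b x y A ^ n = (\<Sum>i\<le>n. (\<Sum>j\<le>n. ell_coeff n i j A * x ^ j * y ^ (n - j)) * a ^ i * b ^ (n - i))"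
  unfolding ell_power_expand
proof (rule sum.cong[OF refl])
  fix i assume i: "i \<in> {..n}"
  let ?h = "\<lambda>(p, r). of_nat (n choose i) * of_nat (i choose p) * of_nat ((n - i) choose r) *
      monom4 p (i - p) r (n - i - r) A * x ^ (p + r) * y ^ (n - (p + r))"
  have "(\<Sum>j\<le>n. \<Sum>z\<in>{z \<in> {..i} \<times> {..n - i}. (\<lambda>(p, r). p + r) z = j}. ?h z) = sum ?h ({..i} \<times> {..n - i})"
    using i by (intro sum.group) auto
  moreover have "(\<Sum>z\<in>{z \<in> {..i} \<times> {..n - i}. (\<lambda>(p, r). p + r) z = j}. ?h z) =
      ell_coeff n i j A * x ^ j * y ^ (n - j)" for j
  proof -
    have "{z \<in> {..i} \<times> {..n - i}. (\<lambda>(p, r). p + r) z = j} = {(p, r). p \<le> i \<and> r \<le> n - i \<and> p + r = j}"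
      by auto
    then show ?thesis unfolding ell_coeff_def
      by (simp add: sum_distrib_right) (auto intro!: sum.cong)
  qed
  ultimately show "(\<Sum>(p, r)\<in>{..i} \<times> {..n - i}.
      of_nat (n choose i) * of_nat (i choose p) * of_nat ((n - i) choose r) *
      monom4 p (i - p) r (n - i - r) A * x ^ (p + r) * y ^ (n - (p + r))) * a ^ i * b ^ (n - i) =
      (\<Sum>j\<le>n. ell_coeff n i j A * x ^ j * y ^ (n - j)) * a ^ i * b ^ (n - i)"
    by simp
qed

lemma polynomial_zero_coeffs:
  fixes c :: "nat \<Rightarrow> complex"
  assumes "\<And>x. (\<Sum>i\<le>n. c i * x ^ i) = 0" "i \<le> n"
  shows "c i = 0"
  using assms polyfun_eq_0[of c n] by auto

lemma integral_ell_power: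
  assumes F: "continuous_on SU2 F"
  shows "SU2_integral (\<lambda>A. F A * ell a b x y A ^ n) =
    (\<Sum>i\<le>n. (\<Sum>j\<le>n. SU2_integral (\<lambda>A. F A * ell_coeff n i j A) * x ^ j * y ^ (n - j)) * a ^ i * b ^ (n - i))"
proof -
  have c: "continuous_on SU2 (\<lambda>A. F A * ell_coeff n i j A)" for i j
    by (intro continuous_intros F continuous_on_ell_coeff)
  have "SU2_integral (\<lambda>A. F A * ell a b x y A ^ n) =
      SU2_integral (\<lambda>A. \<Sum>i\<le>n. \<Sum>j\<le>n. (x ^ j * y ^ (n - j) * a ^ i * b ^ (n - i)) * (F A * ell_coeff n i j A))"
    unfolding ell_power_coeffs by (simp add: sum_distrib_left sum_distrib_right mult_ac)
  also have "\<dots> = (\<Sum>i\<le>n. \<Sum>j\<le>n. (x ^ j * y ^ (n - j) * a ^ i * b ^ (n - i)) * SU2_integral (\<lambda>A. F A * ell_coeff n i j A))"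
    by (subst SU2_integral_sum, intro continuous_intros c, rule sum.cong[OF refl],
        subst SU2_integral_sum, intro continuous_intros c, rule sum.cong[OF refl],
        rule SU2_integral_mult_left[OF c])
  finally show ?thesis by (simp add: sum_distrib_left sum_distrib_right mult_ac)
qed

text \<open>
  Induction on the degree. When all moments of lower degree vanish, the moments of degree \<open>n\<close> depend
  only on the bidegree \<open>(i, j)\<close>, by \<open>monom4_relation\<close>. The integral of \<open>F\<close> against
  \<open>ell_coeff n i j\<close> is then a positive multiple of that common moment.
\<close>

lemma moments_from_ell_coeffs:
  assumes F: "continuous_on SU2 F"
    and zero: "\<And>n i j. i \<le> n \<Longrightarrow> j \<le> n \<Longrightarrow> SU2_integral (\<lambda>A. F A * ell_coeff n i j A) = 0"
  shows "SU2_integral (\<lambda>A. F A * monom4 p q r s A) = (0::complex)"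
proof (induction "p + q + r + s" arbitrary: p q r s rule: less_induct)
  case less
  define \<mu> where "\<mu> = (\<lambda>p q r s. SU2_integral (\<lambda>A. F A * monom4 p q r s A))"
  define n i j where "n = p + q + r + s" and "i = p + q" and "j = p + r"
  have c: "continuous_on SU2 (\<lambda>A. F A * monom4 p q r s A)" for p q r s by (intro continuous_intros F)
  have step: "\<mu> (Suc p') q' r' (Suc s') = \<mu> p' (Suc q') (Suc r') s'" if "Suc p' + q' + r' + Suc s' = n" for p' q' r' s'
  proof -
    have "\<mu> (Suc p') q' r' (Suc s') = SU2_integral (\<lambda>A. F A * monom4 p' q' r' s' A + F A * monom4 p' (Suc q') (Suc r') s' A)"
      unfolding \<mu>_def by (rule SU2_integral_cong) (simp add: monom4_relation distrib_left)
    also have "\<dots> = \<mu> p' q' r' s' + \<mu> p' (Suc q') (Suc r') s'"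
      unfolding \<mu>_def by (rule SU2_integral_add[OF c c])
    also have "\<mu> p' q' r' s' = 0" unfolding \<mu>_def using less that by (simp add: n_def)
    finally show ?thesis by simp
  qed
  \<comment> \<open>By \<open>det A = 1\<close>, the moment of a monomial of degree \<open>n\<close> depends only on its degrees \<open>i\<close> in the second row and
    \<open>j\<close> in the first column.\<close>
  have down: "\<mu> p' q' r' s' = \<mu> (p' - k) (q' + k) (r' + k) (s' - k)"
    if "p' + q' + r' + s' = n" "k \<le> p'" "k \<le> s'" for p' q' r' s' k
    using that
  proof (induction k)
    case (Suc k)
    then have "\<mu> p' q' r' s' = \<mu> (Suc (p' - Suc k)) (q' + k) (r' + k) (Suc (s' - Suc k))" by (simp add: Suc_diff_Suc)
    also have "\<dots> = \<mu> (p' - Suc k) (Suc (q' + k)) (Suc (r' + k)) (s' - Suc k)"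
      using Suc.prems by (intro step) simp
    finally show ?case by simp
  qed simp
  have same: "\<mu> p' (i - p') r' (n - i - r') = \<mu> p q r s" if "p' \<le> i" "r' \<le> n - i" "p' + r' = j" for p' r'
  proof (cases "p' \<le> p")
    case True
    have "\<mu> p q r s = \<mu> (p - (p - p')) (q + (p - p')) (r + (p - p')) (s - (p - p'))"
      using True that by (intro down) (auto simp: n_def i_def j_def)
    moreover have "p - (p - p') = p'" "q + (p - p') = i - p'" "r + (p - p') = r'" "s - (p - p') = n - i - r'"
      using True that by (auto simp: n_def i_def j_def)
    ultimately show ?thesis by simp
  next
    case False
    have "\<mu> p' (i - p') r' (n - i - r') =
        \<mu> (p' - (p' - p)) (i - p' + (p' - p)) (r' + (p' - p)) (n - i - r' - (p' - p))"
      using False that by (intro down) (auto simp: n_def i_def j_def)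
    moreover have "p' - (p' - p) = p" "i - p' + (p' - p) = q" "r' + (p' - p) = r" "n - i - r' - (p' - p) = s"
      using False that by (auto simp: n_def i_def j_def)
    ultimately show ?thesis by simp
  qed
  let ?P = "{(p, r). p \<le> i \<and> r \<le> n - i \<and> p + r = j}"
  have fin: "finite ?P" by (rule finite_subset[of _ "{..i} \<times> {..n - i}"]) auto
  define w where "w = (\<Sum>(p, r)\<in>?P. (n choose i) * (i choose p) * ((n - i) choose r))"
  have "(p, r) \<in> ?P" by (simp add: n_def i_def j_def)
  moreover have "(n choose i) * (i choose p) * ((n - i) choose r) > 0"
    by (simp add: n_def i_def)
  ultimately have w: "w > 0" unfolding w_def using fin
    by (intro sum_pos2[of _ "(p, r)"]) auto
  have "0 = SU2_integral (\<lambda>A. F A * ell_coeff n i j A)" using zero[of i n j] by (simp add: n_def i_def j_def)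
  also have "\<dots> = SU2_integral (\<lambda>A. \<Sum>z\<in>?P. of_nat ((n choose i) * (i choose fst z) * ((n - i) choose snd z)) *
      (F A * monom4 (fst z) (i - fst z) (snd z) (n - i - snd z) A))"
    unfolding ell_coeff_def case_prod_unfold by (simp add: sum_distrib_left mult_ac)
  also have "\<dots> = (\<Sum>z\<in>?P. of_nat ((n choose i) * (i choose fst z) * ((n - i) choose snd z)) *
      \<mu> (fst z) (i - fst z) (snd z) (n - i - snd z))"
    unfolding \<mu>_def
    by (subst SU2_integral_sum, intro continuous_intros c, rule sum.cong[OF refl], rule SU2_integral_mult_left[OF c])
  also have "\<dots> = (\<Sum>z\<in>?P. of_nat ((n choose i) * (i choose fst z) * ((n - i) choose snd z)) * \<mu> p q r s)"
    using same by (intro sum.cong) auto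
  also have "\<dots> = of_nat w * \<mu> p q r s"
    by (simp add: w_def case_prod_unfold sum_distrib_right)
  finally show ?case using w by (simp add: \<mu>_def)
qed

text \<open>
  On SU(2), the real and imaginary parts of the entries are complex linear combinations of the
  entries.
\<close>

lemma linear_on_SU2:
  fixes p :: "mat2 \<Rightarrow> real"
  assumes "linear p"
  shows "\<exists>c1 c2 c3 c4. \<forall>A\<in>SU2. complex_of_real (p A) = c1 * A$1$1 + c2 * A$1$2 + c3 * A$2$1 + c4 * A$2$2"
proof -
  define d where "d = (\<lambda>z w. complex_of_real (p (mat2 z (- cnj w) w (cnj z))))"
  have "complex_of_real (p A) = ((d 1 0 - \<i> * d \<i> 0) / 2) * A$1$1 + (- (d 0 1 + \<i> * d 0 \<i>) / 2) * A$1$2 +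
      ((d 0 1 - \<i> * d 0 \<i>) / 2) * A$2$1 + ((d 1 0 + \<i> * d \<i> 0) / 2) * A$2$2" if A: "A \<in> SU2" for A
  proof -
    define z w where "z = A$1$1" and "w = A$2$1"
    have Aeq: "A = Re z *\<^sub>R mat2 1 0 0 1 + Im z *\<^sub>R mat2 \<i> 0 0 (- \<i>) + Re w *\<^sub>R mat2 0 (- 1) 1 0 + Im w *\<^sub>R mat2 0 \<i> \<i> 0"
      using A unfolding SU2_iff by (auto simp: mat2_eq_iff z_def w_def complex_eq_iff)
    have "complex_of_real (p A) = of_real (Re z) * d 1 0 + of_real (Im z) * d \<i> 0 + of_real (Re w) * d 0 1 + of_real (Im w) * d 0 \<i>"
      unfolding Aeq using assms by (simp add: linear_add linear_cmul d_def)
    moreover have "A$2$2 = cnj z" "A$1$2 = - cnj w" using A by (auto simp: SU2_iff z_def w_def)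
    moreover have "of_real (Re z) = (z + cnj z) / 2" "of_real (Re w) = (w + cnj w) / 2"
      "of_real (Im z) = (z - cnj z) * (- \<i>) / 2" "of_real (Im w) = (w - cnj w) * (- \<i>) / 2"
      by (auto simp: complex_eq_iff)
    ultimately show ?thesis by (simp add: z_def[symmetric] w_def[symmetric] algebra_simps
        add_divide_distrib diff_divide_distrib)
  qed
  then show ?thesis by blast
qed

text \<open>
  The moments control the integrals against all polynomials, and polynomials are uniformly dense
  by the Stone--Weierstrass theorem, so the real and imaginary parts of \<open>F\<close> are orthogonal to
  themselves.
\<close>

lemma zero_if_moments_vanish:
  assumes F: "continuous_on SU2 F"
    and zero: "\<And>p q r s. SU2_integral (\<lambda>A. F A * monom4 p q r s A) = (0::complex)"
    and A: "A \<in> SU2"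
  shows "F A = 0"
proof -
  \<comment> \<open>\<open>N\<close>: all moments vanish; \<open>M\<close>: multipliers that preserve \<open>N\<close>. The multipliers form an algebra that
    contains the entries, hence all polynomials, although \<open>N\<close> itself is not closed under products.\<close>
  define N where "N = {Q. continuous_on SU2 Q \<and> (\<forall>p q r s. SU2_integral (\<lambda>A. Q A * monom4 p q r s A) = (0::complex))}"
  define M where "M = {P. continuous_on SU2 P \<and> (\<forall>Q\<in>N. (\<lambda>A. P A * Q A) \<in> N)}"
  have FN: "F \<in> N" using F zero by (simp add: N_def)
  have Ncong: "Q' \<in> N" if "Q \<in> N" "\<And>A. A \<in> SU2 \<Longrightarrow> Q A = Q' A" for Q Q'
  proof -
    have "SU2_integral (\<lambda>A. Q' A * monom4 p q r s A) = SU2_integral (\<lambda>A. Q A * monom4 p q r s A)" for p q r s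
      by (rule SU2_integral_cong) (simp add: that(2))
    moreover have "continuous_on SU2 Q'"
      using that continuous_on_cong[of SU2 SU2 Q Q'] by (auto simp: N_def)
    ultimately show ?thesis using that(1) by (simp add: N_def)
  qed
  have Nadd: "(\<lambda>A. P A + Q A) \<in> N" if "P \<in> N" "Q \<in> N" for P Q
  proof -
    have "SU2_integral (\<lambda>A. (P A + Q A) * monom4 p q r s A) =
        SU2_integral (\<lambda>A. P A * monom4 p q r s A) + SU2_integral (\<lambda>A. Q A * monom4 p q r s A)" for p q r s
      unfolding distrib_right using that by (intro SU2_integral_add continuous_intros) (auto simp: N_def)
    then show ?thesis using that by (auto simp: N_def intro!: continuous_intros)
  qed
  have Nscale: "(\<lambda>A. c * Q A) \<in> N" if "Q \<in> N" for c Q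
  proof -
    have "SU2_integral (\<lambda>A. (c * Q A) * monom4 p q r s A) = c * SU2_integral (\<lambda>A. Q A * monom4 p q r s A)" for p q r s
      unfolding mult.assoc using that by (intro SU2_integral_mult_left continuous_intros) (auto simp: N_def)
    then show ?thesis using that by (auto simp: N_def intro!: continuous_intros)
  qed
  have Nentry: "(\<lambda>A. A$i$j * Q A) \<in> N" if Q: "Q \<in> N" for i j Q
  proof -
    have cQ: "continuous_on SU2 Q" and mQ: "\<And>p q r s. SU2_integral (\<lambda>A. Q A * monom4 p q r s A) = 0"
      using Q by (auto simp: N_def)
    have 1: "(\<lambda>A. A$2$1 * Q A) \<in> N" "(\<lambda>A. A$2$2 * Q A) \<in> N" "(\<lambda>A. (- A$1$1) * Q A) \<in> N" "(\<lambda>A. (- A$1$2) * Q A) \<in> N"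
    proof -
      have e: "(A$2$1 * Q A) * monom4 p q r s A = Q A * monom4 (Suc p) q r s A"
        "(A$2$2 * Q A) * monom4 p q r s A = Q A * monom4 p (Suc q) r s A"
        "((- A$1$1) * Q A) * monom4 p q r s A = Q A * monom4 p q (Suc r) s A"
        "((- A$1$2) * Q A) * monom4 p q r s A = Q A * monom4 p q r (Suc s) A" for A p q r s
        by (simp_all add: monom4_def)
      show "(\<lambda>A. A$2$1 * Q A) \<in> N" "(\<lambda>A. A$2$2 * Q A) \<in> N" "(\<lambda>A. (- A$1$1) * Q A) \<in> N" "(\<lambda>A. (- A$1$2) * Q A) \<in> N"
        unfolding N_def mem_Collect_eq e by (intro conjI continuous_intros cQ allI mQ)+
    qed
    have "(\<lambda>A. A$1$1 * Q A) \<in> N" "(\<lambda>A. A$1$2 * Q A) \<in> N"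
      using Nscale[OF 1(3), of "-1"] Nscale[OF 1(4), of "-1"] by simp_all
    with 1(1,2) show ?thesis by (cases "i = 1"; cases "j = 1") (simp_all add: not_eq_1)
  qed
  have MI: "real_polynomial_function p \<Longrightarrow> (\<lambda>A. complex_of_real (p A)) \<in> M" for p
  proof (induction rule: real_polynomial_function.induct)
    case (linear p)
    then obtain c1 c2 c3 c4 where c: "\<And>A. A \<in> SU2 \<Longrightarrow> complex_of_real (p A) = c1 * A$1$1 + c2 * A$1$2 + c3 * A$2$1 + c4 * A$2$2"
      using linear_on_SU2[of p] bounded_linear.linear by metis
    have "(\<lambda>A. complex_of_real (p A) * Q A) \<in> N" if Q: "Q \<in> N" for Q
    proof (rule Ncong)
      show "(\<lambda>A. c1 * (A$1$1 * Q A) + c2 * (A$1$2 * Q A) + c3 * (A$2$1 * Q A) + c4 * (A$2$2 * Q A)) \<in> N"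
        by (intro Nadd Nscale Nentry Q)
    qed (simp add: c algebra_simps)
    moreover have "continuous_on SU2 (\<lambda>A. complex_of_real (p A))"
      using linear by (intro continuous_intros linear_continuous_on)
    ultimately show ?case by (simp add: M_def)
  next
    case (const c)
    then show ?case by (auto simp: M_def intro!: Nscale)
  next
    case (add f g)
    then show ?case using Nadd unfolding M_def by (auto simp: distrib_right intro!: continuous_intros)
  next
    case (mult f g)
    then show ?case unfolding M_def by (auto simp: mult.assoc intro!: continuous_intros)
  qed
  have poly: "SU2_integral (\<lambda>A. F A * complex_of_real (p A)) = 0" if "real_polynomial_function p" for p
  proof -
    have "(\<lambda>A. complex_of_real (p A) * F A) \<in> N" using MI[OF that] FN by (simp add: M_def)
    then have "SU2_integral (\<lambda>A. complex_of_real (p A) * F A * monom4 0 0 0 0 A) = 0" by (simp add: N_def)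
    then show ?thesis by (simp add: monom4_def mult.commute)
  qed
  have real: "\<phi> A = 0" if \<phi>: "continuous_on SU2 \<phi>"
    and orth: "\<And>p. real_polynomial_function p \<Longrightarrow> SU2_integral (\<lambda>A. \<phi> A * p A) = 0" for \<phi> :: "mat2 \<Rightarrow> real"
  proof -
    have csq: "continuous_on SU2 (\<lambda>A. \<phi> A * \<phi> A)" by (intro continuous_intros \<phi>)
    have "\<exists>c\<ge>0. \<forall>x\<in>SU2. norm (\<phi> x) \<le> c" by (rule continuous_on_SU2_bounded[OF \<phi>])
    then obtain c where c: "c \<ge> 0" "\<And>x. x \<in> SU2 \<Longrightarrow> \<bar>\<phi> x\<bar> \<le> c" by auto
    define g where "g = (\<lambda>n. SOME g. real_polynomial_function g \<and> (\<forall>x\<in>SU2. \<bar>\<phi> x - g x\<bar> < 1 / real (Suc n)))"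
    have g: "real_polynomial_function (g n) \<and> (\<forall>x\<in>SU2. \<bar>\<phi> x - g n x\<bar> < 1 / real (Suc n))" for n
    proof -
      obtain h where "real_polynomial_function h" "\<And>x. x \<in> SU2 \<Longrightarrow> \<bar>\<phi> x - h x\<bar> < 1 / real (Suc n)"
        by (rule Stone_Weierstrass_real_polynomial_function[OF compact_SU2 \<phi>, of "1 / real (Suc n)"]) auto
      then show ?thesis unfolding g_def by (intro someI_ex[of "\<lambda>g. real_polynomial_function g \<and> _ g"]) blast
    qed
    have cg: "continuous_on SU2 (g n)" for n
      using g[of n] continuous_on_polymonial_function real_polynomial_function_eq by blast
    have "(\<lambda>n. SU2_integral (\<lambda>A. \<phi> A * g n A)) \<longlonglongrightarrow> SU2_integral (\<lambda>A. \<phi> A * \<phi> A)"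
    proof (rule SU2_integral_dominated_convergence)
      fix x assume x: "x \<in> SU2"
      have "(\<lambda>n. g n x - \<phi> x) \<longlonglongrightarrow> 0"
      proof (rule Lim_null_comparison[OF _ LIMSEQ_inverse_real_of_nat])
        show "\<forall>\<^sub>F n in sequentially. norm (g n x - \<phi> x) \<le> inverse (real (Suc n))"
          using g x by (intro always_eventually allI) (auto simp: inverse_eq_divide abs_minus_commute less_imp_le simp del: of_nat_Suc)
      qed
      then have "(\<lambda>n. g n x) \<longlonglongrightarrow> \<phi> x" by (simp add: LIM_zero_iff)
      then show "(\<lambda>n. \<phi> x * g n x) \<longlonglongrightarrow> \<phi> x * \<phi> x" by (intro tendsto_intros)
      fix n
      have "\<bar>\<phi> x - g n x\<bar> < 1 / real (Suc n)" using g x by blast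
      moreover have "1 / real (Suc n) \<le> 1" by simp
      ultimately have "\<bar>g n x\<bar> \<le> c + 1" using c(2)[OF x] by linarith
      then show "\<bar>\<phi> x * g n x\<bar> \<le> c * (c + 1)"
        unfolding abs_mult using c x by (intro mult_mono) auto
    qed (intro continuous_intros \<phi> cg)+
    moreover have "SU2_integral (\<lambda>A. \<phi> A * g n A) = 0" for n using g orth by blast
    ultimately have "SU2_integral (\<lambda>A. \<phi> A * \<phi> A) = 0" by (simp add: LIMSEQ_const_iff)
    then have "\<phi> A * \<phi> A = 0" by (rule SU2_integral_eq_0_imp[OF csq _ _ A, rotated]) simp
    then show ?thesis by simp
  qed
  have "SU2_integral (\<lambda>A. Re (F A) * p A) = 0" "SU2_integral (\<lambda>A. Im (F A) * p A) = 0"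
    if p: "real_polynomial_function p" for p
  proof -
    have "continuous_on SU2 p"
      using p continuous_on_polymonial_function real_polynomial_function_eq by blast
    then have c: "continuous_on SU2 (\<lambda>A. F A * complex_of_real (p A))" by (intro continuous_intros F)
    show "SU2_integral (\<lambda>A. Re (F A) * p A) = 0" "SU2_integral (\<lambda>A. Im (F A) * p A) = 0"
      using SU2_integral_bounded_linear[OF bounded_linear_Re c] SU2_integral_bounded_linear[OF bounded_linear_Im c]
        poly[OF p] by simp_all
  qed
  then have "Re (F A) = 0" "Im (F A) = 0"
    by (intro real[of "\<lambda>A. Re (F A)"] real[of "\<lambda>A. Im (F A)"] continuous_intros F; blast)+
  then show ?thesis by (simp add: complex_eq_iff)
qed

lemma zero_if_orthogonal_to_ell_powers:
  assumes F: "continuous_on SU2 F"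
    and zero: "\<And>n a b x y. SU2_integral (\<lambda>A. F A * ell a b x y A ^ n) = (0::complex)"
    and A: "A \<in> SU2"
  shows "F A = 0"
proof (rule zero_if_moments_vanish[OF F _ A], rule moments_from_ell_coeffs[OF F])
  fix n i j :: nat assume ij: "i \<le> n" "j \<le> n"
  have "(\<Sum>i\<le>n. (\<Sum>j\<le>n. SU2_integral (\<lambda>A. F A * ell_coeff n i j A) * x ^ j) * a ^ i) = 0" for a x
    using integral_ell_power[OF F, of a 1 x 1 n] zero by simp
  then have "(\<Sum>j\<le>n. SU2_integral (\<lambda>A. F A * ell_coeff n i j A) * x ^ j) = 0" for x
    by (rule polynomial_zero_coeffs) (rule ij(1))
  then show "SU2_integral (\<lambda>A. F A * ell_coeff n i j A) = 0"
    by (rule polynomial_zero_coeffs) (rule ij(2))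
qed

section \<open>Linear combinations and translates of smooth functions\<close>

lemma Ck_on_subset: "Ck_on k U f \<Longrightarrow> V \<subseteq> U \<Longrightarrow> Ck_on k V f"
proof (induction k arbitrary: f)
  case 0
  then show ?case using continuous_on_subset by auto
next
  case (Suc k)
  then obtain f' where f': "\<And>x. x \<in> U \<Longrightarrow> (f has_derivative f' x) (at x)" "\<And>v. Ck_on k U (\<lambda>x. f' x v)"
    by auto
  then show ?case using Suc by (auto intro!: exI[of _ f'])
qed

lemma Ck_on_lincomb:
  "Ck_on k U f \<Longrightarrow> Ck_on k U g \<Longrightarrow> Ck_on k U (\<lambda>x. c * f x + d * g x)"
proof (induction k arbitrary: f g)
  case 0
  then show ?case by (auto intro!: continuous_intros)
next
  case (Suc k)
  obtain f' where f': "\<And>x. x \<in> U \<Longrightarrow> (f has_derivative f' x) (at x)" "\<And>v. Ck_on k U (\<lambda>x. f' x v)"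
    using Suc.prems(1) by auto
  obtain g' where g': "\<And>x. x \<in> U \<Longrightarrow> (g has_derivative g' x) (at x)" "\<And>v. Ck_on k U (\<lambda>x. g' x v)"
    using Suc.prems(2) by auto
  have "((\<lambda>x. c * f x + d * g x) has_derivative (\<lambda>v. c * f' x v + d * g' x v)) (at x)" if "x \<in> U" for x
    using f'(1)[OF that] g'(1)[OF that] by (auto intro!: derivative_eq_intros)
  moreover have "Ck_on k U (\<lambda>x. c * f' x v + d * g' x v)" for v
    by (rule Suc.IH[OF f'(2) g'(2)])
  ultimately show ?case by (auto intro!: exI[of _ "\<lambda>x v. c * f' x v + d * g' x v"])
qed

lemma smooth_lincomb:
  assumes "smooth_on_submanifold S f" "smooth_on_submanifold S g"
  shows "smooth_on_submanifold S (\<lambda>x. c * f x + d * g x)"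
  unfolding smooth_on_submanifold_def
proof
  fix x assume x: "x \<in> S"
  obtain U F where U: "open U" "x \<in> U" "\<forall>k. Ck_on k U F" "\<forall>y\<in>U \<inter> S. F y = f y"
    using bspec[OF assms(1)[unfolded smooth_on_submanifold_def] x] by (elim exE conjE)
  obtain V G where V: "open V" "x \<in> V" "\<forall>k. Ck_on k V G" "\<forall>y\<in>V \<inter> S. G y = g y"
    using bspec[OF assms(2)[unfolded smooth_on_submanifold_def] x] by (elim exE conjE)
  have "Ck_on k (U \<inter> V) (\<lambda>y. c * F y + d * G y)" for k
    by (rule Ck_on_lincomb[OF Ck_on_subset[OF spec[OF U(3)] Int_lower1]
          Ck_on_subset[OF spec[OF V(3)] Int_lower2]])
  then show "\<exists>U h. open U \<and> x \<in> U \<and> (\<forall>k. Ck_on k U h) \<and> (\<forall>y\<in>U \<inter> S. h y = c * f y + d * g y)"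
    using U V by (intro exI[of _ "U \<inter> V"] exI[of _ "\<lambda>y. c * F y + d * G y"]) auto
qed

lemma Ck_on_compose_linear:
  fixes T :: "'a::euclidean_space \<Rightarrow> 'a"
  assumes T: "linear T"
  shows "Ck_on k U g \<Longrightarrow> Ck_on k (T -` U) (\<lambda>x. g (T x))"
proof (induction k arbitrary: g)
  case 0
  have "continuous_on (T -` U) T" using T by (simp add: linear_continuous_on linear_linear)
  then show ?case using 0 continuous_on_compose2[of U g "T -` U" T] by auto
next
  case (Suc k)
  obtain g' where g': "\<And>x. x \<in> U \<Longrightarrow> (g has_derivative g' x) (at x)" "\<And>v. Ck_on k U (\<lambda>x. g' x v)"
    using Suc.prems by auto
  have Td: "(T has_derivative T) (at x)" for x
    using T by (simp add: bounded_linear_imp_has_derivative linear_linear)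
  have "((\<lambda>x. g (T x)) has_derivative (\<lambda>v. g' (T x) (T v))) (at x)" if "T x \<in> U" for x
    using diff_chain_at[OF Td g'(1)[OF that]] by (simp add: comp_def)
  moreover have "Ck_on k (T -` U) (\<lambda>x. g' (T x) (T v))" for v
    by (rule Suc.IH[OF g'(2)])
  ultimately show ?case by (auto intro!: exI[of _ "\<lambda>x v. g' (T x) (T v)"])
qed

lemma linear_matmul_left: "linear (\<lambda>x::mat2. (a::mat2) ** x)"
  by (rule linearI) (simp_all add: mat2_eq_iff algebra_simps)

text \<open>
  Left translations are restrictions of linear maps.
\<close>

lemma smooth_left_translate:
  assumes f: "smooth_on_submanifold SU2 f" and a: "a \<in> SU2"
  shows "smooth_on_submanifold SU2 (\<lambda>x. f (a ** x))"
  unfolding smooth_on_submanifold_def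
proof
  fix x assume x: "x \<in> SU2"
  then have ax: "a ** x \<in> SU2" using a by blast
  obtain U F where U: "open U" "a ** x \<in> U" "\<forall>k. Ck_on k U F" "\<forall>y\<in>U \<inter> SU2. F y = f y"
    using bspec[OF f[unfolded smooth_on_submanifold_def] ax] by (elim exE conjE)
  have "continuous_on UNIV (\<lambda>x::mat2. a ** x)"
    using linear_matmul_left[of a] by (simp add: linear_continuous_on linear_linear)
  then have "open ((\<lambda>x. a ** x) -` U)" using U(1) by (metis open_vimage)
  then show "\<exists>U h. open U \<and> x \<in> U \<and> (\<forall>k. Ck_on k U h) \<and> (\<forall>y\<in>U \<inter> SU2. h y = f (a ** y))"
    using U a Ck_on_compose_linear[OF linear_matmul_left[of a]]
    by (intro exI[of _ "(\<lambda>x. a ** x) -` U"] exI[of _ "\<lambda>y. F (a ** y)"]) auto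
qed

lemma second_along_lincomb:
  assumes "second_along e f f2" "second_along e g g2"
  shows "second_along e (\<lambda>x. c * f x + d * g x) (\<lambda>x. c * f2 x + d * g2 x)"
proof -
  obtain f1 where f1: "\<And>x. x \<in> SU2 \<Longrightarrow> ((\<lambda>t. f (geo e t x)) has_real_derivative f1 x) (at 0)"
    "\<And>x. x \<in> SU2 \<Longrightarrow> ((\<lambda>t. f1 (geo e t x)) has_real_derivative f2 x) (at 0)"
    using assms(1) by (auto simp: second_along_def)
  obtain g1 where g1: "\<And>x. x \<in> SU2 \<Longrightarrow> ((\<lambda>t. g (geo e t x)) has_real_derivative g1 x) (at 0)"
    "\<And>x. x \<in> SU2 \<Longrightarrow> ((\<lambda>t. g1 (geo e t x)) has_real_derivative g2 x) (at 0)"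
    using assms(2) by (auto simp: second_along_def)
  show ?thesis
    unfolding second_along_def using assms
    by (intro conjI exI[of _ "\<lambda>x. c * f1 x + d * g1 x"] ballI DERIV_add DERIV_cmult f1 g1 continuous_intros)
      (auto simp: second_along_def)
qed

lemma laplacian_lincomb:
  assumes f: "smooth_on_submanifold SU2 f" and g: "smooth_on_submanifold SU2 g" and x: "x \<in> SU2"
  shows "laplacian_SU2 (\<lambda>x. c * f x + d * g x) x = c * laplacian_SU2 f x + d * laplacian_SU2 g x"
proof -
  obtain f2 where f2: "\<And>e. e \<in> quaternion_units \<Longrightarrow> second_along e f (f2 e)"
    using smooth_second_along[OF _ f] by metis
  obtain g2 where g2: "\<And>e. e \<in> quaternion_units \<Longrightarrow> second_along e g (g2 e)"
    using smooth_second_along[OF _ g] by metis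
  have "(deriv ^^ 2) (\<lambda>t. c * f (geo e t x) + d * g (geo e t x)) 0 =
      c * (deriv ^^ 2) (\<lambda>t. f (geo e t x)) 0 + d * (deriv ^^ 2) (\<lambda>t. g (geo e t x)) 0"
    if e: "e \<in> quaternion_units" for e
    using second_along_deriv[OF e x second_along_lincomb[OF f2[OF e] g2[OF e]]]
      second_along_deriv[OF e x f2[OF e]] second_along_deriv[OF e x g2[OF e]] by simp
  then show ?thesis
    unfolding laplacian_SU2_alt by (simp add: sum.distrib sum_distrib_left[symmetric] cong: sum.cong)
qed

section \<open>Continuous functions on the quotient\<close>

text \<open>
  The common home of the eigenspace and of its products. It is an algebra, and integration
  against the square is definite on it.
\<close>

definition C_PDS :: "(mat2 set \<Rightarrow> real) set"
  where "C_PDS = {h. (\<forall>x. x \<notin> PDS \<longrightarrow> h x = 0) \<and> continuous_on SU2 (\<lambda>A. h (coset A))}"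

lemma C_PDS_continuous: "h \<in> C_PDS \<Longrightarrow> continuous_on SU2 (\<lambda>A. h (coset A))"
  by (simp add: C_PDS_def)

lemma C_PDS_ext: "\<lbrakk>f \<in> C_PDS; g \<in> C_PDS; \<And>A. A \<in> SU2 \<Longrightarrow> f (coset A) = g (coset A)\<rbrakk> \<Longrightarrow> f = g"
proof (rule ext)
  fix x assume fg: "f \<in> C_PDS" "g \<in> C_PDS" "\<And>A. A \<in> SU2 \<Longrightarrow> f (coset A) = g (coset A)"
  show "f x = g x"
  proof (cases "x \<in> PDS")
    case True
    then obtain A where "A \<in> SU2" "x = coset A" by (auto simp: PDS_def)
    then show ?thesis using fg(3) by simp
  qed (use fg(1,2) in \<open>simp add: C_PDS_def\<close>)
qed

lemma subspace_C_PDS: "subspace C_PDS"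
  by (rule subspaceI) (auto simp: C_PDS_def scaleR_fun_def intro!: continuous_intros)

lemma C_PDS_mult: "f \<in> C_PDS \<Longrightarrow> g \<in> C_PDS \<Longrightarrow> f * g \<in> C_PDS"
  by (auto simp: C_PDS_def intro!: continuous_intros)

lemma integral_PDS_eq:
  assumes "h \<in> C_PDS"
  shows "integral_PDS h = SU2_integral (\<lambda>A. h (coset A)) / real (card Istar)"
proof -
  have "h (coset A) = indicator SU2 A *\<^sub>R h (coset A)" for A
    using assms coset_in_PDS_iff[of A] by (auto simp: C_PDS_def indicator_def)
  then have "(LINT A|vol_SU2. h (coset A)) = (LINT A|vol_SU2. indicator SU2 A *\<^sub>R h (coset A))"
    by (rule Bochner_Integration.integral_cong[OF refl])
  then show ?thesis
    by (simp only: integral_PDS_def SU2_integral_def set_lebesgue_integral_def)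
qed

lemma integral_PDS_add: "f \<in> C_PDS \<Longrightarrow> g \<in> C_PDS \<Longrightarrow> integral_PDS (f + g) = integral_PDS f + integral_PDS g"
  using subspace_add[OF subspace_C_PDS, of f g]
  by (simp add: integral_PDS_eq SU2_integral_add C_PDS_continuous add_divide_distrib)

lemma integral_PDS_scale: "f \<in> C_PDS \<Longrightarrow> integral_PDS (c *\<^sub>R f) = c * integral_PDS f"
  using subspace_scale[OF subspace_C_PDS, of f c]
  by (simp add: integral_PDS_eq SU2_integral_mult_left C_PDS_continuous scaleR_fun_def)

lemma integral_PDS_square_eq_0:
  assumes f: "f \<in> C_PDS" and z: "integral_PDS (f * f) = 0"
  shows "f = 0"
proof -
  have c: "continuous_on SU2 (\<lambda>A. f (coset A) * f (coset A))" using f by (intro continuous_on_mult C_PDS_continuous)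
  have "SU2_integral (\<lambda>A. f (coset A) * f (coset A)) = 0"
    using z card_Istar_pos by (simp add: integral_PDS_eq[OF C_PDS_mult[OF f f]])
  then have "f (coset A) * f (coset A) = 0" if "A \<in> SU2" for A
    by (rule SU2_integral_eq_0_imp[OF c _ _ that, rotated]) simp
  then show ?thesis using f subspace_0[OF subspace_C_PDS] by (intro C_PDS_ext) auto
qed

lemma integral_PDS_square_nonneg:
  assumes f: "f \<in> C_PDS" shows "integral_PDS (f * f) \<ge> 0"
  unfolding integral_PDS_eq[OF C_PDS_mult[OF f f]] SU2_integral_def set_lebesgue_integral_def
  by (intro divide_nonneg_nonneg Bochner_Integration.integral_nonneg) auto

lemma scaleR_mult_fun: "(c *\<^sub>R f) * g = c *\<^sub>R (f * (g :: 'a \<Rightarrow> real))" "f * (c *\<^sub>R g) = c *\<^sub>R (f * (g :: 'a \<Rightarrow> real))"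
  by (auto simp: fun_eq_iff scaleR_fun_def)

lemma inner_space_L2:
  assumes S: "subspace S" "S \<subseteq> C_PDS" and fin: "\<exists>B. finite B \<and> S \<subseteq> span B"
  shows "inner_space S L2_inner"
proof
  fix f g h c assume fgh: "f \<in> S" "g \<in> S"
  then have C: "f \<in> C_PDS" "g \<in> C_PDS" using S by auto
  show "L2_inner (c *\<^sub>R f) g = c * L2_inner f g"
    unfolding L2_inner_def scaleR_mult_fun by (rule integral_PDS_scale[OF C_PDS_mult[OF C]])
  show "L2_inner f g = L2_inner g f" by (simp add: L2_inner_def mult.commute)
  { assume "h \<in> S"
    then have h: "h \<in> C_PDS" using S by auto
    show "L2_inner (f + g) h = L2_inner f h + L2_inner g h"
      unfolding L2_inner_def distrib_right by (intro integral_PDS_add C_PDS_mult C h) }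
next
  fix f assume f: "f \<in> S" "f \<noteq> 0"
  then have C: "f \<in> C_PDS" using S by auto
  show "L2_inner f f > 0"
    using integral_PDS_square_eq_0[OF C] integral_PDS_square_nonneg[OF C] f(2)
    by (force simp: L2_inner_def less_le)
qed (use assms in auto)

section \<open>The eigenspace is finite-dimensional\<close>

lemma E168_iff:
  "f \<in> E168 \<longleftrightarrow> (\<forall>x. x \<notin> PDS \<longrightarrow> f x = 0) \<and> smooth_on_submanifold SU2 (\<lambda>A. f (coset A)) \<and>
    (\<forall>A\<in>SU2. laplacian_SU2 (\<lambda>A. f (coset A)) A = 168 * f (coset A))"
  by (auto simp: laplace_eigenspace_def Cinf_PDS_def comp_def)

lemma E168_C_PDS: "E168 \<subseteq> C_PDS"
  by (auto simp: E168_iff C_PDS_def intro: smooth_continuous_on_SU2)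

lemma Ck_on_zero: "Ck_on k U (\<lambda>x. 0)"
  by (induction k) (auto intro!: exI[of _ "\<lambda>x v. 0"])

lemma subspace_E168: "subspace E168"
proof (rule subspaceI)
  have "smooth_on_submanifold SU2 (\<lambda>A. 0)"
    unfolding smooth_on_submanifold_def using Ck_on_zero
    by (intro ballI exI[of _ UNIV] exI[of _ "\<lambda>x. 0"]) auto
  moreover have "deriv (\<lambda>t::real. 0::real) = (\<lambda>t. 0)" by (auto simp: fun_eq_iff)
  then have "laplacian_SU2 (\<lambda>A. 0) x = 0" for x
    by (simp add: laplacian_SU2_def numeral_2_eq_2)
  ultimately show "0 \<in> E168" by (simp add: E168_iff)
next
  fix f g assume "f \<in> E168" "g \<in> E168"
  then show "f + g \<in> E168"
    using smooth_lincomb[of SU2 "\<lambda>A. f (coset A)" "\<lambda>A. g (coset A)" 1 1]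
      laplacian_lincomb[of "\<lambda>A. f (coset A)" "\<lambda>A. g (coset A)" _ 1 1]
    by (auto simp: E168_iff)
next
  fix f c assume "f \<in> E168"
  then show "c *\<^sub>R f \<in> E168"
    using smooth_lincomb[of SU2 "\<lambda>A. f (coset A)" "\<lambda>A. f (coset A)" c 0]
      laplacian_lincomb[of "\<lambda>A. f (coset A)" "\<lambda>A. f (coset A)" _ c 0]
    by (auto simp: E168_iff scaleR_fun_def)
qed

lemma left_translate_coset:
  "a \<in> SU2 \<Longrightarrow> left_translate a f (coset x) = f (coset (conj_transpose a ** x))"
  by (simp add: left_translate_def matrix_inv_SU2 image_mult_coset)

lemma left_translate_E168:
  assumes f: "f \<in> E168" and a: "a \<in> SU2"
  shows "left_translate a f \<in> E168"
proof -
  define b where "b = conj_transpose a"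
  have b: "b \<in> SU2" using a by (auto simp: b_def)
  have sm: "smooth_on_submanifold SU2 (\<lambda>A. f (coset A))" and
    eig: "\<And>A. A \<in> SU2 \<Longrightarrow> laplacian_SU2 (\<lambda>A. f (coset A)) A = 168 * f (coset A)" using f by (auto simp: E168_iff)
  have "left_translate a f x = 0" if "x \<notin> PDS" for x
  proof -
    have "(\<lambda>y. b ** y) ` x \<notin> PDS"
    proof
      assume "(\<lambda>y. b ** y) ` x \<in> PDS"
      then obtain c where c: "c \<in> SU2" "(\<lambda>y. b ** y) ` x = coset c" by (auto simp: PDS_def)
      have "x = (\<lambda>y. a ** y) ` ((\<lambda>y. b ** y) ` x)" using a by (simp add: b_def image_image)
      also have "\<dots> = coset (a ** c)" by (simp add: c image_mult_coset)
      finally show False using that a c coset_in_PDS[of "a ** c"] by auto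
    qed
    then show ?thesis using f a by (simp add: left_translate_def matrix_inv_SU2 b_def E168_iff)
  qed
  moreover have "laplacian_SU2 (\<lambda>x. f (coset (b ** x))) A = laplacian_SU2 (\<lambda>x. f (coset x)) (b ** A)" for A
    by (simp add: laplacian_SU2_alt matmul_geo)
  ultimately show ?thesis
    using smooth_left_translate[OF sm b] eig b SU2_mult
    by (simp add: E168_iff left_translate_coset[OF a] b_def)
qed

text \<open>
  The equation \<open>n (n + 2) = 168\<close> has \<open>n = 12\<close> as its only natural solution.
\<close>

lemma E168_orthogonal_ell_power:
  assumes f: "f \<in> E168" and n: "n \<noteq> 12"
  shows "SU2_integral (\<lambda>A. complex_of_real (f (coset A)) * ell a b x y A ^ n) = 0"
proof -
  have sm: "smooth_on_submanifold SU2 (\<lambda>A. f (coset A))" and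
    eig: "\<And>A. A \<in> SU2 \<Longrightarrow> laplacian_SU2 (\<lambda>A. f (coset A)) A = 168 * f (coset A)" using f by (auto simp: E168_iff)
  have "168 \<noteq> real (n * (n + 2))"
  proof
    assume "168 = real (n * (n + 2))"
    then have "168 = n * (n + 2)" by linarith
    moreover have "n * (n + 2) < 12 * 14" if "n < 12" using that by (intro mult_strict_mono) auto
    moreover have "12 * 14 < n * (n + 2)" if "n > 12" using that by (intro mult_strict_mono) auto
    ultimately show False using n by linarith
  qed
  then show ?thesis by (intro eigenfunction_orthogonal_ell_power[OF sm, of 168] eig)
qed

lemma E168_zero_if_moments_vanish:
  assumes f: "f \<in> E168"
    and m: "\<And>i j. i \<le> 12 \<Longrightarrow> j \<le> 12 \<Longrightarrow> SU2_integral (\<lambda>A. complex_of_real (f (coset A)) * ell_coeff 12 i j A) = 0"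
  shows "f = 0"
proof -
  have c: "continuous_on SU2 (\<lambda>A. complex_of_real (f (coset A)))"
    using f E168_C_PDS by (intro continuous_intros C_PDS_continuous) auto
  have "SU2_integral (\<lambda>A. complex_of_real (f (coset A)) * ell a b x y A ^ n) = 0" for n a b x y
    using m E168_orthogonal_ell_power[OF f] by (cases "n = 12") (auto simp: integral_ell_power[OF c])
  then have "complex_of_real (f (coset A)) = 0" if "A \<in> SU2" for A
    by (rule zero_if_orthogonal_to_ell_powers[OF c _ that])
  then show ?thesis using f E168_C_PDS subspace_0[OF subspace_C_PDS] by (intro C_PDS_ext) auto
qed

text \<open>
  Induction on the number of functionals: passing to the kernel of one of them costs at most one
  dimension.
\<close>

lemma finite_span_if_separating_functionals:
  fixes S :: "'v::real_vector set" and \<phi> :: "'i \<Rightarrow> 'v \<Rightarrow> real"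
  assumes "finite I" "subspace S"
    and "\<And>i f g. f \<in> S \<Longrightarrow> g \<in> S \<Longrightarrow> \<phi> i (f + g) = \<phi> i f + \<phi> i g"
    and "\<And>i c f. f \<in> S \<Longrightarrow> \<phi> i (c *\<^sub>R f) = c * \<phi> i f"
    and "\<And>f. f \<in> S \<Longrightarrow> (\<And>i. i \<in> I \<Longrightarrow> \<phi> i f = 0) \<Longrightarrow> f = 0"
  shows "\<exists>B. finite B \<and> S \<subseteq> span B"
  using assms
proof (induction I arbitrary: S)
  case empty
  then show ?case by (intro exI[of _ "{}"]) auto
next
  case (insert i I)
  define R where "R = {f \<in> S. \<phi> i f = 0}"
  have "\<phi> i 0 = 0" using insert.prems(3)[of 0 i 0] subspace_0[OF insert.prems(1)] by simp
  then have "subspace R" unfolding R_def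
    using insert.prems(1-3) by (intro subspaceI) (auto simp: subspace_0 subspace_add subspace_scale)
  moreover have "f = 0" if "f \<in> R" "\<And>i. i \<in> I \<Longrightarrow> \<phi> i f = 0" for f
    using that by (intro insert.prems(4)) (auto simp: R_def)
  ultimately have "\<exists>B. finite B \<and> R \<subseteq> span B"
    using insert.prems(2,3) by (intro insert.IH) (auto simp: R_def)
  then obtain B where B: "finite B" "R \<subseteq> span B" by blast
  show ?case
  proof (cases "S \<subseteq> R")
    case True
    then show ?thesis using B by blast
  next
    case False
    then obtain f0 where f0: "f0 \<in> S" "\<phi> i f0 \<noteq> 0" by (auto simp: R_def)
    have "S \<subseteq> span (insert f0 B)"
    proof
      fix f assume f: "f \<in> S"
      define c where "c = \<phi> i f / \<phi> i f0"
      have m: "(- c) *\<^sub>R f0 \<in> S" by (rule subspace_scale[OF insert.prems(1) f0(1)])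
      have "\<phi> i (f + (- c) *\<^sub>R f0) = 0"
        unfolding insert.prems(2)[OF f m] insert.prems(3)[OF f0(1)] using f0 by (simp add: c_def)
      then have "f + (- c) *\<^sub>R f0 \<in> span B" using B(2) subspace_add[OF insert.prems(1) f m] by (auto simp: R_def)
      then have "f + (- c) *\<^sub>R f0 \<in> span (insert f0 B)" using span_mono[of B "insert f0 B"] by auto
      moreover have "c *\<^sub>R f0 \<in> span (insert f0 B)" by (intro span_scale span_base) simp
      ultimately have "(f + (- c) *\<^sub>R f0) + c *\<^sub>R f0 \<in> span (insert f0 B)" by (rule span_add)
      then show "f \<in> span (insert f0 B)" by simp
    qed
    then show ?thesis using B(1) by (intro exI[of _ "insert f0 B"]) auto
  qed
qed

text \<open>
  The moments against the functions \<open>ell_coeff 12 i j\<close> are finitely many and separate the elements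
  of the eigenspace. The Boolean index selects the real or the imaginary part.
\<close>

lemma E168_finite_span: "\<exists>B. finite B \<and> E168 \<subseteq> span B"
proof -
  define \<mu> where "\<mu> = (\<lambda>i j f. SU2_integral (\<lambda>A. complex_of_real (f (coset A)) * ell_coeff 12 i j A))"
  have cf: "continuous_on SU2 (\<lambda>A. complex_of_real (f (coset A)) * ell_coeff 12 i j A)" if "f \<in> E168" for f i j
    using that E168_C_PDS by (intro continuous_intros continuous_on_ell_coeff C_PDS_continuous) auto
  have add: "\<mu> i j (f + g) = \<mu> i j f + \<mu> i j g" if "f \<in> E168" "g \<in> E168" for i j f g
    unfolding \<mu>_def using SU2_integral_add[OF cf[OF that(1)] cf[OF that(2)]] by (simp add: distrib_right)
  have scale: "\<mu> i j (c *\<^sub>R f) = of_real c * \<mu> i j f" if "f \<in> E168" for i j c f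
    unfolding \<mu>_def using SU2_integral_mult_left[OF cf[OF that], of "complex_of_real c"]
    by (simp add: scaleR_fun_def mult.assoc)
  define \<phi> where "\<phi> = (\<lambda>(b, i, j) f. if b then Re (\<mu> i j f) else Im (\<mu> i j f))"
  show ?thesis
  proof (rule finite_span_if_separating_functionals[of "UNIV \<times> {..12} \<times> {..12}" _ \<phi>])
    show "subspace E168" by (rule subspace_E168)
    show "f = 0" if f: "f \<in> E168" and z: "\<And>i. i \<in> UNIV \<times> {..12} \<times> {..12} \<Longrightarrow> \<phi> i f = 0" for f
    proof (rule E168_zero_if_moments_vanish[OF f])
      fix i j :: nat assume "i \<le> 12" "j \<le> 12"
      then show "SU2_integral (\<lambda>A. complex_of_real (f (coset A)) * ell_coeff 12 i j A) = 0"
        using z[of "(True, i, j)"] z[of "(False, i, j)"] by (simp add: \<phi>_def \<mu>_def complex_eq_iff)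
    qed
  qed (auto simp: \<phi>_def add scale split: prod.splits)
qed

interpretation E: inner_space E168 L2_inner
  by (rule inner_space_L2[OF subspace_E168 E168_C_PDS E168_finite_span])

lemma products_E_C_PDS: "products_E \<subseteq> C_PDS"
  unfolding products_E_def using E168_C_PDS C_PDS_mult
  by (intro span_minimal subspace_C_PDS) auto

lemma products_E_finite_span: "\<exists>B. finite B \<and> products_E \<subseteq> span B"
proof -
  obtain B where B: "finite B" "span B = E168" using E.finite_basis by blast
  define P where "P = (\<lambda>(b, c). b * c) ` (B \<times> B)"
  have 1: "b * g \<in> span P" if b: "b \<in> B" and g: "g \<in> span B" for b g
  proof -
    have "subspace {g. b * g \<in> span P}"
      by (rule subspaceI) (auto simp: distrib_left scaleR_mult_fun span_add span_scale span_zero)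
    moreover have "B \<subseteq> {g. b * g \<in> span P}" using b by (auto simp: P_def intro!: span_base)
    ultimately show ?thesis using span_minimal g by blast
  qed
  have 2: "f * g \<in> span P" if f: "f \<in> span B" and g: "g \<in> span B" for f g
  proof -
    have "subspace {f. f * g \<in> span P}"
      by (rule subspaceI) (auto simp: distrib_right scaleR_mult_fun span_add span_scale span_zero)
    moreover have "B \<subseteq> {f. f * g \<in> span P}" using 1 g by auto
    ultimately show ?thesis using span_minimal f by blast
  qed
  have "products_E \<subseteq> span P" unfolding products_E_def
    using 2 B(2) by (intro span_minimal) auto
  moreover have "finite P" using B(1) by (simp add: P_def)
  ultimately show ?thesis by blast
qed

interpretation P: inner_space products_E L2_inner
  by (rule inner_space_L2[OF _ products_E_C_PDS products_E_finite_span])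
    (simp add: products_E_def)

lemma E168_mult_products_E: "f \<in> E168 \<Longrightarrow> g \<in> E168 \<Longrightarrow> f * g \<in> products_E"
  unfolding products_E_def by (intro span_base) auto

section \<open>The operators defined by products\<close>

text \<open>
  Existence is the Riesz lemma on the eigenspace. Uniqueness also uses that the members of \<open>Sym_E\<close>
  have a prescribed value outside the eigenspace.
\<close>

lemma B_op_exists:
  assumes q: "q \<in> C_PDS"
  shows "\<exists>!A. A \<in> Sym_E \<and> (\<forall>f\<in>E168. \<forall>g\<in>E168. L2_inner (A f) g = - integral_PDS (q * f * g))"
proof (rule ex_ex1I)
  have C: "q * f * g \<in> C_PDS" if "f \<in> E168" "g \<in> E168" for f g
    using that q E168_C_PDS by (intro C_PDS_mult) auto
  have "\<exists>r\<in>E168. \<forall>g\<in>E168. L2_inner r g = - integral_PDS (q * f * g)" if f: "f \<in> E168" for f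
    by (rule E.Riesz)
      (use C f in \<open>auto simp: distrib_left integral_PDS_add scaleR_mult_fun integral_PDS_scale\<close>)
  then obtain r where r: "\<And>f. f \<in> E168 \<Longrightarrow> r f \<in> E168"
    "\<And>f g. f \<in> E168 \<Longrightarrow> g \<in> E168 \<Longrightarrow> L2_inner (r f) g = - integral_PDS (q * f * g)" by metis
  have "r (f + g) = r f + r g" if "f \<in> E168" "g \<in> E168" for f g
  proof (rule E.ext_ip)
    fix h assume h: "h \<in> E168"
    have "q * (f + g) * h = q * f * h + q * g * h" by (simp add: algebra_simps)
    then show "L2_inner (r (f + g)) h = L2_inner (r f + r g) h"
      using that h r C by (simp add: E.ip_add integral_PDS_add)
  qed (use that r in auto)
  moreover have "r (c *\<^sub>R f) = c *\<^sub>R r f" if "f \<in> E168" for c f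
  proof (rule E.ext_ip)
    fix h assume h: "h \<in> E168"
    have "q * (c *\<^sub>R f) * h = c *\<^sub>R (q * f * h)" by (simp add: scaleR_mult_fun)
    then show "L2_inner (r (c *\<^sub>R f)) h = L2_inner (c *\<^sub>R r f) h"
      using that h r C by (simp add: E.ip_scale integral_PDS_scale)
  qed (use that r in auto)
  moreover have "L2_inner (r f) g = L2_inner f (r g)" if "f \<in> E168" "g \<in> E168" for f g
  proof -
    have "L2_inner f (r g) = L2_inner (r g) f" using that r E.ip_commute by blast
    then show ?thesis using that r by (simp add: mult.assoc mult.commute[of g f])
  qed
  ultimately have "restrict r E168 \<in> Sym_E" unfolding Sym_E_def using r by auto
  then show "\<exists>A. A \<in> Sym_E \<and> (\<forall>f\<in>E168. \<forall>g\<in>E168. L2_inner (A f) g = - integral_PDS (q * f * g))"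
    using r by (intro exI[of _ "restrict r E168"]) auto
next
  fix A B assume A: "A \<in> Sym_E \<and> (\<forall>f\<in>E168. \<forall>g\<in>E168. L2_inner (A f) g = - integral_PDS (q * f * g))"
    and B: "B \<in> Sym_E \<and> (\<forall>f\<in>E168. \<forall>g\<in>E168. L2_inner (B f) g = - integral_PDS (q * f * g))"
  have AE: "A \<in> E168 \<rightarrow>\<^sub>E E168" and BE: "B \<in> E168 \<rightarrow>\<^sub>E E168" using A B by (auto simp: Sym_E_def)
  show "A = B"
  proof (rule PiE_ext[OF AE BE])
    fix f assume f: "f \<in> E168"
    show "A f = B f"
      by (rule E.ext_ip) (use A B f PiE_mem[OF AE f] PiE_mem[OF BE f] in auto)
  qed
qed

lemma B_op:
  assumes q: "q \<in> C_PDS"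
  shows "B_op q \<in> Sym_E"
    and "\<lbrakk>f \<in> E168; g \<in> E168\<rbrakk> \<Longrightarrow> L2_inner (B_op q f) g = - integral_PDS (q * f * g)"
  using theI'[OF B_op_exists[OF q]] unfolding B_op_def[symmetric] by auto

lemma Sym_E_linop: "A \<in> Sym_E \<Longrightarrow> E.linop A"
  by (auto simp: Sym_E_def E.linop_def)

lemma Sym_E_symmetric: "A \<in> Sym_E \<Longrightarrow> f \<in> E168 \<Longrightarrow> g \<in> E168 \<Longrightarrow> L2_inner (A f) g = L2_inner f (A g)"
  by (auto simp: Sym_E_def)

lemma B_op_add:
  assumes "p \<in> C_PDS" "q \<in> C_PDS" and f: "f \<in> E168"
  shows "B_op (p + q) f = B_op p f + B_op q f"
proof (rule E.ext_ip)
  have pq: "p + q \<in> C_PDS" using assms subspace_add[OF subspace_C_PDS] by blast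
  have m: "B_op r f \<in> E168" if "r \<in> C_PDS" for r using E.linopD(1)[OF Sym_E_linop[OF B_op(1)[OF that]] f] .
  show "B_op (p + q) f \<in> E168" "B_op p f + B_op q f \<in> E168" using m pq assms by auto
  fix h assume h: "h \<in> E168"
  have "(p + q) * f * h = p * f * h + q * f * h" by (simp add: algebra_simps)
  moreover have "p * f * h \<in> C_PDS" "q * f * h \<in> C_PDS"
    using assms h E168_C_PDS by (auto intro!: C_PDS_mult)
  ultimately show "L2_inner (B_op (p + q) f) h = L2_inner (B_op p f + B_op q f) h"
    using h f m assms by (simp add: B_op(2)[OF pq] B_op(2)[OF assms(1)] B_op(2)[OF assms(2)] E.ip_add integral_PDS_add)
qed

lemma B_op_scale:
  assumes q: "q \<in> C_PDS" and f: "f \<in> E168"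
  shows "B_op (c *\<^sub>R q) f = c *\<^sub>R B_op q f"
proof (rule E.ext_ip)
  have cq: "c *\<^sub>R q \<in> C_PDS" using q subspace_scale[OF subspace_C_PDS] by blast
  have m: "B_op r f \<in> E168" if "r \<in> C_PDS" for r using E.linopD(1)[OF Sym_E_linop[OF B_op(1)[OF that]] f] .
  show "B_op (c *\<^sub>R q) f \<in> E168" "c *\<^sub>R B_op q f \<in> E168" using m cq q by auto
  fix h assume h: "h \<in> E168"
  have "(c *\<^sub>R q) * f * h = c *\<^sub>R (q * f * h)" by (simp add: scaleR_mult_fun)
  moreover have "q * f * h \<in> C_PDS" using q h f E168_C_PDS by (auto intro!: C_PDS_mult)
  ultimately show "L2_inner (B_op (c *\<^sub>R q) f) h = L2_inner (c *\<^sub>R B_op q f) h"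
    using h f m q by (simp add: B_op(2)[OF cq] B_op(2)[OF q] E.ip_scale integral_PDS_scale)
qed

section \<open>The fixed vectors form a line\<close>

text \<open>
  Binary forms of degree 12 that are invariant under \<open>Istar\<close> are determined by the coefficient of
  \<open>x\<^sup>1\<^sup>1 y\<close>. Invariance under the diagonal element leaves only the monomials \<open>x y\<^sup>1\<^sup>1\<close>, \<open>x\<^sup>6 y\<^sup>6\<close> and
  \<open>x\<^sup>1\<^sup>1 y\<close>, the half turn relates the first to the last, and the tilted half turn fixes the middle
  one.
\<close>

lemma Istar_invariant_form_zero:
  fixes c :: "nat \<Rightarrow> complex" and p :: "complex \<Rightarrow> complex \<Rightarrow> complex"
  assumes p: "\<And>x y. p x y = (\<Sum>j\<le>12. c j * x ^ j * y ^ (12 - j))"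
    and inv: "\<And>h x y. h \<in> Istar \<Longrightarrow> p (h$1$1 * x + h$1$2 * y) (h$2$1 * x + h$2$2 * y) = p x y"
    and c11: "c 11 = 0"
  shows "p x y = 0"
proof -
  have c0: "c j = 0" if j: "j \<le> 12" "j \<noteq> 1" "j \<noteq> 6" "j \<noteq> 11" for j
  proof -
    define w where "w = (\<lambda>j. cis (- pi / 5) ^ j * cis (pi / 5) ^ (12 - j))"
    have "(\<Sum>j\<le>12. (c j * (w j - 1)) * x ^ j) = 0" for x
    proof -
      have "p (cis (- pi / 5) * x) (cis (pi / 5)) - p x 1 = 0"
        using inv[OF fifth_turn_in_Istar, of x 1] by simp
      then have "(\<Sum>j\<le>12. c j * (cis (- pi / 5) * x) ^ j * cis (pi / 5) ^ (12 - j) - c j * x ^ j) = 0"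
        unfolding p by (simp add: sum_subtractf)
      then show ?thesis by (simp add: w_def power_mult_distrib algebra_simps)
    qed
    then have z: "c j * (w j - 1) = 0" using j(1) by (rule polynomial_zero_coeffs)
    have "w j \<noteq> 1"
    proof
      assume w1: "w j = 1"
      have "w j = cis (real j * (- pi / 5) + real (12 - j) * (pi / 5))"
        unfolding w_def by (simp only: Complex.DeMoivre cis_mult)
      then have "cos (real j * (- pi / 5) + real (12 - j) * (pi / 5)) = 1"
        using w1 by (metis cis.sel(1) one_complex.sel(1))
      then obtain k :: int where "real j * (- pi / 5) + real (12 - j) * (pi / 5) = of_int k * 2 * pi"
        unfolding cos_one_2pi_int by blast
      then have "pi * (real (12 - j) - real j) = pi * (10 * of_int k)" by (simp add: algebra_simps)
      then have "real (12 - j) - real j = 10 * of_int k" by simp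
      then have "12 - 2 * int j = 10 * k" using j(1) by (simp add: of_nat_diff)
      then have "6 - int j = 5 * k" by simp
      moreover have "int j \<le> 12" using j(1) by simp
      ultimately have "k = 1 \<or> k = 0 \<or> k = -1" by presburger
      then show False using \<open>6 - int j = 5 * k\<close> j by auto
    qed
    then show ?thesis using z by simp
  qed
  have short: "p x y = c 1 * x * y ^ 11 + c 6 * x ^ 6 * y ^ 6" for x y
  proof -
    have "p x y = (\<Sum>j\<in>{1, 6, 11}. c j * x ^ j * y ^ (12 - j))"
      unfolding p by (rule sum.mono_neutral_right) (auto simp: c0)
    then show ?thesis by (simp add: c11)
  qed
  have "p (- 1) 1 = p 1 1" using inv[OF half_turn_in_Istar, of 1 1] by simp
  then have "- c 1 = c 1" by (simp add: short)
  then have c1: "c 1 = 0" by simp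
  define cc ss where "cc = sqrt ((1 + 1 / sqrt 5) / 2)" and "ss = sqrt ((1 - 1 / sqrt 5) / 2)"
  have s5: "1 / sqrt 5 < (1::real)" by simp
  have sq: "cc\<^sup>2 = (1 + 1 / sqrt 5) / 2" "ss\<^sup>2 = (1 - 1 / sqrt 5) / 2"
    using s5 by (simp_all add: cc_def ss_def)
  have pos: "cc > 0" "ss > 0" using s5 by (simp_all add: cc_def ss_def add_pos_pos)
  \<comment> \<open>The pole \<open>(1, 0)\<close> is a zero of the form, hence so is its image, whose coordinates are nonzero.\<close>
  have "p (\<i> * cc) (\<i> * ss) = p 1 0"
    using inv[OF tilted_half_turn_in_Istar[OF sq pos], of 1 0] by simp
  then have "c 6 * (\<i> * cc) ^ 6 * (\<i> * ss) ^ 6 = 0" by (simp add: short c1[unfolded One_nat_def])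
  then have "c 6 = 0" using pos by simp
  then show ?thesis by (simp add: short c1[unfolded One_nat_def])
qed

lemma ell_mult_right: "ell a b x y (A ** h) = ell a b (h$1$1 * x + h$1$2 * y) (h$2$1 * x + h$2$2 * y) A"
  by (simp add: ell_def algebra_simps)

lemma ell_mult_left:
  assumes "h \<in> SU2"
  shows "ell a b x y (conj_transpose h ** A) = ell (h$1$1 * a + h$1$2 * b) (h$2$1 * a + h$2$2 * b) x y A"
  using assms by (simp add: SU2_iff ell_def algebra_simps)

text \<open>
  The integrals \<open>G a b x y\<close> of \<open>F\<close> against the twelfth powers form a binary form of degree 12 both
  in \<open>(x, y)\<close> and in \<open>(a, b)\<close>. Right invariance of \<open>F\<close> makes \<open>G\<close> invariant in \<open>(x, y)\<close>, left
  invariance makes it invariant in \<open>(a, b)\<close>, so it vanishes as soon as its coefficient of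
  \<open>a\<^sup>1\<^sup>1 b x\<^sup>1\<^sup>1 y\<close> does.
\<close>

lemma biinvariant_zero:
  fixes F :: "mat2 \<Rightarrow> complex"
  assumes cont: "continuous_on SU2 F"
    and orth: "\<And>n a b x y. n \<noteq> 12 \<Longrightarrow> SU2_integral (\<lambda>A. F A * ell a b x y A ^ n) = 0"
    and right: "\<And>h A. h \<in> Istar \<Longrightarrow> A \<in> SU2 \<Longrightarrow> F (A ** h) = F A"
    and left: "\<And>h A. h \<in> Istar \<Longrightarrow> A \<in> SU2 \<Longrightarrow> F (h ** A) = F A"
    and lead: "SU2_integral (\<lambda>A. F A * ell_coeff 12 11 11 A) = 0"
    and A: "A \<in> SU2"
  shows "F A = 0"
proof -
  define m where "m = (\<lambda>i j. SU2_integral (\<lambda>A. F A * ell_coeff 12 i j A))"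
  define G where "G = (\<lambda>a b x y. SU2_integral (\<lambda>A. F A * ell a b x y A ^ 12))"
  define cf where "cf = (\<lambda>j a b. \<Sum>i\<le>12. m i j * a ^ i * b ^ (12 - i))"
  have cG: "continuous_on SU2 (\<lambda>A. F A * ell a b x y A ^ 12)" for a b x y
    by (intro continuous_intros cont)
  have G: "G a b x y = (\<Sum>j\<le>12. cf j a b * x ^ j * y ^ (12 - j))" for a b x y
  proof -
    have "G a b x y = (\<Sum>i\<le>12. \<Sum>j\<le>12. m i j * a ^ i * b ^ (12 - i) * x ^ j * y ^ (12 - j))"
      unfolding G_def integral_ell_power[OF cont] m_def
      by (simp only: sum_distrib_right) (simp only: mult_ac)
    also have "\<dots> = (\<Sum>j\<le>12. \<Sum>i\<le>12. m i j * a ^ i * b ^ (12 - i) * x ^ j * y ^ (12 - j))"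
      by (rule sum.swap)
    finally show ?thesis by (simp only: cf_def sum_distrib_right)
  qed
  have Gr: "G a b (h$1$1 * x + h$1$2 * y) (h$2$1 * x + h$2$2 * y) = G a b x y" if h: "h \<in> Istar" for h a b x y
  proof -
    have "G a b x y = SU2_integral (\<lambda>A. F (mat 1 ** A ** h) * ell a b x y (mat 1 ** A ** h) ^ 12)"
      unfolding G_def using Istar_SU2[OF h]
      by (intro SU2_integral_translate[of "mat 1" h "\<lambda>A. F A * ell a b x y A ^ 12", symmetric] cG) auto
    also have "\<dots> = G a b (h$1$1 * x + h$1$2 * y) (h$2$1 * x + h$2$2 * y)"
      unfolding G_def by (rule SU2_integral_cong) (simp add: right h ell_mult_right)
    finally show ?thesis ..
  qed
  have Gl: "G (h$1$1 * a + h$1$2 * b) (h$2$1 * a + h$2$2 * b) x y = G a b x y" if h: "h \<in> Istar" for h a b x y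
  proof -
    have "G a b x y = SU2_integral (\<lambda>A. F (conj_transpose h ** A ** mat 1) * ell a b x y (conj_transpose h ** A ** mat 1) ^ 12)"
      unfolding G_def using Istar_SU2[OF h]
      by (intro SU2_integral_translate[of "conj_transpose h" "mat 1" "\<lambda>A. F A * ell a b x y A ^ 12", symmetric] cG) auto
    also have "\<dots> = G (h$1$1 * a + h$1$2 * b) (h$2$1 * a + h$2$2 * b) x y"
      unfolding G_def
      by (rule SU2_integral_cong) (simp add: left Istar_conj_transpose[OF h] ell_mult_left[OF Istar_SU2[OF h]])
    finally show ?thesis ..
  qed
  have cfl: "cf j (h$1$1 * a + h$1$2 * b) (h$2$1 * a + h$2$2 * b) = cf j a b"
    if h: "h \<in> Istar" and j: "j \<le> 12" for h a b j
  proof -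
    have "(\<Sum>j\<le>12. (cf j (h$1$1 * a + h$1$2 * b) (h$2$1 * a + h$2$2 * b) - cf j a b) * x ^ j) = 0" for x
      using Gl[OF h, of a b x 1] by (simp add: G sum_subtractf left_diff_distrib)
    then have "cf j (h$1$1 * a + h$1$2 * b) (h$2$1 * a + h$2$2 * b) - cf j a b = 0"
      using j by (rule polynomial_zero_coeffs)
    then show ?thesis by simp
  qed
  have "cf 11 a b = 0" for a b
    by (rule Istar_invariant_form_zero[of "cf 11" "\<lambda>i. m i 11"])
      (use cfl lead in \<open>auto simp: cf_def m_def\<close>)
  then have "G a b x y = 0" for a b x y
    by (intro Istar_invariant_form_zero[of "G a b" "\<lambda>j. cf j a b"]) (use Gr in \<open>auto simp: G\<close>)
  then have "SU2_integral (\<lambda>A. F A * ell a b x y A ^ n) = 0" for n a b x y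
    using orth[of n] by (cases "n = 12") (auto simp: G_def)
  then show ?thesis by (rule zero_if_orthogonal_to_ell_powers[OF cont _ A])
qed

lemma Istar_fixed_left_invariant:
  assumes f: "f \<in> Istar_fixed" and h: "h \<in> Istar"
  shows "f (coset (h ** A)) = f (coset A)"
proof -
  have "left_translate (conj_transpose h) f (coset A) = f (coset A)"
    using f Istar_conj_transpose[OF h] by (simp add: Istar_fixed_def)
  then show ?thesis
    using Istar_SU2[OF Istar_conj_transpose[OF h]] by (simp add: left_translate_coset)
qed

text \<open>
  A suitable complex combination \<open>f - k g\<close> has vanishing leading coefficient, so it is zero. The
  scalar \<open>k\<close> is then a quotient of two real values, hence real.
\<close>

lemma Istar_fixed_one_dimensional:
  assumes f: "f \<in> Istar_fixed" and g: "g \<in> Istar_fixed" and "g \<noteq> 0"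
  shows "\<exists>c. f = c *\<^sub>R g"
proof -
  have E: "f \<in> E168" "g \<in> E168" using f g by (auto simp: Istar_fixed_def)
  have C: "f \<in> C_PDS" "g \<in> C_PDS" using E E168_C_PDS by auto
  define m where "m = (\<lambda>f. SU2_integral (\<lambda>A. complex_of_real (f (coset A)) * ell_coeff 12 11 11 A))"
  have cc: "continuous_on SU2 (\<lambda>A. complex_of_real (f (coset A)))" if "f \<in> C_PDS" for f
    using that by (intro continuous_intros C_PDS_continuous)
  have ce: "continuous_on SU2 (\<lambda>A. complex_of_real (f (coset A)) * h A)" if "f \<in> C_PDS" "continuous_on SU2 h" for f h
    by (intro continuous_on_mult cc that)
  have mg: "m g \<noteq> 0"
  proof
    assume "m g = 0"
    then have "complex_of_real (g (coset A)) = 0" if "A \<in> SU2" for A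
      using that E E168_orthogonal_ell_power Istar_fixed_left_invariant[OF g] coset_mult_Istar
      by (intro biinvariant_zero[of "\<lambda>A. complex_of_real (g (coset A))"] cc C) (auto simp: m_def)
    then have "g = 0" using C subspace_0[OF subspace_C_PDS] by (intro C_PDS_ext) auto
    then show False using \<open>g \<noteq> 0\<close> by simp
  qed
  define k where "k = m f / m g"
  have lin: "SU2_integral (\<lambda>A. (complex_of_real (f (coset A)) - k * complex_of_real (g (coset A))) * h A) =
      SU2_integral (\<lambda>A. complex_of_real (f (coset A)) * h A) - k * SU2_integral (\<lambda>A. complex_of_real (g (coset A)) * h A)"
    if h: "continuous_on SU2 h" for h
  proof -
    have "SU2_integral (\<lambda>A. (complex_of_real (f (coset A)) - k * complex_of_real (g (coset A))) * h A) =
        SU2_integral (\<lambda>A. complex_of_real (f (coset A)) * h A - k * (complex_of_real (g (coset A)) * h A))"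
      by (simp add: algebra_simps)
    also have "\<dots> = SU2_integral (\<lambda>A. complex_of_real (f (coset A)) * h A) - SU2_integral (\<lambda>A. k * (complex_of_real (g (coset A)) * h A))"
      by (rule SU2_integral_diff) (intro ce C h continuous_on_mult continuous_on_const)+
    finally show ?thesis by (simp add: SU2_integral_mult_left ce C h)
  qed
  have proportional: "complex_of_real (f (coset A)) - k * complex_of_real (g (coset A)) = 0" if A: "A \<in> SU2" for A
  proof (rule biinvariant_zero[of "\<lambda>A. complex_of_real (f (coset A)) - k * complex_of_real (g (coset A))", OF _ _ _ _ _ A])
    show "continuous_on SU2 (\<lambda>A. complex_of_real (f (coset A)) - k * complex_of_real (g (coset A)))"
      by (intro continuous_intros C_PDS_continuous C)
    show "SU2_integral (\<lambda>A. (complex_of_real (f (coset A)) - k * complex_of_real (g (coset A))) * ell a b x y A ^ n) = 0"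
      if "n \<noteq> 12" for n a b x y
      using that E168_orthogonal_ell_power E by (subst lin) (auto intro!: continuous_intros)
    show "SU2_integral (\<lambda>A. (complex_of_real (f (coset A)) - k * complex_of_real (g (coset A))) * ell_coeff 12 11 11 A) = 0"
      using mg by (subst lin[OF continuous_on_ell_coeff]) (simp add: k_def m_def)
  qed (simp_all add: Istar_fixed_left_invariant f g coset_mult_Istar)
  obtain A0 where A0: "A0 \<in> SU2" "g (coset A0) \<noteq> 0"
    using C_PDS_ext[OF C(2) subspace_0[OF subspace_C_PDS]] \<open>g \<noteq> 0\<close> by auto
  define c where "c = f (coset A0) / g (coset A0)"
  have "k = complex_of_real c" using proportional[OF A0(1)] A0(2) by (simp add: c_def field_simps)
  then have "f (coset A) = c * g (coset A)" if "A \<in> SU2" for A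
    using proportional[OF that] by (simp flip: of_real_mult)
  then have "f = c *\<^sub>R g"
    using C subspace_scale[OF subspace_C_PDS C(2)] by (intro C_PDS_ext) (auto simp: scaleR_fun_def)
  then show ?thesis ..
qed

section \<open>Unique continuation\<close>

lemma norm_SU2_mult:
  assumes a: "a \<in> SU2"
  shows "norm (a ** X) = norm (X :: mat2)"
proof -
  have pair: "(cmod (a$1$1 * z + a$1$2 * w))\<^sup>2 + (cmod (a$2$1 * z + a$2$2 * w))\<^sup>2 = (cmod z)\<^sup>2 + (cmod w)\<^sup>2" for z w
  proof -
    define p q where "p = a$1$1" and "q = a$2$1"
    have e: "a$2$2 = cnj p" "a$1$2 = - cnj q" "p * cnj p + q * cnj q = 1"
      using a by (auto simp: SU2_iff p_def q_def)
    have "complex_of_real ((cmod (p * z - cnj q * w))\<^sup>2 + (cmod (q * z + cnj p * w))\<^sup>2) =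
        (p * cnj p + q * cnj q) * (z * cnj z + w * cnj w)"
      unfolding of_real_add complex_norm_square by (simp add: algebra_simps)
    also have "\<dots> = complex_of_real ((cmod z)\<^sup>2 + (cmod w)\<^sup>2)"
      unfolding of_real_add complex_norm_square e by simp
    finally show ?thesis unfolding of_real_eq_iff e p_def[symmetric] q_def[symmetric] by simp
  qed
  have "(cmod ((a ** X)$1$1))\<^sup>2 + (cmod ((a ** X)$1$2))\<^sup>2 + (cmod ((a ** X)$2$1))\<^sup>2 + (cmod ((a ** X)$2$2))\<^sup>2 =
      (cmod (X$1$1))\<^sup>2 + (cmod (X$1$2))\<^sup>2 + (cmod (X$2$1))\<^sup>2 + (cmod (X$2$2))\<^sup>2"
    using pair[of "X$1$1" "X$2$1"] pair[of "X$1$2" "X$2$2"] by simp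
  then show ?thesis unfolding norm_mat2 by simp
qed

lemma dist_SU2_mult:
  assumes a: "a \<in> SU2"
  shows "dist (conj_transpose a ** X) (mat 1) = dist X a"
proof -
  have "conj_transpose a ** X - mat 1 = conj_transpose a ** (X - a)"
    using SU2_left_inverse[OF a] by (simp add: mat2_eq_iff algebra_simps)
  then show ?thesis using norm_SU2_mult[of "conj_transpose a" "X - a"] a by (auto simp: dist_norm)
qed

lemma left_translate_mult:
  assumes "a \<in> SU2" "b \<in> SU2" "f \<in> E168"
  shows "left_translate (a ** b) f = left_translate a (left_translate b f)"
proof (rule C_PDS_ext)
  show "left_translate (a ** b) f \<in> C_PDS" "left_translate a (left_translate b f) \<in> C_PDS"
    using assms by (auto intro!: left_translate_E168 SU2_mult subsetD[OF E168_C_PDS])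
  fix A assume "A \<in> SU2"
  then show "left_translate (a ** b) f (coset A) = left_translate a (left_translate b f) (coset A)"
    using assms by (simp add: left_translate_coset SU2_mult conj_transpose_mult matrix_mul_assoc)
qed

text \<open>
  Let \<open>W n\<close> consist of the elements of the eigenspace that vanish on the ball of radius \<open>1 / (n + 1)\<close>
  about the identity. This increasing sequence of subspaces is stationary. A translate by a small
  group element of a function in the limit space still vanishes on a smaller ball, so it is in the
  limit space again; as SU(2) is connected, the limit space is stable under all translations, and
  its elements vanish everywhere.
\<close>

lemma E168_unique_continuation:
  assumes g: "g \<in> E168" and r: "r > 0"
    and van: "\<And>A. A \<in> SU2 \<Longrightarrow> dist A (mat 1) < r \<Longrightarrow> g (coset A) = 0"
  shows "g = 0"
proof -
  define W where "W = (\<lambda>n. {f \<in> E168. \<forall>A\<in>SU2. dist A (mat 1) < 1 / real (Suc n) \<longrightarrow> f (coset A) = 0})"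
  have WE: "W n \<subseteq> E168" for n by (auto simp: W_def)
  have subW: "subspace (W n)" for n
  proof (rule subspaceI)
    show "c *\<^sub>R f \<in> W n" if "f \<in> W n" for c f
    proof -
      have "c *\<^sub>R f \<in> E168" using that by (intro subspace_scale[OF subspace_E168]) (auto simp: W_def)
      then show ?thesis using that by (simp add: W_def scaleR_fun_def)
    qed
  qed (auto simp: W_def subspace_0[OF subspace_E168] intro: subspace_add[OF subspace_E168])
  have mono: "W n \<subseteq> W m" if "n \<le> m" for n m
  proof -
    have "1 / real (Suc m) \<le> 1 / real (Suc n)" using that by (intro divide_left_mono) auto
    then show ?thesis by (force simp: W_def)
  qed
  \<comment> \<open>An independent set of largest size in any of the increasing spaces \<open>W n\<close> spans all later ones.\<close>
  obtain B0 where B0: "finite B0" "E168 \<subseteq> span B0" using E168_finite_span by blast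
  define Q where "Q = (\<lambda>k. \<exists>n B. B \<subseteq> W n \<and> independent B \<and> finite B \<and> card B = k)"
  have "Q 0" unfolding Q_def by (intro exI[of _ 0] exI[of _ "{}"]) (auto simp: independent_empty)
  moreover have "k \<le> card B0" if Qk: "Q k" for k
  proof -
    obtain n B where B: "B \<subseteq> W n" "independent B" "card B = k" using Qk by (auto simp: Q_def)
    have "B \<subseteq> span B0" using B(1) WE B0(2) by blast
    then show ?thesis using independent_span_bound[OF B0(1) B(2)] B(3) by simp
  qed
  ultimately obtain k where k: "Q k" "\<And>k'. Q k' \<Longrightarrow> k' \<le> k"
    using GreatestI_nat[of Q 0 "card B0"] Greatest_le_nat[of Q _ "card B0"] by blast
  obtain n B where B: "B \<subseteq> W n" "independent B" "finite B" "card B = k" using k(1) by (auto simp: Q_def)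
  have stable: "W m \<subseteq> W n" if "n \<le> m" for m
  proof
    fix x assume x: "x \<in> W m"
    have "x \<in> span B"
    proof (rule ccontr)
      assume nx: "x \<notin> span B"
      then have "x \<notin> B" using span_base by blast
      moreover have "independent (insert x B)" using nx B(2) by (simp add: independent_insert)
      moreover have "insert x B \<subseteq> W m" using x B(1) mono[OF that] by auto
      ultimately have "Q (Suc k)" unfolding Q_def using B(3,4)
        by (intro exI[of _ m] exI[of _ "insert x B"]) auto
      then show False using k(2) by force
    qed
    then show "x \<in> W n" using span_minimal[OF B(1) subW] by auto
  qed
  \<comment> \<open>Half of the radius that defines \<open>W n\<close>, and itself the radius that defines \<open>W (2 * n + 1)\<close>.\<close>
  define \<rho> where "\<rho> = 1 / real (Suc (2 * n + 1))"
  have \<rho>: "\<rho> > 0" "2 * \<rho> = 1 / real (Suc n)" by (simp_all add: \<rho>_def field_simps)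
  have small: "left_translate a f \<in> W n" if a: "a \<in> SU2" "dist a (mat 1) < \<rho>" and f: "f \<in> W n" for a f
  proof -
    have fE: "f \<in> E168" using f WE by auto
    have "left_translate a f (coset A) = 0" if A: "A \<in> SU2" "dist A (mat 1) < \<rho>" for A
    proof -
      have "dist (conj_transpose a ** A) (mat 1) = dist A a" by (rule dist_SU2_mult[OF a(1)])
      also have "\<dots> \<le> dist A (mat 1) + dist a (mat 1)" by (rule dist_triangle2)
      also have "\<dots> < 1 / real (Suc n)" using a(2) A(2) \<rho>(2) by linarith
      finally have "f (coset (conj_transpose a ** A)) = 0"
        using f SU2_mult[OF SU2_conj_transpose[OF a(1)] A(1)] by (simp add: W_def)
      then show ?thesis by (simp add: left_translate_coset[OF a(1)])
    qed
    then have "left_translate a f \<in> W (2 * n + 1)"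
      using left_translate_E168[OF fE a(1)] by (simp add: W_def \<rho>_def del: of_nat_Suc)
    then show ?thesis using stable[of "2 * n + 1"] by auto
  qed
  define T where "T = {a \<in> SU2. \<forall>f\<in>W n. left_translate a f \<in> W n}"
  have step: "b \<in> T" if a: "a \<in> T" and b: "b \<in> SU2" "dist b a < \<rho>" for a b
  proof -
    have aS: "a \<in> SU2" using a by (simp add: T_def)
    define c where "c = conj_transpose a ** b"
    have c: "c \<in> SU2" "b = a ** c" "dist c (mat 1) < \<rho>"
      using aS b dist_SU2_mult[OF aS, of b] by (auto simp: c_def)
    have "left_translate b f \<in> W n" if f: "f \<in> W n" for f
    proof -
      have "left_translate b f = left_translate a (left_translate c f)"
        using left_translate_mult[OF aS c(1)] f WE c(2) by auto
      moreover have "left_translate a (left_translate c f) \<in> W n"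
        using a small[OF c(1,3) f] by (simp add: T_def)
      ultimately show ?thesis by simp
    qed
    then show ?thesis using b by (simp add: T_def)
  qed
  have "mat 1 \<in> T"
    using small[of "mat 1"] \<rho>(1) by (simp add: T_def)
  moreover have "openin (top_of_set SU2) T"
    unfolding openin_euclidean_subtopology_iff using step \<rho>(1) by (auto simp: T_def)
  moreover have "openin (top_of_set SU2) (SU2 - T)"
    unfolding openin_euclidean_subtopology_iff
  proof (intro conjI ballI)
    fix x assume x: "x \<in> SU2 - T"
    show "\<exists>e>0. \<forall>x'\<in>SU2. dist x' x < e \<longrightarrow> x' \<in> SU2 - T"
      using x step[of _ x] \<rho>(1) by (intro exI[of _ \<rho>]) (auto simp: dist_commute)
  qed auto
  then have "closedin (top_of_set SU2) T" by (auto simp: closedin_def T_def)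
  ultimately have T: "T = SU2" using connected_SU2 unfolding connected_clopen by blast
  have vanish: "f = 0" if f: "f \<in> W n" for f
  proof (rule C_PDS_ext)
    show "f \<in> C_PDS" "0 \<in> C_PDS" using f WE E168_C_PDS subspace_0[OF subspace_C_PDS] by auto
    fix A assume A: "A \<in> SU2"
    then have "conj_transpose A \<in> T" using T by auto
    then have "left_translate (conj_transpose A) f \<in> W n" using f by (simp add: T_def)
    then have "left_translate (conj_transpose A) f (coset (mat 1)) = 0" by (simp add: W_def)
    then show "f (coset A) = 0 (coset A)"
      using SU2_conj_transpose[OF A] by (simp add: left_translate_coset)
  qed
  obtain m where m: "1 / real (Suc m) < r"
    using reals_Archimedean[OF r] by (auto simp: inverse_eq_divide)
  have "g \<in> W m" using g van m by (auto simp: W_def)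
  then have "g \<in> W (max m n)" using mono[of m "max m n"] by auto
  then have "g \<in> W n" using stable[of "max m n"] by auto
  then show ?thesis by (rule vanish)
qed

section \<open>Evaluation at the base point\<close>

lemma L2_inner_left_translate:
  assumes a: "a \<in> SU2" and f: "f \<in> E168" and g: "g \<in> E168"
  shows "L2_inner (left_translate a f) (left_translate a g) = L2_inner f g"
proof -
  have C: "f * g \<in> C_PDS" "left_translate a f * left_translate a g \<in> C_PDS"
    using f g left_translate_E168[OF f a] left_translate_E168[OF g a] E168_C_PDS
    by (auto intro!: C_PDS_mult)
  have "SU2_integral (\<lambda>A. (f * g) (coset (conj_transpose a ** A ** mat 1))) = SU2_integral (\<lambda>A. (f * g) (coset A))"
    using a by (intro SU2_integral_translate[of _ _ "\<lambda>A. (f * g) (coset A)"] C_PDS_continuous C) auto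
  then show ?thesis
    unfolding L2_inner_def integral_PDS_eq[OF C(1)] integral_PDS_eq[OF C(2)]
    by (simp add: left_translate_coset[OF a])
qed

lemma left_translate_inverse:
  assumes a: "a \<in> SU2" and f: "f \<in> E168"
  shows "left_translate a (left_translate (conj_transpose a) f) = f"
proof (rule C_PDS_ext)
  show "left_translate a (left_translate (conj_transpose a) f) \<in> C_PDS" "f \<in> C_PDS"
    using assms by (auto intro!: left_translate_E168 SU2_conj_transpose subsetD[OF E168_C_PDS])
qed (use a in \<open>simp add: left_translate_coset SU2_conj_transpose\<close>)

lemma evaluation_kernel_exists:
  "\<exists>K\<in>E168. \<forall>f\<in>E168. L2_inner K f = f (coset (mat 1))"
  by (rule E.Riesz) (auto simp: scaleR_fun_def)

text \<open>
  Evaluation at the base point is invariant under \<open>Istar\<close>, because \<open>Istar\<close> fixes the base point.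
\<close>

lemma evaluation_kernel_fixed:
  assumes K: "K \<in> E168" "\<And>f. f \<in> E168 \<Longrightarrow> L2_inner K f = f (coset (mat 1))"
  shows "K \<in> Istar_fixed"
proof -
  have "left_translate a K = K" if a: "a \<in> Istar" for a
  proof (rule E.ext_ip)
    have aS: "a \<in> SU2" using a by (rule Istar_SU2)
    show "left_translate a K \<in> E168" by (rule left_translate_E168[OF K(1) aS])
    fix h assume h: "h \<in> E168"
    define h' where "h' = left_translate (conj_transpose a) h"
    have h': "h' \<in> E168" unfolding h'_def by (rule left_translate_E168[OF h SU2_conj_transpose[OF aS]])
    have "L2_inner (left_translate a K) h = L2_inner (left_translate a K) (left_translate a h')"
      by (simp add: h'_def left_translate_inverse[OF aS h])
    also have "\<dots> = h' (coset (mat 1))"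
      by (simp add: L2_inner_left_translate[OF aS K(1) h'] K(2)[OF h'])
    also have "\<dots> = h (coset (mat 1 ** a))"
      by (simp add: h'_def left_translate_coset[OF SU2_conj_transpose[OF aS]])
    also have "\<dots> = L2_inner K h" by (simp only: coset_mult_Istar[OF a] K(2)[OF h])
    finally show "L2_inner (left_translate a K) h = L2_inner K h" .
  qed (rule K)
  then show ?thesis using K(1) by (simp add: Istar_fixed_def)
qed

text \<open>
  If every element of the eigenspace vanished at the base point, then by translation it would
  vanish everywhere.
\<close>

lemma evaluation_kernel_nonzero:
  assumes K: "K \<in> E168" "\<And>f. f \<in> E168 \<Longrightarrow> L2_inner K f = f (coset (mat 1))"
    and f: "f \<in> E168" "f \<noteq> 0"
  shows "K \<noteq> 0"
proof
  assume "K = 0"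
  have "f (coset A) = 0" if A: "A \<in> SU2" for A
  proof -
    have "left_translate (conj_transpose A) f \<in> E168"
      using f A by (intro left_translate_E168) auto
    then have "left_translate (conj_transpose A) f (coset (mat 1)) = 0"
      using K \<open>K = 0\<close> by (metis E.ip_zero(1))
    then show ?thesis using SU2_conj_transpose[OF A] by (simp add: left_translate_coset)
  qed
  then have "f = 0" using f E168_C_PDS subspace_0[OF subspace_C_PDS] by (intro C_PDS_ext) auto
  then show False using f by simp
qed

text \<open>
  The parameter \<open>q\<close> is the kernel that represents evaluation at the base point on the space of
  products: integrating \<open>q f g\<close> gives \<open>f g\<close> at that point, a form of rank one in \<open>f\<close> and \<open>g\<close>.
\<close>

lemma evaluation_rank_one:
  assumes K: "K \<in> E168" "\<And>f. f \<in> E168 \<Longrightarrow> L2_inner K f = f (coset (mat 1))"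
  shows "\<exists>q\<in>products_E. \<forall>f\<in>E168. B_op q f = - (L2_inner f K) *\<^sub>R K"
proof -
  have "\<exists>q\<in>products_E. \<forall>p\<in>products_E. L2_inner q p = p (coset (mat 1))"
    by (rule P.Riesz) (auto simp: scaleR_fun_def)
  then obtain q where q: "q \<in> products_E" "\<And>p. p \<in> products_E \<Longrightarrow> L2_inner q p = p (coset (mat 1))" by blast
  have qC: "q \<in> C_PDS" using q(1) products_E_C_PDS by blast
  have "B_op q f = - (L2_inner f K) *\<^sub>R K" if f: "f \<in> E168" for f
  proof (rule E.ext_ip)
    show "B_op q f \<in> E168" using E.linopD(1)[OF Sym_E_linop[OF B_op(1)[OF qC]] f] .
    show "- L2_inner f K *\<^sub>R K \<in> E168" by (intro E.S_scale K)
    fix g assume g: "g \<in> E168"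
    have "L2_inner (B_op q f) g = - L2_inner q (f * g)"
      using B_op(2)[OF qC f g] by (simp add: L2_inner_def mult.assoc)
    also have "\<dots> = - (f (coset (mat 1)) * g (coset (mat 1)))"
      using q(2)[OF E168_mult_products_E[OF f g]] by simp
    also have "\<dots> = - (L2_inner f K * L2_inner K g)"
      using K f g E.ip_commute[OF f K(1)] by simp
    also have "\<dots> = L2_inner (- L2_inner f K *\<^sub>R K) g"
      by (simp only: E.ip_scale[OF K(1) g])
    finally show "L2_inner (B_op q f) g = L2_inner (- L2_inner f K *\<^sub>R K) g" .
  qed
  then show ?thesis using q(1) by blast
qed

text \<open>
  A vector \<open>g\<close> orthogonal to the image satisfies \<open>\<integral> q K g = 0\<close> for all products \<open>q\<close>, in particular
  for \<open>q = K g\<close>. Thus \<open>K g = 0\<close>, and \<open>g\<close> vanishes near the base point.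
\<close>

lemma B_op_surjective_at:
  assumes K: "K \<in> E168" and K1: "K (coset (mat 1)) \<noteq> 0" and h: "h \<in> E168"
  shows "\<exists>q\<in>products_E. B_op q K = h"
proof -
  define R where "R = (\<lambda>q. B_op q K) ` products_E"
  have qC: "q \<in> C_PDS" if "q \<in> products_E" for q using that products_E_C_PDS by blast
  have m: "B_op q K \<in> E168" if "q \<in> products_E" for q
    using E.linopD(1)[OF Sym_E_linop[OF B_op(1)[OF qC[OF that]]] K] .
  have "subspace R"
  proof (rule subspaceI)
    have "B_op (0 *\<^sub>R 0) K = 0 *\<^sub>R B_op 0 K"
      by (rule B_op_scale[OF qC[OF P.S_zero] K])
    then show "0 \<in> R" unfolding R_def by (intro image_eqI[of _ _ 0]) auto
  next
    fix x y assume "x \<in> R" "y \<in> R"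
    then obtain p q where pq: "p \<in> products_E" "q \<in> products_E" "x = B_op p K" "y = B_op q K"
      by (auto simp: R_def)
    then have "x + y = B_op (p + q) K" using B_op_add[OF qC qC K] by simp
    then show "x + y \<in> R" using pq unfolding R_def by (intro image_eqI[of _ _ "p + q"]) auto
  next
    fix x c assume "x \<in> R"
    then obtain p where p: "p \<in> products_E" "x = B_op p K" by (auto simp: R_def)
    then have "c *\<^sub>R x = B_op (c *\<^sub>R p) K" using B_op_scale[OF qC K] by simp
    then show "c *\<^sub>R x \<in> R" using p unfolding R_def by (intro image_eqI[of _ _ "c *\<^sub>R p"]) auto
  qed
  moreover have "R \<subseteq> E168" using m by (auto simp: R_def)
  moreover have "g = 0" if g: "g \<in> E168" and orth: "\<And>r. r \<in> R \<Longrightarrow> L2_inner r g = 0" for g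
  proof -
    have Kg: "K * g \<in> products_E" by (rule E168_mult_products_E[OF K g])
    have "L2_inner (B_op (K * g) K) g = - integral_PDS ((K * g) * K * g)"
      by (rule B_op(2)[OF qC[OF Kg] K g])
    moreover have "L2_inner (B_op (K * g) K) g = 0" using orth Kg by (auto simp: R_def)
    ultimately have "integral_PDS ((K * g) * (K * g)) = 0" by (simp add: mult.assoc)
    then have "K * g = 0" by (rule integral_PDS_square_eq_0[OF qC[OF Kg]])
    then have prod: "K x * g x = 0" for x by (metis times_fun_apply zero_fun_apply)
    have "continuous_on SU2 (\<lambda>A. K (coset A))" using K E168_C_PDS by (intro C_PDS_continuous) auto
    then obtain d where d: "d > 0"
      "\<And>A. A \<in> SU2 \<Longrightarrow> dist A (mat 1) < d \<Longrightarrow> dist (K (coset A)) (K (coset (mat 1))) < \<bar>K (coset (mat 1))\<bar>"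
      using K1 SU2_mat_1 unfolding continuous_on_iff by (metis zero_less_abs_iff)
    have "g (coset A) = 0" if "A \<in> SU2" "dist A (mat 1) < d" for A
      using d(2)[OF that] prod[of "coset A"] by (auto simp: dist_real_def)
    then show ?thesis by (rule E168_unique_continuation[OF g d(1)])
  qed
  ultimately have "R = E168" by (rule E.subspace_eq_if_orthogonal_trivial)
  then have "h \<in> R" using h by simp
  then show ?thesis unfolding R_def by blast
qed

section \<open>The eigenspace is not a line\<close>

lemma E168_constant_zero:
  assumes f: "f \<in> E168" and const: "\<And>A. A \<in> SU2 \<Longrightarrow> f (coset A) = k"
  shows "f = 0"
proof (rule C_PDS_ext)
  show "f \<in> C_PDS" "0 \<in> C_PDS" using f E168_C_PDS subspace_0[OF subspace_C_PDS] by auto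
  fix A assume A: "A \<in> SU2"
  have "(deriv ^^ 2) (\<lambda>t. f (coset (geo e t A))) 0 = 0" if e: "e \<in> quaternion_units" for e
  proof -
    have "(\<lambda>t. f (coset (geo e t A))) = (\<lambda>t. k)" using const[OF geo_SU2[OF e A]] by simp
    moreover have "deriv (\<lambda>t::real. k) = (\<lambda>t. 0)" "deriv (\<lambda>t::real. 0::real) = (\<lambda>t. 0)" by (auto simp: fun_eq_iff)
    ultimately show ?thesis by (simp add: numeral_2_eq_2)
  qed
  then have "laplacian_SU2 (\<lambda>A. f (coset A)) A = 0" by (simp add: laplacian_SU2_alt)
  then show "f (coset A) = 0 (coset A)" using f A by (simp add: E168_iff)
qed

text \<open>
  If the eigenspace were the line of \<open>K\<close>, then SU(2) would act on it by signs, so the square of \<open>K\<close>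
  and by connectedness \<open>K\<close> itself would be constant; but constants have Laplacian zero. That a
  second eigenvalue exists at all depends on this.
\<close>

lemma E168_orthogonal_vector_exists:
  assumes K: "K \<in> E168" "K \<noteq> 0"
  shows "\<exists>g\<in>E168. g \<noteq> 0 \<and> L2_inner g K = 0"
proof (rule ccontr)
  assume no: "\<not> ?thesis"
  have KK: "L2_inner K K > 0" by (rule E.ip_pos[OF K])
  have line: "\<exists>c. f = c *\<^sub>R K" if f: "f \<in> E168" for f
  proof -
    define c where "c = L2_inner f K / L2_inner K K"
    have "L2_inner (f - c *\<^sub>R K) K = 0"
      using f K KK by (simp add: E.ip_diff E.ip_scale c_def)
    moreover have "f - c *\<^sub>R K \<in> E168" using f K by (intro E.S_diff E.S_scale)
    ultimately have "f - c *\<^sub>R K = 0" using no by blast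
    then show ?thesis by auto
  qed
  have sq: "(K (coset A))\<^sup>2 = (K (coset (mat 1)))\<^sup>2" if A: "A \<in> SU2" for A
  proof -
    define b where "b = conj_transpose A"
    have b: "b \<in> SU2" "conj_transpose b = A" using A by (auto simp: b_def)
    obtain c where c: "left_translate b K = c *\<^sub>R K" using line left_translate_E168[OF K(1) b(1)] by blast
    have "L2_inner K K = c\<^sup>2 * L2_inner K K"
      using L2_inner_left_translate[OF b(1) K(1) K(1)] K
      by (simp add: c E.ip_scale E.ip_scale2 power2_eq_square mult.assoc)
    then have "c\<^sup>2 = 1" using KK by simp
    moreover have "K (coset A) = c * K (coset (mat 1))"
      using left_translate_coset[OF b(1), of K "mat 1"] by (simp add: c b scaleR_fun_def)
    ultimately show ?thesis by (simp add: power_mult_distrib)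
  qed
  have "(\<lambda>A. K (coset A)) ` SU2 \<subseteq> {K (coset (mat 1)), - K (coset (mat 1))}"
    using sq by (auto simp: power2_eq_iff)
  then have "finite ((\<lambda>A. K (coset A)) ` SU2)" by (rule finite_subset) simp
  moreover have "continuous_on SU2 (\<lambda>A. K (coset A))" using K E168_C_PDS by (intro C_PDS_continuous) auto
  ultimately have "(\<lambda>A. K (coset A)) constant_on SU2"
    using connected_SU2 by (intro continuous_finite_range_constant)
  then obtain k where "\<And>A. A \<in> SU2 \<Longrightarrow> K (coset A) = k" by (auto simp: constant_on_def)
  then have "K = 0" by (rule E168_constant_zero[OF K(1)])
  then show False using K by simp
qed

section \<open>Simple lowest eigenvalues\<close>

text \<open>
  Eigenvectors for different eigenvalues are orthogonal, hence independent.
\<close>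

lemma finite_op_spectrum:
  assumes A: "A \<in> Sym_E"
  shows "finite (op_spectrum A)"
proof (rule ccontr)
  assume inf: "infinite (op_spectrum A)"
  obtain B0 where B0: "finite B0" "E168 \<subseteq> span B0" using E168_finite_span by blast
  obtain T where T: "T \<subseteq> op_spectrum A" "finite T" "card T = Suc (card B0)"
    using infinite_arbitrarily_large[OF inf] by blast
  have "\<forall>\<nu>\<in>T. \<exists>f. f \<in> E168 \<and> A f = \<nu> *\<^sub>R f \<and> f \<noteq> 0"
    using T(1) by (fastforce simp: op_spectrum_def op_eigenspace_def)
  then obtain v where v: "\<And>\<nu>. \<nu> \<in> T \<Longrightarrow> v \<nu> \<in> E168 \<and> A (v \<nu>) = \<nu> *\<^sub>R v \<nu> \<and> v \<nu> \<noteq> 0" by metis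
  have orth: "L2_inner (v \<nu>) (v \<mu>) = 0" if "\<nu> \<in> T" "\<mu> \<in> T" "\<nu> \<noteq> \<mu>" for \<nu> \<mu>
  proof -
    have "L2_inner (A (v \<nu>)) (v \<mu>) = L2_inner (v \<nu>) (A (v \<mu>))"
      using v that by (intro Sym_E_symmetric[OF A]) auto
    then have "\<nu> * L2_inner (v \<nu>) (v \<mu>) = \<mu> * L2_inner (v \<nu>) (v \<mu>)"
      using v that by (simp add: E.ip_scale E.ip_scale2)
    then show ?thesis using that by simp
  qed
  have inj: "inj_on v T"
  proof (rule inj_onI)
    fix \<nu> \<mu> assume h: "\<nu> \<in> T" "\<mu> \<in> T" "v \<nu> = v \<mu>"
    show "\<nu> = \<mu>"
    proof (rule ccontr)
      assume "\<nu> \<noteq> \<mu>"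
      then have "L2_inner (v \<nu>) (v \<nu>) = 0" using orth h by metis
      then show False using v[OF h(1)] E.ip_self_eq_0 by auto
    qed
  qed
  have "independent (v ` T)"
  proof (rule independent_if_scalars_zero)
    show "finite (v ` T)" using T by simp
    fix u x assume s: "(\<Sum>x\<in>v ` T. u x *\<^sub>R x) = 0" and x: "x \<in> v ` T"
    then obtain \<nu> where \<nu>: "\<nu> \<in> T" "x = v \<nu>" by auto
    have "0 = L2_inner (\<Sum>x\<in>v ` T. u x *\<^sub>R x) x" using s \<nu> v by simp
    also have "\<dots> = (\<Sum>y\<in>v ` T. L2_inner (u y *\<^sub>R y) x)"
      using v \<nu> by (intro E.ip_sum) auto
    also have "\<dots> = (\<Sum>y\<in>v ` T. if y = x then u x * L2_inner x x else 0)"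
    proof (rule sum.cong[OF refl])
      fix y assume "y \<in> v ` T"
      then obtain \<mu> where \<mu>: "\<mu> \<in> T" "y = v \<mu>" by auto
      have "L2_inner (u y *\<^sub>R y) x = u y * L2_inner y x"
        using v \<mu> \<nu> by (simp add: E.ip_scale)
      moreover have "L2_inner y x = 0" if "y \<noteq> x" using orth[OF \<mu>(1) \<nu>(1)] that \<mu> \<nu> by blast
      ultimately show "L2_inner (u y *\<^sub>R y) x = (if y = x then u x * L2_inner x x else 0)" by auto
    qed
    also have "\<dots> = u x * L2_inner x x" using T(2) x by simp
    finally show "u x = 0" using v[OF \<nu>(1)] \<nu>(2) E.ip_self_eq_0 by auto
  qed
  moreover have "v ` T \<subseteq> span B0" using v B0(2) by blast
  ultimately have "card (v ` T) \<le> card B0" using independent_span_bound[OF B0(1)] by blast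
  then show False using card_image[OF inj] T(3) by simp
qed

lemma subspace_op_eigenspace:
  assumes A: "A \<in> Sym_E"
  shows "subspace (op_eigenspace A \<mu>)"
  using E.linopD[OF Sym_E_linop[OF A]] E.linop_sum[OF Sym_E_linop[OF A], of "{}" "\<lambda>x. x"]
  by (intro subspaceI) (auto simp: op_eigenspace_def algebra_simps)

lemma dim_op_eigenspace_pos:
  assumes A: "A \<in> Sym_E" and \<nu>: "\<nu> \<in> op_spectrum A"
  shows "dim (op_eigenspace A \<nu>) > 0"
proof -
  obtain B0 where B0: "finite B0" "E168 \<subseteq> span B0" using E168_finite_span by blast
  obtain f where f: "f \<in> op_eigenspace A \<nu>" "f \<noteq> 0" using \<nu> by (auto simp: op_spectrum_def)
  obtain B where B: "B \<subseteq> op_eigenspace A \<nu>" "independent B" "op_eigenspace A \<nu> \<subseteq> span B"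
    "card B = dim (op_eigenspace A \<nu>)" by (rule basis_exists)
  have "B \<subseteq> span B0" using B(1) B0(2) by (auto simp: op_eigenspace_def)
  then have "finite B" using independent_span_bound[OF B0(1) B(2)] by blast
  moreover have "B \<noteq> {}" using B(3) f by auto
  ultimately have "card B > 0" by (simp add: card_gt_0_iff)
  then show ?thesis using B(4) by simp
qed

text \<open>
  The gap makes the eigenspace of \<open>\<mu>\<close> a line and puts every other eigenvalue above \<open>\<mu>\<close>. So the list
  of eigenvalues with multiplicity starts with \<open>\<mu>\<close>, and its second entry, which exists since the
  orthogonal complement of \<open>F\<close> contains an eigenvector, is larger.
\<close>

lemma simple_lowest_eigenvalue:
  assumes A: "A \<in> Sym_E" and F: "F \<in> E168" "F \<noteq> 0" "A F = \<mu> *\<^sub>R F" and \<delta>: "\<delta> > 0"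
    and gap: "\<And>g. g \<in> E168 \<Longrightarrow> L2_inner g F = 0 \<Longrightarrow> L2_inner (A g) g \<ge> (\<mu> + \<delta>) * L2_inner g g"
  shows "eigenvalue A 1 = \<mu>" "eigenvalue A 1 < eigenvalue A 2" "op_eigenspace A \<mu> = span {F}"
proof -
  note lin = E.linopD[OF Sym_E_linop[OF A]]
  have FF: "L2_inner F F > 0" by (rule E.ip_pos[OF F(1,2)])
  show eig: "op_eigenspace A \<mu> = span {F}"
  proof
    show "span {F} \<subseteq> op_eigenspace A \<mu>"
      using F subspace_op_eigenspace[OF A] by (intro span_minimal) (auto simp: op_eigenspace_def)
    show "op_eigenspace A \<mu> \<subseteq> span {F}"
    proof
      fix f assume "f \<in> op_eigenspace A \<mu>"
      then have f: "f \<in> E168" "A f = \<mu> *\<^sub>R f" by (auto simp: op_eigenspace_def)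
      define c where "c = L2_inner f F / L2_inner F F"
      define g where "g = f + (- c) *\<^sub>R F"
      have g: "g \<in> E168" unfolding g_def using f F by (intro E.S_add E.S_scale) auto
      have orth: "L2_inner g F = 0"
        unfolding g_def E.ip_add[OF f(1) E.S_scale[OF F(1)] F(1)] E.ip_scale[OF F(1) F(1)]
        using FF by (simp add: c_def)
      have "A g = A f + (- c) *\<^sub>R A F"
        unfolding g_def lin(2)[OF f(1) E.S_scale[OF F(1)]] lin(3)[OF F(1)] ..
      then have "A g = \<mu> *\<^sub>R g" using f F by (simp add: g_def algebra_simps)
      then have "(\<mu> + \<delta>) * L2_inner g g \<le> \<mu> * L2_inner g g"
        using gap[OF g orth] E.ip_scale[OF g g] by simp
      then have "L2_inner g g \<le> 0" using \<delta> by (simp add: algebra_simps mult_le_0_iff)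
      then have "g = 0" using E.ip_pos[OF g] by force
      then have "f = c *\<^sub>R F" by (simp add: g_def eq_neg_iff_add_eq_0)
      then show "f \<in> span {F}" by (simp add: span_scale span_base)
    qed
  qed
  have above: "\<nu> > \<mu>" if \<nu>: "\<nu> \<in> op_spectrum A" "\<nu> \<noteq> \<mu>" for \<nu>
  proof -
    obtain f where f: "f \<in> E168" "A f = \<nu> *\<^sub>R f" "f \<noteq> 0"
      using \<nu>(1) by (auto simp: op_spectrum_def op_eigenspace_def)
    have "L2_inner (A f) F = L2_inner f (A F)" by (rule Sym_E_symmetric[OF A f(1) F(1)])
    then have "\<nu> * L2_inner f F = \<mu> * L2_inner f F" using f F by (simp add: E.ip_scale E.ip_scale2)
    then have "L2_inner f F = 0" using \<nu>(2) by simp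
    then have "(\<mu> + \<delta>) * L2_inner f f \<le> \<nu> * L2_inner f f" using gap[OF f(1)] f E.ip_scale[OF f(1) f(1)] by simp
    then have "\<mu> + \<delta> \<le> \<nu>" using E.ip_pos[OF f(1,3)] by simp
    then show ?thesis using \<delta> by simp
  qed
  have \<mu>: "\<mu> \<in> op_spectrum A" using F by (auto simp: op_spectrum_def op_eigenspace_def)
  have "\<exists>\<nu>\<in>op_spectrum A. \<nu> \<noteq> \<mu>"
  proof -
    define H where "H = {g \<in> E168. L2_inner g F = 0}"
    have "subspace H" unfolding H_def
      by (rule subspaceI) (auto simp: E.ip_add E.ip_scale F(1))
    then interpret H: inner_space H L2_inner by (rule E.inner_space_subspace) (auto simp: H_def)
    have AH: "A g \<in> H" if "g \<in> H" for g
    proof -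
      have g: "g \<in> E168" "L2_inner g F = 0" using that by (auto simp: H_def)
      have "L2_inner (A g) F = L2_inner g (A F)" by (rule Sym_E_symmetric[OF A g(1) F(1)])
      then show ?thesis using g F lin(1) by (simp add: H_def E.ip_scale2)
    qed
    have HE: "g \<in> E168" if "g \<in> H" for g using that by (simp add: H_def)
    have "H.linop A" unfolding H.linop_def using AH lin(2,3) HE by blast
    moreover have "L2_inner (A f) g = L2_inner f (A g)" if "f \<in> H" "g \<in> H" for f g
      using Sym_E_symmetric[OF A] that HE by blast
    moreover have "H \<noteq> {0}" using E168_orthogonal_vector_exists[OF F(1,2)] by (auto simp: H_def)
    ultimately obtain \<nu> g where g: "g \<in> H" "g \<noteq> 0" "A g = \<nu> *\<^sub>R g"
      using H.symmetric_eigenvalue_exists by blast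
    have "\<nu> \<noteq> \<mu>"
    proof
      assume "\<nu> = \<mu>"
      then have "g \<in> span {F}" using g HE eig by (auto simp: op_eigenspace_def)
      then obtain c where "g = c *\<^sub>R F" by (auto simp: span_singleton)
      then have "L2_inner g g = 0" using g(1) F(1) by (simp add: H_def E.ip_scale2)
      then show False using g HE E.ip_self_eq_0 by auto
    qed
    moreover have "\<nu> \<in> op_spectrum A" using g HE by (auto simp: op_spectrum_def op_eigenspace_def)
    ultimately show ?thesis by blast
  qed
  then obtain \<nu> where \<nu>: "\<nu> \<in> op_spectrum A" "\<nu> \<noteq> \<mu>" by blast
  have fin: "finite (op_spectrum A)" by (rule finite_op_spectrum[OF A])
  define M where "M = (\<Sum>\<nu>\<in>op_spectrum A. replicate_mset (dim (op_eigenspace A \<nu>)) \<nu>)"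
  define M' where "M' = (\<Sum>\<nu>\<in>op_spectrum A - {\<mu>}. replicate_mset (dim (op_eigenspace A \<nu>)) \<nu>)"
  have "dim (op_eigenspace A \<mu>) = 1"
  proof -
    have "dim {F} = card {F}" using F(2) by (intro dim_eq_card_independent) simp
    then show ?thesis by (simp add: eig dim_span)
  qed
  then have M: "M = add_mset \<mu> M'"
    unfolding M_def M'_def by (subst sum.remove[OF fin \<mu>]) simp
  have setM': "set_mset M' \<subseteq> op_spectrum A - {\<mu>}"
    unfolding M'_def using fin by (subst set_mset_sum) auto
  have "\<nu> \<in># M'"
  proof -
    have "\<nu> \<in># replicate_mset (dim (op_eigenspace A \<nu>)) \<nu>"
      using dim_op_eigenspace_pos[OF A \<nu>(1)] by simp
    then show ?thesis unfolding M'_def using fin \<nu> by (subst set_mset_sum) (auto split: if_splits)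
  qed
  then have ne: "sorted_list_of_multiset M' \<noteq> []" by (metis mset_sorted_list_of_multiset mset.simps(1) empty_iff set_mset_empty)
  have le: "\<mu> < x" if "x \<in> set (sorted_list_of_multiset M')" for x
    using that setM' above by (auto simp: set_sorted_list_of_multiset)
  have list: "sorted_list_of_multiset M = \<mu> # sorted_list_of_multiset M'"
    unfolding M sorted_list_of_multiset_insert using le by (intro insort_is_Cons) (auto simp: less_imp_le)
  show e1: "eigenvalue A 1 = \<mu>" unfolding eigenvalue_def M_def[symmetric] list by simp
  have "eigenvalue A 2 = hd (sorted_list_of_multiset M')"
    unfolding eigenvalue_def M_def[symmetric] list using ne by (simp add: hd_conv_nth)
  then show "eigenvalue A 1 < eigenvalue A 2" using e1 le[OF hd_in_set[OF ne]] by simp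
qed

section \<open>Neighbourhoods in projective space\<close>

lemma L2_dist_eq: "L2_dist f g = E.nrm (f - g)"
  by (simp add: L2_dist_def E.nrm_def)

lemma Metric_space_E168: "Metric_space (E168 - {0}) L2_dist"
proof
  have "L2_inner h h \<ge> 0" for h
    unfolding L2_inner_def integral_PDS_def
    by (intro divide_nonneg_nonneg Bochner_Integration.integral_nonneg) auto
  then show "0 \<le> L2_dist f g" for f g by (simp add: L2_dist_def)
  have "(f - g) * (f - g) = (g - f) * (g - f)" for f g :: "mat2 set \<Rightarrow> real"
    by (simp add: algebra_simps)
  then show "L2_dist f g = L2_dist g f" for f g by (simp add: L2_dist_def L2_inner_def)
  fix f g h assume fg: "f \<in> E168 - {0}" "g \<in> E168 - {0}"
  then show "L2_dist f g = 0 \<longleftrightarrow> f = g" by (simp add: L2_dist_eq E.nrm_eq_0)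
  assume h: "h \<in> E168 - {0}"
  have "f - h = (f - g) + (g - h)" by simp
  then show "L2_dist f h \<le> L2_dist f g + L2_dist g h"
    using fg h E.nrm_triangle[of "f - g" "g - h"] by (simp add: L2_dist_eq)
qed

text \<open>
  The neighbourhood consists of the lines that have a representative at distance less than \<open>\<epsilon>\<close>
  from \<open>K\<close>. The set \<open>D\<close> of all their nonzero vectors is saturated and open, because rescaling by \<open>c\<close>
  changes distances by the factor \<open>\<bar>c\<bar>\<close>.
\<close>

lemma lines_near_realized:
  assumes K: "K \<in> E168" and real: "\<And>F. F \<in> E168 \<Longrightarrow> F \<noteq> 0 \<Longrightarrow> E.nrm (F - K) < \<epsilon> \<Longrightarrow> span {F} \<in> L"
    and \<epsilon>: "\<epsilon> > 0" and F0: "F0 \<in> E168" "F0 \<noteq> 0" "F0 = c0 *\<^sub>R K"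
  shows "\<exists>U. openin projective_E U \<and> span {F0} \<in> U \<and> U \<subseteq> L"
proof -
  interpret Metric_space "E168 - {0}" L2_dist by (rule Metric_space_E168)
  have scale_span: "span {c *\<^sub>R f} = span {f}" if "c \<noteq> 0" for c and f :: "mat2 set \<Rightarrow> real"
    by (rule span_image_scale[of "{f}" "\<lambda>_. c", simplified]) (use that in auto)
  define D where "D = {f \<in> E168 - {0}. \<exists>c. c \<noteq> 0 \<and> E.nrm (c *\<^sub>R f - K) < \<epsilon>}"
  define U where "U = (\<lambda>f. span {f}) ` D"
  have sat: "f \<in> D" if f: "f \<in> E168 - {0}" and fU: "span {f} \<in> U" for f
  proof -
    obtain g c where g: "g \<in> E168 - {0}" "c \<noteq> 0" "E.nrm (c *\<^sub>R g - K) < \<epsilon>" "span {f} = span {g}"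
      using fU by (auto simp: U_def D_def)
    then have "g \<in> span {f}" by (simp add: span_base)
    then obtain d where d: "g = d *\<^sub>R f" by (auto simp: span_singleton)
    then have "c * d \<noteq> 0" using g by auto
    then show ?thesis using f g d unfolding D_def by (auto intro!: exI[of _ "c * d"])
  qed
  have "openin mtopology D"
    unfolding openin_mtopology
  proof (intro conjI allI impI)
    show "D \<subseteq> E168 - {0}" by (auto simp: D_def)
    fix f assume "f \<in> D"
    then obtain c where f: "f \<in> E168" "f \<noteq> 0" and c: "c \<noteq> 0" "E.nrm (c *\<^sub>R f - K) < \<epsilon>" by (auto simp: D_def)
    define r where "r = (\<epsilon> - E.nrm (c *\<^sub>R f - K)) / \<bar>c\<bar>"
    have r: "r > 0" using c by (simp add: r_def)
    have "g \<in> D" if g: "g \<in> mball f r" for g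
    proof -
      have gE: "g \<in> E168" "g \<noteq> 0" and d: "E.nrm (f - g) < r" using g by (auto simp: mball_def L2_dist_eq)
      have mem: "c *\<^sub>R (g - f) \<in> E168" "c *\<^sub>R f - K \<in> E168" using gE f K by (auto intro!: E.S_scale E.S_diff)
      have "c *\<^sub>R g - K = c *\<^sub>R (g - f) + (c *\<^sub>R f - K)" by (simp add: algebra_simps)
      then have "E.nrm (c *\<^sub>R g - K) \<le> E.nrm (c *\<^sub>R (g - f)) + E.nrm (c *\<^sub>R f - K)"
        using E.nrm_triangle[OF mem] by (simp only:)
      also have "E.nrm (c *\<^sub>R (g - f)) = \<bar>c\<bar> * E.nrm (f - g)"
        using gE f E.nrm_minus_commute[OF f(1) gE(1)] by (simp add: E.nrm_scale)
      also have "\<dots> < \<bar>c\<bar> * r" using d c by (intro mult_strict_left_mono) auto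
      also have "\<bar>c\<bar> * r = \<epsilon> - E.nrm (c *\<^sub>R f - K)" using c by (simp add: r_def)
      finally have "E.nrm (c *\<^sub>R g - K) < \<epsilon>" by (simp only: diff_add_cancel)
      then show ?thesis using gE c by (auto simp: D_def)
    qed
    then show "\<exists>r>0. mball f r \<subseteq> D" using r by blast
  qed
  moreover have "{f \<in> topspace mtopology. span {f} \<in> U} = D"
    using sat by (auto simp: U_def D_def)
  moreover have "U \<subseteq> (\<lambda>f. span {f}) ` topspace mtopology" by (auto simp: U_def D_def)
  ultimately have "openin projective_E U"
    unfolding projective_E_def openin_quotient_topology by simp
  moreover have "span {F0} \<in> U"
  proof -
    have c0: "c0 \<noteq> 0" using F0 by auto
    have "E.nrm ((1 / c0) *\<^sub>R F0 - K) < \<epsilon>" using c0 F0(3) \<epsilon> by (simp add: E.nrm_def)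
    then have "F0 \<in> D" unfolding D_def using F0 c0 by (auto intro!: exI[of _ "1 / c0"])
    then show ?thesis by (auto simp: U_def)
  qed
  moreover have "U \<subseteq> L"
  proof
    fix l assume "l \<in> U"
    then obtain f c where f: "f \<in> E168" "f \<noteq> 0" "c \<noteq> 0" "E.nrm (c *\<^sub>R f - K) < \<epsilon>" "l = span {f}"
      by (auto simp: U_def D_def)
    then show "l \<in> L" using real[of "c *\<^sub>R f"] scale_span[of c f] by auto
  qed
  ultimately show ?thesis by blast
qed

theorem corollary11p12:
  fixes F0 :: "mat2 set \<Rightarrow> real"
  assumes "F0 \<in> Istar_fixed" and "F0 \<noteq> 0"
  shows "\<exists>U. openin projective_E U \<and> span {F0} \<in> U \<and> U \<subseteq> lowest_line ` Omega"
proof -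
  have F0: "F0 \<in> E168" using assms(1) by (simp add: Istar_fixed_def)
  obtain K where K: "K \<in> E168" "\<And>f. f \<in> E168 \<Longrightarrow> L2_inner K f = f (coset (mat 1))"
    using evaluation_kernel_exists by blast
  have K0: "K \<noteq> 0" by (rule evaluation_kernel_nonzero[OF K F0 assms(2)])
  obtain c0 where c0: "F0 = c0 *\<^sub>R K"
    using Istar_fixed_one_dimensional[OF assms(1) evaluation_kernel_fixed[OF K] K0] by blast
  have K1: "K (coset (mat 1)) \<noteq> 0" using E.ip_pos[OF K(1) K0] K(2)[OF K(1)] by simp
  obtain q0 where q0: "q0 \<in> products_E" "\<And>f. f \<in> E168 \<Longrightarrow> B_op q0 f = - (L2_inner f K) *\<^sub>R K"
    using evaluation_rank_one[OF K] by blast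
  have qC: "q \<in> C_PDS" if "q \<in> products_E" for q using that products_E_C_PDS by blast
  have "\<exists>\<epsilon>>0. \<forall>F\<in>E168. E.nrm (F - K) < \<epsilon> \<longrightarrow>
    (\<exists>q\<in>products_E. \<exists>\<mu> \<delta>. \<delta> > 0 \<and> B_op q F = \<mu> *\<^sub>R F \<and>
      (\<forall>g\<in>E168. L2_inner g F = 0 \<longrightarrow> L2_inner (B_op q g) g \<ge> (\<mu> + \<delta>) * L2_inner g g))"
  proof (rule E.stable_lowest_direction[where Q = products_E and Bop = B_op and K = K and ?q0.0 = q0])
    show "subspace products_E" by (rule P.subspace_S)
    show "E.linop (B_op q)" if "q \<in> products_E" for q by (rule Sym_E_linop[OF B_op(1)[OF qC[OF that]]])
    show "B_op (p + q) f = B_op p f + B_op q f" if "p \<in> products_E" "q \<in> products_E" "f \<in> E168" for p q f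
      by (rule B_op_add[OF qC[OF that(1)] qC[OF that(2)] that(3)])
    show "B_op (c *\<^sub>R q) f = c *\<^sub>R B_op q f" if "q \<in> products_E" "f \<in> E168" for c q f
      by (rule B_op_scale[OF qC[OF that(1)] that(2)])
    show "\<exists>q\<in>products_E. B_op q K = h" if "h \<in> E168" for h
      by (rule B_op_surjective_at[OF K(1) K1 that])
  qed (fact K(1) K0 q0)+
  then obtain \<epsilon> where \<epsilon>: "\<epsilon> > 0" and near: "\<And>F. F \<in> E168 \<Longrightarrow> E.nrm (F - K) < \<epsilon> \<Longrightarrow>
    (\<exists>q\<in>products_E. \<exists>\<mu> \<delta>. \<delta> > 0 \<and> B_op q F = \<mu> *\<^sub>R F \<and>
      (\<forall>g\<in>E168. L2_inner g F = 0 \<longrightarrow> L2_inner (B_op q g) g \<ge> (\<mu> + \<delta>) * L2_inner g g))"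
    by blast
  show ?thesis
  proof (rule lines_near_realized[OF K(1) _ \<epsilon> F0 assms(2) c0])
    fix F assume F: "F \<in> E168" "F \<noteq> 0" "E.nrm (F - K) < \<epsilon>"
    obtain q \<mu> \<delta> where q: "q \<in> products_E" "\<delta> > 0" "B_op q F = \<mu> *\<^sub>R F"
      "\<And>g. g \<in> E168 \<Longrightarrow> L2_inner g F = 0 \<Longrightarrow> L2_inner (B_op q g) g \<ge> (\<mu> + \<delta>) * L2_inner g g"
      using near[OF F(1,3)] by blast
    note s = simple_lowest_eigenvalue[OF B_op(1)[OF qC[OF q(1)]] F(1,2) q(3,2,4)]
    have "B_op q \<in> Omega" using s(2) q(1) by (simp add: Omega_def B_ops_def)
    moreover have "lowest_line (B_op q) = span {F}" using s(1,3) by (simp add: lowest_line_def)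
    ultimately show "span {F} \<in> lowest_line ` Omega" by (metis imageI)
  qed
qed

end
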